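(* Let $R$ be a ring and let $n$ be a fixed positive integer. The following conditions are equivalent: \begin{itemize} \item[(1)] Every $n$-generated projective right $R$-module is a CS-Rickart module. \item[(2)] The free right $R$-module $R_R^{(n)}$ is a CS-Rickart module. \item[(3)] $\mathrm{Mat}_n(R)$ is a right ACS ring. \item[(4)] Every $n$-generated right ideal of $R$ has the form $P\oplus S$, where $P$ is a projective right $R$-module and $S$ is a singular right ideal of $R$. \item[(5)] The right $R$-module $R_R^{(n)}$ is relatively CS-Rickart to $R_R$. \item[(6)] Every $n$-generated submodule of $R_R^{(n)}$ has the form $P_1\oplus\cdots\oplus P_n\oplus S$, where each of $P_1,\ldots,P_n$ is a projective module which is isomorphic to a submodule of $R_R$, and $S$ is a singular module. \end{itemize}
   Context: All rings are associative with nonzero identity; modules are unitary right modules. A submodule $N$ of $M$ is essential if it meets every nonzero submodule of $M$ nontrivially. A right $R$-module $M$ is CS-Rickart if for every $\varphi\in\mathrm{End}_R(M)$ the submodule $\mathrm{Ker}\,\varphi$ is essential in a direct summand of $M$. A module $M$ is relatively CS-Rickart to a module $N$ if for every $\varphi\in\mathrm{Hom}_R(M,N)$, $\mathrm{Ker}\,\varphi$ is an essential submodule of a direct summand of $M$. A ring $R$ is right ACS if the right annihilator of every element of $R$ is an essential submodule of a direct summand of $R_R$. A module $M$ is singular if every element of $M$ has essential right annihilator in $R_R$. A module is $n$-generated if it can be generated by $n$ elements. $\mathrm{Mat}_n(R)$ is the ring of $n\times n$ matrices over $R$, and $R_R^{(n)}$ is the direct sum of $n$ copies of $R_R$. *)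

theory Defs
  imports "HOL-Algebra.Module" "HOL-Algebra.AbelCoset"
begin

section \<open>Right modules\<close>

text \<open>
  The library's locale for modules demands a commutative ring, but its record of modules and its
  notion of submodule do not.  Both are reused here for right modules over an arbitrary ring, with
  the convention that \<open>r \<odot>\<^bsub>M\<^esub> x\<close> stands for the \<^emph>\<open>right\<close> action \<open>x \<cdot> r\<close>; this is what
  the order of the factors in \<open>smult_assoc\<close> expresses.
  The record inherits fields for a multiplication and a unit, which play no role for modules and
  are left undefined in the concrete modules below.
\<close>

locale right_module = R?: ring R + M?: abelian_group M
  for R :: "('r, 'k) ring_scheme" (structure) and M :: "('r, 'm) module" (structure) +
  assumes smult_closed:
      "\<lbrakk>r \<in> carrier R; x \<in> carrier M\<rbrakk> \<Longrightarrow> r \<odot>\<^bsub>M\<^esub> x \<in> carrier M"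
    and smult_ring_distr:
      "\<lbrakk>r \<in> carrier R; s \<in> carrier R; x \<in> carrier M\<rbrakk> \<Longrightarrow>
        (r \<oplus>\<^bsub>R\<^esub> s) \<odot>\<^bsub>M\<^esub> x = r \<odot>\<^bsub>M\<^esub> x \<oplus>\<^bsub>M\<^esub> s \<odot>\<^bsub>M\<^esub> x"
    and smult_module_distr:
      "\<lbrakk>r \<in> carrier R; x \<in> carrier M; y \<in> carrier M\<rbrakk> \<Longrightarrow>
        r \<odot>\<^bsub>M\<^esub> (x \<oplus>\<^bsub>M\<^esub> y) = r \<odot>\<^bsub>M\<^esub> x \<oplus>\<^bsub>M\<^esub> r \<odot>\<^bsub>M\<^esub> y"
    and smult_assoc:
      "\<lbrakk>r \<in> carrier R; s \<in> carrier R; x \<in> carrier M\<rbrakk> \<Longrightarrow>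
        (r \<otimes>\<^bsub>R\<^esub> s) \<odot>\<^bsub>M\<^esub> x = s \<odot>\<^bsub>M\<^esub> (r \<odot>\<^bsub>M\<^esub> x)"
    and smult_one:
      "x \<in> carrier M \<Longrightarrow> \<one>\<^bsub>R\<^esub> \<odot>\<^bsub>M\<^esub> x = x"

text \<open>A submodule \<open>N\<close> of \<open>M\<close>, regarded as a module, is \<open>M\<lparr>carrier := N\<rparr>\<close>.\<close>

definition module_hom ::
    "('r, 'k) ring_scheme \<Rightarrow> ('r, 'm) module \<Rightarrow> ('r, 'l) module \<Rightarrow> ('m \<Rightarrow> 'l) set" where
  "module_hom R M N = {f \<in> hom (add_monoid M) (add_monoid N).
     \<forall>r \<in> carrier R. \<forall>x \<in> carrier M. f (r \<odot>\<^bsub>M\<^esub> x) = r \<odot>\<^bsub>N\<^esub> f x}"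

definition module_iso ::
    "('r, 'k) ring_scheme \<Rightarrow> ('r, 'm) module \<Rightarrow> ('r, 'l) module \<Rightarrow> bool" where
  "module_iso R M N \<longleftrightarrow> (\<exists>f \<in> module_hom R M N. bij_betw f (carrier M) (carrier N))"

definition essential :: "('r, 'k) ring_scheme \<Rightarrow> ('r, 'm) module \<Rightarrow> 'm set \<Rightarrow> bool" where
  "essential R M N \<longleftrightarrow> submodule N R M \<and>
     (\<forall>K. submodule K R M \<and> K \<noteq> {\<zero>\<^bsub>M\<^esub>} \<longrightarrow> N \<inter> K \<noteq> {\<zero>\<^bsub>M\<^esub>})"

text \<open>\<open>N = A \<oplus> B\<close> as an internal direct sum of submodules of \<open>M\<close>.\<close>

definition direct_sum ::
    "('r, 'k) ring_scheme \<Rightarrow> ('r, 'm) module \<Rightarrow> 'm set \<Rightarrow> 'm set \<Rightarrow> 'm set \<Rightarrow> bool" where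
  "direct_sum R M A B N \<longleftrightarrow> submodule A R M \<and> submodule B R M \<and>
     A \<inter> B = {\<zero>\<^bsub>M\<^esub>} \<and> A <+>\<^bsub>M\<^esub> B = N"

text \<open>
  The same for a family of submodules indexed by a finite set \<open>I\<close>: each element of \<open>N\<close> is a sum
  of elements of the \<open>A i\<close> in exactly one way.
\<close>

definition direct_sum_family ::
    "('r, 'k) ring_scheme \<Rightarrow> ('r, 'm) module \<Rightarrow> 'i set \<Rightarrow> ('i \<Rightarrow> 'm set) \<Rightarrow> 'm set \<Rightarrow> bool" where
  "direct_sum_family R M I A N \<longleftrightarrow> (\<forall>i \<in> I. submodule (A i) R M) \<and>
     bij_betw (\<lambda>x. \<Oplus>\<^bsub>M\<^esub>i \<in> I. x i) (\<Pi>\<^sub>E i \<in> I. A i) N"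

definition direct_summand :: "('r, 'k) ring_scheme \<Rightarrow> ('r, 'm) module \<Rightarrow> 'm set \<Rightarrow> bool" where
  "direct_summand R M D \<longleftrightarrow> (\<exists>E. direct_sum R M D E (carrier M))"

definition essential_in_summand ::
    "('r, 'k) ring_scheme \<Rightarrow> ('r, 'm) module \<Rightarrow> 'm set \<Rightarrow> bool" where
  "essential_in_summand R M N \<longleftrightarrow>
     (\<exists>D. direct_summand R M D \<and> essential R (M\<lparr>carrier := D\<rparr>) N)"

definition generated_submodule ::
    "('r, 'k) ring_scheme \<Rightarrow> ('r, 'm) module \<Rightarrow> 'm set \<Rightarrow> 'm set" where
  "generated_submodule R M X = \<Inter>{N. submodule N R M \<and> X \<subseteq> N}"

text \<open>
  As generators may be repeated (and zero is allowed as a generator), generation by \<open>n\<close> elements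
  is generation by a set of at most \<open>n\<close> elements.
\<close>

definition n_generated :: "('r, 'k) ring_scheme \<Rightarrow> nat \<Rightarrow> ('r, 'm) module \<Rightarrow> bool" where
  "n_generated R n M \<longleftrightarrow> (\<exists>X. X \<subseteq> carrier M \<and> finite X \<and> card X \<le> n \<and>
     generated_submodule R M X = carrier M)"

text \<open>
  The module \<open>R\<^sub>R\<close>; its submodules are the right ideals of \<open>R\<close>.
\<close>

definition regular_module :: "('r, 'k) ring_scheme \<Rightarrow> ('r, 'r) module" where
  "regular_module R = \<lparr>carrier = carrier R, mult = undefined, one = undefined,
     zero = \<zero>\<^bsub>R\<^esub>, add = add R, smult = (\<lambda>r x. x \<otimes>\<^bsub>R\<^esub> r)\<rparr>"

text \<open>The direct sum of copies of \<open>R\<^sub>R\<close> indexed by \<open>I\<close>; so \<open>R\<^sub>R\<^sup>(\<^sup>n\<^sup>)\<close> is the case \<open>I = {..<n}\<close>.\<close>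

definition free_module :: "('r, 'k) ring_scheme \<Rightarrow> 'i set \<Rightarrow> ('r, 'i \<Rightarrow> 'r) module" where
  "free_module R I = \<lparr>carrier = {v \<in> I \<rightarrow>\<^sub>E carrier R. finite {i \<in> I. v i \<noteq> \<zero>\<^bsub>R\<^esub>}},
     mult = undefined, one = undefined,
     zero = (\<lambda>i \<in> I. \<zero>\<^bsub>R\<^esub>),
     add = (\<lambda>v w. \<lambda>i \<in> I. v i \<oplus>\<^bsub>R\<^esub> w i),
     smult = (\<lambda>r v. \<lambda>i \<in> I. v i \<otimes>\<^bsub>R\<^esub> r)\<rparr>"

text \<open>
  The lifting property of projective modules.  A definition cannot quantify over the carrier types
  of the test modules \<open>A\<close> and \<open>B\<close>; the types chosen here have room for \<open>P\<close> itself and for the free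
  module on the set of elements of \<open>P\<close>, and \<open>projective_lifting\<close> below derives the lifting property
  for test modules of arbitrary types.

  For the same reason a statement about all \<open>n\<close>-generated projective modules \<open>M\<close> has to name carrier
  types for \<open>M\<close>: an arbitrary type variable, together with \<open>nat \<Rightarrow> 'r\<close>, which has room for every
  such module up to isomorphism, as a direct summand of \<open>R\<^sub>R\<^sup>(\<^sup>n\<^sup>)\<close>.
\<close>

definition projective :: "('r, 'k) ring_scheme \<Rightarrow> ('r, 'm) module \<Rightarrow> bool" where
  "projective R P \<longleftrightarrow>
     (\<forall>(A :: ('r, 'm \<Rightarrow> 'r) module) (B :: ('r, 'm) module) g h.
        right_module R A \<and> right_module R B \<and>
        g \<in> module_hom R A B \<and> g ` carrier A = carrier B \<and> h \<in> module_hom R P B \<longrightarrow>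
        (\<exists>k \<in> module_hom R P A. \<forall>x \<in> carrier P. g (k x) = h x))"

definition right_annihilator :: "('r, 'k) ring_scheme \<Rightarrow> ('r, 'm) module \<Rightarrow> 'm \<Rightarrow> 'r set" where
  "right_annihilator R M x = {r \<in> carrier R. r \<odot>\<^bsub>M\<^esub> x = \<zero>\<^bsub>M\<^esub>}"

definition singular :: "('r, 'k) ring_scheme \<Rightarrow> ('r, 'm) module \<Rightarrow> bool" where
  "singular R M \<longleftrightarrow>
     (\<forall>x \<in> carrier M. essential R (regular_module R) (right_annihilator R M x))"

section \<open>CS-Rickart modules and ACS rings\<close>

definition CS_Rickart :: "('r, 'k) ring_scheme \<Rightarrow> ('r, 'm) module \<Rightarrow> bool" where
  "CS_Rickart R M \<longleftrightarrow>
     (\<forall>\<phi> \<in> module_hom R M M. essential_in_summand R M (a_kernel M M \<phi>))"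

definition relatively_CS_Rickart ::
    "('r, 'k) ring_scheme \<Rightarrow> ('r, 'm) module \<Rightarrow> ('r, 'l) module \<Rightarrow> bool" where
  "relatively_CS_Rickart R M N \<longleftrightarrow>
     (\<forall>\<phi> \<in> module_hom R M N. essential_in_summand R M (a_kernel M N \<phi>))"

definition right_ACS :: "('r, 'k) ring_scheme \<Rightarrow> bool" where
  "right_ACS R \<longleftrightarrow> (\<forall>a \<in> carrier R.
     essential_in_summand R (regular_module R) (right_annihilator R (regular_module R) a))"

definition Mat :: "nat \<Rightarrow> ('r, 'k) ring_scheme \<Rightarrow> (nat \<times> nat \<Rightarrow> 'r) ring" where
  "Mat n R = \<lparr>carrier = {..<n} \<times> {..<n} \<rightarrow>\<^sub>E carrier R,
     mult = (\<lambda>A B. restrict (\<lambda>(i, j). \<Oplus>\<^bsub>R\<^esub>k \<in> {..<n}. A (i, k) \<otimes>\<^bsub>R\<^esub> B (k, j)) ({..<n} \<times> {..<n})),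
     one = restrict (\<lambda>(i, j). if i = j then \<one>\<^bsub>R\<^esub> else \<zero>\<^bsub>R\<^esub>) ({..<n} \<times> {..<n}),
     zero = restrict (\<lambda>_. \<zero>\<^bsub>R\<^esub>) ({..<n} \<times> {..<n}),
     add = (\<lambda>A B. restrict (\<lambda>ij. A ij \<oplus>\<^bsub>R\<^esub> B ij) ({..<n} \<times> {..<n}))\<rparr>"

definition all_equivalent :: "bool list \<Rightarrow> bool" where
  "all_equivalent ps \<longleftrightarrow> (\<forall>p \<in> set ps. \<forall>q \<in> set ps. p \<longleftrightarrow> q)"

section \<open>Basic facts\<close>

lemma (in right_module) smult_zero_left:
  assumes "x \<in> carrier M"
  shows "\<zero>\<^bsub>R\<^esub> \<odot>\<^bsub>M\<^esub> x = \<zero>\<^bsub>M\<^esub>"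
proof -
  have c: "\<zero>\<^bsub>R\<^esub> \<odot>\<^bsub>M\<^esub> x \<in> carrier M"
    using assms by (simp add: smult_closed)
  have "\<zero>\<^bsub>R\<^esub> \<odot>\<^bsub>M\<^esub> x \<oplus>\<^bsub>M\<^esub> \<zero>\<^bsub>R\<^esub> \<odot>\<^bsub>M\<^esub> x = \<zero>\<^bsub>R\<^esub> \<odot>\<^bsub>M\<^esub> x"
    using smult_ring_distr[of "\<zero>\<^bsub>R\<^esub>" "\<zero>\<^bsub>R\<^esub>" x] assms by simp
  then show ?thesis using c by (metis M.add.l_cancel_one')
qed

lemma (in right_module) smult_zero_right:
  assumes "r \<in> carrier R"
  shows "r \<odot>\<^bsub>M\<^esub> \<zero>\<^bsub>M\<^esub> = \<zero>\<^bsub>M\<^esub>"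
proof -
  have c: "r \<odot>\<^bsub>M\<^esub> \<zero>\<^bsub>M\<^esub> \<in> carrier M"
    using assms by (simp add: smult_closed)
  have "r \<odot>\<^bsub>M\<^esub> \<zero>\<^bsub>M\<^esub> \<oplus>\<^bsub>M\<^esub> r \<odot>\<^bsub>M\<^esub> \<zero>\<^bsub>M\<^esub> = r \<odot>\<^bsub>M\<^esub> \<zero>\<^bsub>M\<^esub>"
    using smult_module_distr[of r "\<zero>\<^bsub>M\<^esub>" "\<zero>\<^bsub>M\<^esub>"] assms by simp
  then show ?thesis using c by (metis M.add.l_cancel_one')
qed

lemma (in right_module) smult_finsum:
  assumes "finite S" and "r \<in> carrier R" and "f \<in> S \<rightarrow> carrier M"
  shows "r \<odot>\<^bsub>M\<^esub> (\<Oplus>\<^bsub>M\<^esub>i \<in> S. f i) = (\<Oplus>\<^bsub>M\<^esub>i \<in> S. r \<odot>\<^bsub>M\<^esub> f i)"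
  using assms
proof (induction S rule: finite_induct)
  case empty
  then show ?case by (simp add: smult_zero_right)
next
  case (insert x F)
  then show ?case
    by (simp add: Pi_def smult_module_distr smult_closed M.finsum_closed)
qed

lemma module_hom_closed:
  "f \<in> module_hom R M N \<Longrightarrow> x \<in> carrier M \<Longrightarrow> f x \<in> carrier N"
  by (auto simp: module_hom_def hom_def)

lemma module_hom_add:
  "f \<in> module_hom R M N \<Longrightarrow> x \<in> carrier M \<Longrightarrow> y \<in> carrier M \<Longrightarrow>
    f (x \<oplus>\<^bsub>M\<^esub> y) = f x \<oplus>\<^bsub>N\<^esub> f y"
  by (auto simp: module_hom_def hom_def)

lemma module_hom_smult:
  "f \<in> module_hom R M N \<Longrightarrow> r \<in> carrier R \<Longrightarrow> x \<in> carrier M \<Longrightarrow>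
    f (r \<odot>\<^bsub>M\<^esub> x) = r \<odot>\<^bsub>N\<^esub> f x"
  by (auto simp: module_hom_def)

lemma module_homI:
  assumes "\<And>x. x \<in> carrier M \<Longrightarrow> f x \<in> carrier N"
    and "\<And>x y. x \<in> carrier M \<Longrightarrow> y \<in> carrier M \<Longrightarrow> f (x \<oplus>\<^bsub>M\<^esub> y) = f x \<oplus>\<^bsub>N\<^esub> f y"
    and "\<And>r x. r \<in> carrier R \<Longrightarrow> x \<in> carrier M \<Longrightarrow> f (r \<odot>\<^bsub>M\<^esub> x) = r \<odot>\<^bsub>N\<^esub> f x"
  shows "f \<in> module_hom R M N"
  using assms by (auto simp: module_hom_def hom_def)

lemma module_hom_compose:
  assumes "f \<in> module_hom R L M" and "g \<in> module_hom R M N"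
  shows "(\<lambda>x. g (f x)) \<in> module_hom R L N"
  by (rule module_homI)
     (simp_all add: module_hom_closed[OF assms(1)] module_hom_closed[OF assms(2)]
        module_hom_add[OF assms(1)] module_hom_add[OF assms(2)]
        module_hom_smult[OF assms(1)] module_hom_smult[OF assms(2)])

lemma module_hom_zero:
  assumes "right_module R M" and "right_module R N" and f: "f \<in> module_hom R M N"
  shows "f \<zero>\<^bsub>M\<^esub> = \<zero>\<^bsub>N\<^esub>"
proof -
  interpret M: right_module R M by fact
  interpret N: right_module R N by fact
  have "f (\<zero>\<^bsub>R\<^esub> \<odot>\<^bsub>M\<^esub> \<zero>\<^bsub>M\<^esub>) = \<zero>\<^bsub>R\<^esub> \<odot>\<^bsub>N\<^esub> f \<zero>\<^bsub>M\<^esub>"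
    by (rule module_hom_smult[OF f]) simp_all
  then show ?thesis
    by (simp add: M.smult_zero_left N.smult_zero_left module_hom_closed[OF f])
qed

lemma module_hom_finsum:
  assumes M: "right_module R M" and N: "right_module R N" and f: "f \<in> module_hom R M N"
    and "finite S" and "u \<in> S \<rightarrow> carrier M"
  shows "f (\<Oplus>\<^bsub>M\<^esub>i \<in> S. u i) = (\<Oplus>\<^bsub>N\<^esub>i \<in> S. f (u i))"
proof -
  interpret M: right_module R M by fact
  interpret N: right_module R N by fact
  show ?thesis using \<open>finite S\<close> \<open>u \<in> S \<rightarrow> carrier M\<close>
  proof (induction S rule: finite_induct)
    case empty
    then show ?case by (simp add: module_hom_zero[OF M N f])
  next
    case (insert x F)
    have "f (u x \<oplus>\<^bsub>M\<^esub> (\<Oplus>\<^bsub>M\<^esub>i \<in> F. u i)) = f (u x) \<oplus>\<^bsub>N\<^esub> f (\<Oplus>\<^bsub>M\<^esub>i \<in> F. u i)"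
      using insert by (intro module_hom_add[OF f] M.M.finsum_closed) auto
    then show ?case using insert
      by (simp add: Pi_def module_hom_closed[OF f])
  qed
qed

lemma right_module_regular:
  assumes "ring R"
  shows "right_module R (regular_module R)"
proof -
  interpret ring R by fact
  show ?thesis
  proof (intro right_module.intro right_module_axioms.intro abelian_groupI)
    fix x assume "x \<in> carrier (regular_module R)"
    then show "\<exists>y\<in>carrier (regular_module R). y \<oplus>\<^bsub>regular_module R\<^esub> x = \<zero>\<^bsub>regular_module R\<^esub>"
      by (intro bexI[of _ "\<ominus>\<^bsub>R\<^esub> x"]) (auto simp: regular_module_def l_neg)
  qed (simp_all add: regular_module_def l_distr r_distr m_assoc a_ac \<open>ring R\<close>)
qed

lemma right_module_free:
  fixes R :: "('r, 'k) ring_scheme" and I :: "'i set"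
  assumes "ring R"
  shows "right_module R (free_module R I)"
proof -
  interpret ring R by fact
  have add: "finite {i \<in> I. v i \<oplus>\<^bsub>R\<^esub> w i \<noteq> \<zero>\<^bsub>R\<^esub>}"
    if "finite {i \<in> I. v i \<noteq> \<zero>\<^bsub>R\<^esub>}" "finite {i \<in> I. w i \<noteq> \<zero>\<^bsub>R\<^esub>}" for v w :: "'i \<Rightarrow> 'r"
    by (rule finite_subset[OF _ finite_UnI[OF that]]) auto
  have smult: "finite {i \<in> I. v i \<otimes>\<^bsub>R\<^esub> r \<noteq> \<zero>\<^bsub>R\<^esub>}"
    if "finite {i \<in> I. v i \<noteq> \<zero>\<^bsub>R\<^esub>}" "r \<in> carrier R" for v :: "'i \<Rightarrow> 'r" and r
    by (rule finite_subset[OF _ that(1)]) (use that(2) in auto)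
  have restr: "{i \<in> I. restrict v I i \<noteq> \<zero>\<^bsub>R\<^esub>} = {i \<in> I. v i \<noteq> \<zero>\<^bsub>R\<^esub>}" for v :: "'i \<Rightarrow> 'r"
    by auto
  show ?thesis
  proof (intro right_module.intro right_module_axioms.intro abelian_groupI)
    fix x assume x: "x \<in> carrier (free_module R I)"
    have "finite {i \<in> I. (\<lambda>i\<in>I. \<ominus>\<^bsub>R\<^esub> x i) i \<noteq> \<zero>\<^bsub>R\<^esub>}"
      by (rule finite_subset[of _ "{i \<in> I. x i \<noteq> \<zero>\<^bsub>R\<^esub>}"])
         (use x in \<open>auto simp: free_module_def\<close>)
    then have "(\<lambda>i\<in>I. \<ominus>\<^bsub>R\<^esub> x i) \<in> carrier (free_module R I)"
      using x by (auto simp: free_module_def PiE_def)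
    then show "\<exists>y\<in>carrier (free_module R I). y \<oplus>\<^bsub>free_module R I\<^esub> x = \<zero>\<^bsub>free_module R I\<^esub>"
      by (rule bexI[rotated])
         (use x in \<open>auto simp: free_module_def PiE_iff l_neg fun_eq_iff restrict_def\<close>)
  next
    fix x y assume "x \<in> carrier (free_module R I)" "y \<in> carrier (free_module R I)"
    then show "x \<oplus>\<^bsub>free_module R I\<^esub> y \<in> carrier (free_module R I)"
      using add[of x y] by (auto simp: free_module_def restr simp del: restrict_apply)
  next
    fix r x assume "r \<in> carrier R" "x \<in> carrier (free_module R I)"
    then show "r \<odot>\<^bsub>free_module R I\<^esub> x \<in> carrier (free_module R I)"
      using smult[of x r] by (auto simp: free_module_def restr simp del: restrict_apply)
  qed (simp_all add: free_module_def PiE_iff l_distr r_distr m_assoc a_ac restrict_def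
        extensional_def fun_eq_iff \<open>ring R\<close>)
qed

text \<open>The linear map from the free module on \<open>X\<close> to \<open>M\<close> that extends \<open>a :: X \<rightarrow> carrier M\<close>.\<close>

definition free_extension ::
    "('r, 'k) ring_scheme \<Rightarrow> ('r, 'm) module \<Rightarrow> 'i set \<Rightarrow> ('i \<Rightarrow> 'm) \<Rightarrow> ('i \<Rightarrow> 'r) \<Rightarrow> 'm" where
  "free_extension R M X a v = (\<Oplus>\<^bsub>M\<^esub>x \<in> {x \<in> X. v x \<noteq> \<zero>\<^bsub>R\<^esub>}. v x \<odot>\<^bsub>M\<^esub> a x)"

lemma free_extension_superset:
  assumes "right_module R M" and a: "a \<in> X \<rightarrow> carrier M" and v: "v \<in> X \<rightarrow> carrier R"
    and S: "finite S" "{x \<in> X. v x \<noteq> \<zero>\<^bsub>R\<^esub>} \<subseteq> S" "S \<subseteq> X"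
  shows "free_extension R M X a v = (\<Oplus>\<^bsub>M\<^esub>x \<in> S. v x \<odot>\<^bsub>M\<^esub> a x)"
proof -
  interpret right_module R M by fact
  show ?thesis
    unfolding free_extension_def
    by (rule M.add.finprod_mono_neutral_cong_left)
       (use a v S in \<open>auto simp: Pi_iff smult_zero_left intro!: smult_closed\<close>)
qed

lemma free_extension_hom:
  assumes M: "right_module R M" and a: "a \<in> X \<rightarrow> carrier M"
  shows "free_extension R M X a \<in> module_hom R (free_module R X) M"
proof (rule module_homI)
  interpret right_module R M by fact
  let ?F = "free_module R X"
  interpret F: right_module R ?F
    by (rule right_module_free) (rule R.ring_axioms)
  have supp: "finite {x \<in> X. v x \<noteq> \<zero>\<^bsub>R\<^esub>}" and fn: "v \<in> X \<rightarrow> carrier R" if "v \<in> carrier ?F" for v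
    using that by (auto simp: free_module_def)
  {
    fix v assume v: "v \<in> carrier ?F"
    show "free_extension R M X a v \<in> carrier M"
      unfolding free_extension_def using fn[OF v] a
      by (auto intro!: M.finsum_closed smult_closed)
  next
    fix v w assume v: "v \<in> carrier ?F" and w: "w \<in> carrier ?F"
    let ?S = "{x \<in> X. v x \<noteq> \<zero>\<^bsub>R\<^esub>} \<union> {x \<in> X. w x \<noteq> \<zero>\<^bsub>R\<^esub>}"
    have vw: "v \<oplus>\<^bsub>?F\<^esub> w \<in> carrier ?F" using v w by simp
    have S: "finite ?S" "?S \<subseteq> X" using supp[OF v] supp[OF w] by auto
    have ap: "(v \<oplus>\<^bsub>?F\<^esub> w) x = v x \<oplus>\<^bsub>R\<^esub> w x" if "x \<in> X" for x
      using that by (simp add: free_module_def)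
    have "free_extension R M X a (v \<oplus>\<^bsub>?F\<^esub> w) = (\<Oplus>\<^bsub>M\<^esub>x \<in> ?S. (v \<oplus>\<^bsub>?F\<^esub> w) x \<odot>\<^bsub>M\<^esub> a x)"
      by (rule free_extension_superset[OF M a fn[OF vw] S(1)]) (auto simp: ap)
    also have "\<dots> = (\<Oplus>\<^bsub>M\<^esub>x \<in> ?S. v x \<odot>\<^bsub>M\<^esub> a x \<oplus>\<^bsub>M\<^esub> w x \<odot>\<^bsub>M\<^esub> a x)"
      by (rule M.add.finprod_cong')
         (use a fn[OF v] fn[OF w] in \<open>auto simp: ap Pi_iff intro!: smult_ring_distr smult_closed\<close>)
    also have "\<dots> = (\<Oplus>\<^bsub>M\<^esub>x \<in> ?S. v x \<odot>\<^bsub>M\<^esub> a x) \<oplus>\<^bsub>M\<^esub> (\<Oplus>\<^bsub>M\<^esub>x \<in> ?S. w x \<odot>\<^bsub>M\<^esub> a x)"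
      by (rule M.finsum_addf) (use a fn[OF v] fn[OF w] in \<open>auto intro!: smult_closed\<close>)
    also have "(\<Oplus>\<^bsub>M\<^esub>x \<in> ?S. v x \<odot>\<^bsub>M\<^esub> a x) = free_extension R M X a v"
      by (rule free_extension_superset[OF M a fn[OF v] S(1), symmetric]) auto
    also have "(\<Oplus>\<^bsub>M\<^esub>x \<in> ?S. w x \<odot>\<^bsub>M\<^esub> a x) = free_extension R M X a w"
      by (rule free_extension_superset[OF M a fn[OF w] S(1), symmetric]) auto
    finally show "free_extension R M X a (v \<oplus>\<^bsub>?F\<^esub> w) =
      free_extension R M X a v \<oplus>\<^bsub>M\<^esub> free_extension R M X a w" .
  next
    fix r v assume r: "r \<in> carrier R" and v: "v \<in> carrier ?F"
    let ?S = "{x \<in> X. v x \<noteq> \<zero>\<^bsub>R\<^esub>}"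
    have rv: "r \<odot>\<^bsub>?F\<^esub> v \<in> carrier ?F" using r v by (simp add: F.smult_closed)
    have ap: "(r \<odot>\<^bsub>?F\<^esub> v) x = v x \<otimes>\<^bsub>R\<^esub> r" if "x \<in> X" for x
      using that by (simp add: free_module_def)
    have "free_extension R M X a (r \<odot>\<^bsub>?F\<^esub> v) = (\<Oplus>\<^bsub>M\<^esub>x \<in> ?S. (r \<odot>\<^bsub>?F\<^esub> v) x \<odot>\<^bsub>M\<^esub> a x)"
      by (rule free_extension_superset[OF M a fn[OF rv] supp[OF v]]) (use r in \<open>auto simp: ap\<close>)
    also have "\<dots> = (\<Oplus>\<^bsub>M\<^esub>x \<in> ?S. r \<odot>\<^bsub>M\<^esub> (v x \<odot>\<^bsub>M\<^esub> a x))"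
      by (rule M.add.finprod_cong')
         (use r a fn[OF v] in \<open>auto simp: ap Pi_iff intro!: smult_assoc smult_closed\<close>)
    also have "\<dots> = r \<odot>\<^bsub>M\<^esub> free_extension R M X a v"
      unfolding free_extension_def
      by (rule smult_finsum[symmetric])
         (use r a fn[OF v] supp[OF v] in \<open>auto intro!: smult_closed\<close>)
    finally show "free_extension R M X a (r \<odot>\<^bsub>?F\<^esub> v) = r \<odot>\<^bsub>M\<^esub> free_extension R M X a v" .
  }
qed

lemma free_extension_surj:
  assumes M: "right_module R M"
  shows "free_extension R M (carrier M) (\<lambda>x. x) ` carrier (free_module R (carrier M)) = carrier M"
    (is "?e ` carrier ?F = _")
proof
  interpret right_module R M by fact
  show "?e ` carrier ?F \<subseteq> carrier M"
    using module_hom_closed[OF free_extension_hom[OF M, of "\<lambda>x. x" "carrier M"]] by auto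
  show "carrier M \<subseteq> ?e ` carrier ?F"
  proof
    fix x assume x: "x \<in> carrier M"
    let ?v = "\<lambda>y\<in>carrier M. if y = x then \<one>\<^bsub>R\<^esub> else \<zero>\<^bsub>R\<^esub>"
    have "finite {y \<in> carrier M. ?v y \<noteq> \<zero>\<^bsub>R\<^esub>}"
      by (rule finite_subset[of _ "{x}"]) auto
    then have v: "?v \<in> carrier ?F"
      by (auto simp: free_module_def)
    have "?e ?v = (\<Oplus>\<^bsub>M\<^esub>y \<in> {x}. ?v y \<odot>\<^bsub>M\<^esub> y)"
      by (rule free_extension_superset[OF M]) (use x in auto)
    also have "\<dots> = x"
      using x by (simp add: smult_one)
    finally show "x \<in> ?e ` carrier ?F" using v by (metis imageI)
  qed
qed

theorem projective_lifting:
  fixes R :: "('r, 'k) ring_scheme" and P :: "('r, 'm) module"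
    and A :: "('r, 'a) module" and B :: "('r, 'b) module"
  assumes P: "right_module R P" and proj: "projective R P"
    and A: "right_module R A" and B: "right_module R B"
    and g: "g \<in> module_hom R A B" "g ` carrier A = carrier B" and h: "h \<in> module_hom R P B"
  shows "\<exists>k \<in> module_hom R P A. \<forall>x \<in> carrier P. g (k x) = h x"
proof -
  interpret P: right_module R P by fact
  interpret A: right_module R A by fact
  interpret B: right_module R B by fact
  define X where "X = carrier P"
  let ?F = "free_module R X"
  let ?e = "free_extension R P X (\<lambda>x. x)"
  have e: "?e \<in> module_hom R ?F P"
    by (rule free_extension_hom[OF P]) (simp add: X_def)
  have "(\<lambda>x. x) \<in> module_hom R P P" by (rule module_homI) auto
  then obtain s where s: "s \<in> module_hom R P ?F" and es: "\<And>x. x \<in> carrier P \<Longrightarrow> ?e (s x) = x"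
    using proj[unfolded projective_def, rule_format, of ?F P ?e "\<lambda>x. x"] e P
      free_extension_surj[OF P] right_module_free[OF P.R.ring_axioms, of X]
    by (auto simp: X_def)
  have "\<forall>x \<in> X. \<exists>y \<in> carrier A. g y = h x"
    using g(2) module_hom_closed[OF h] unfolding X_def by (metis imageE)
  then obtain a where a: "\<And>x. x \<in> X \<Longrightarrow> a x \<in> carrier A" "\<And>x. x \<in> X \<Longrightarrow> g (a x) = h x"
    by metis
  let ?k = "free_extension R A X a"
  have k: "?k \<in> module_hom R ?F A"
    by (rule free_extension_hom[OF A]) (use a in auto)
  have "g (?k v) = h (?e v)" if v: "v \<in> carrier ?F" for v
  proof -
    let ?S = "{x \<in> X. v x \<noteq> \<zero>\<^bsub>R\<^esub>}"
    have S: "finite ?S" and vR: "\<And>x. x \<in> X \<Longrightarrow> v x \<in> carrier R"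
      using v by (auto simp: free_module_def)
    have "g (?k v) = (\<Oplus>\<^bsub>B\<^esub>x \<in> ?S. g (v x \<odot>\<^bsub>A\<^esub> a x))"
      unfolding free_extension_def
      by (rule module_hom_finsum[OF A B g(1) S]) (use a vR in \<open>auto intro!: A.smult_closed\<close>)
    also have "\<dots> = (\<Oplus>\<^bsub>B\<^esub>x \<in> ?S. h (v x \<odot>\<^bsub>P\<^esub> x))"
    proof (rule B.M.add.finprod_cong')
      show "(\<lambda>x. h (v x \<odot>\<^bsub>P\<^esub> x)) \<in> ?S \<rightarrow> carrier B"
        using vR by (auto simp: X_def intro!: module_hom_closed[OF h] P.smult_closed)
      show "g (v x \<odot>\<^bsub>A\<^esub> a x) = h (v x \<odot>\<^bsub>P\<^esub> x)" if "x \<in> ?S" for x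
        using that a vR
        by (simp add: X_def module_hom_smult[OF g(1)] module_hom_smult[OF h])
    qed simp
    also have "\<dots> = h (?e v)"
      unfolding free_extension_def
      by (rule module_hom_finsum[OF P B h S, symmetric])
         (use vR in \<open>auto simp: X_def intro!: P.smult_closed\<close>)
    finally show ?thesis .
  qed
  then have "g (?k (s x)) = h x" if "x \<in> carrier P" for x
    using that es module_hom_closed[OF s] by simp
  then show ?thesis
    using module_hom_compose[OF s k] by (intro bexI[of _ "\<lambda>x. ?k (s x)"]) simp_all
qed

lemma (in ring) finsum_swap:
  assumes "finite S" and "finite T" and "\<And>i j. i \<in> S \<Longrightarrow> j \<in> T \<Longrightarrow> f i j \<in> carrier R"
  shows "(\<Oplus>i \<in> S. \<Oplus>j \<in> T. f i j) = (\<Oplus>j \<in> T. \<Oplus>i \<in> S. f i j)"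
  using assms(1,3)
proof (induction S rule: finite_induct)
  case empty
  then show ?case by (simp add: add.finprod_one)
next
  case (insert x F)
  have "(\<Oplus>j \<in> T. \<Oplus>i \<in> insert x F. f i j) = (\<Oplus>j \<in> T. f x j \<oplus> (\<Oplus>i \<in> F. f i j))"
    by (rule add.finprod_cong') (use insert in \<open>auto intro!: finsum_insert finsum_closed\<close>)
  also have "\<dots> = (\<Oplus>j \<in> T. f x j) \<oplus> (\<Oplus>j \<in> T. \<Oplus>i \<in> F. f i j)"
    by (rule finsum_addf) (use insert in \<open>auto intro!: finsum_closed\<close>)
  also have "\<dots> = (\<Oplus>i \<in> insert x F. \<Oplus>j \<in> T. f i j)"
    using insert by (subst finsum_insert) (auto intro!: finsum_closed)
  finally show ?case by simp
qed

lemma ring_Mat: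
  fixes R (structure)
  assumes "ring R"
  shows "ring (Mat n R)"
proof -
  interpret ring R by fact
  let ?I = "{..<n}"
  have entry: "A (i, j) \<in> carrier R" if "A \<in> carrier (Mat n R)" "i < n" "j < n" for A i j
    using that by (auto simp: Mat_def)
  have eqI: "A = B" if "A \<in> carrier (Mat n R)" "B \<in> carrier (Mat n R)"
      "\<And>i j. i < n \<Longrightarrow> j < n \<Longrightarrow> A (i, j) = B (i, j)" for A B
    using that by (intro PiE_ext[of A "?I \<times> ?I" "\<lambda>_. carrier R" B]) (auto simp: Mat_def)
  have add_entry: "(A \<oplus>\<^bsub>Mat n R\<^esub> B) (i, j) = A (i, j) \<oplus> B (i, j)"
    and mult_entry: "(A \<otimes>\<^bsub>Mat n R\<^esub> B) (i, j) = (\<Oplus>k \<in> ?I. A (i, k) \<otimes> B (k, j))"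
    and one_entry: "\<one>\<^bsub>Mat n R\<^esub> (i, j) = (if i = j then \<one> else \<zero>)"
    and zero_entry: "\<zero>\<^bsub>Mat n R\<^esub> (i, j) = \<zero>"
    if "i < n" "j < n" for A B i j
    using that by (simp_all add: Mat_def)
  have add_closed: "A \<oplus>\<^bsub>Mat n R\<^esub> B \<in> carrier (Mat n R)"
    and mult_closed: "A \<otimes>\<^bsub>Mat n R\<^esub> B \<in> carrier (Mat n R)"
    if "A \<in> carrier (Mat n R)" "B \<in> carrier (Mat n R)" for A B
    using that by (auto simp: Mat_def intro!: finsum_closed)
  have one_closed: "\<one>\<^bsub>Mat n R\<^esub> \<in> carrier (Mat n R)"
    and zero_closed: "\<zero>\<^bsub>Mat n R\<^esub> \<in> carrier (Mat n R)"
    by (auto simp: Mat_def)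
  note closed = add_closed mult_closed one_closed zero_closed
  note entries = add_entry mult_entry one_entry zero_entry
  show ?thesis
  proof (rule ringI)
    show "abelian_group (Mat n R)"
    proof (rule abelian_groupI)
      fix A assume A: "A \<in> carrier (Mat n R)"
      let ?B = "restrict (\<lambda>ij. \<ominus> A ij) (?I \<times> ?I)"
      have B: "?B \<in> carrier (Mat n R)" using A by (auto simp: Mat_def)
      have "?B \<oplus>\<^bsub>Mat n R\<^esub> A = \<zero>\<^bsub>Mat n R\<^esub>"
        by (rule eqI) (use A B in \<open>simp_all add: closed entries entry l_neg\<close>)
      then show "\<exists>B\<in>carrier (Mat n R). B \<oplus>\<^bsub>Mat n R\<^esub> A = \<zero>\<^bsub>Mat n R\<^esub>"
        using B by blast
    qed (simp add: closed | rule eqI; simp add: closed entries entry a_ac)+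
    show "monoid (Mat n R)"
    proof (rule monoidI)
      fix A B C assume A: "A \<in> carrier (Mat n R)" and B: "B \<in> carrier (Mat n R)"
        and C: "C \<in> carrier (Mat n R)"
      show "(A \<otimes>\<^bsub>Mat n R\<^esub> B) \<otimes>\<^bsub>Mat n R\<^esub> C = A \<otimes>\<^bsub>Mat n R\<^esub> (B \<otimes>\<^bsub>Mat n R\<^esub> C)"
      proof (rule eqI)
        fix i j assume ij: "i < n" "j < n"
        have "((A \<otimes>\<^bsub>Mat n R\<^esub> B) \<otimes>\<^bsub>Mat n R\<^esub> C) (i, j) =
            (\<Oplus>k \<in> ?I. (\<Oplus>l \<in> ?I. A (i, l) \<otimes> B (l, k)) \<otimes> C (k, j))"
          unfolding mult_entry[OF ij]
          by (rule add.finprod_cong')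
             (use ij A B C in \<open>auto simp: mult_entry entry intro!: finsum_closed\<close>)
        also have "\<dots> = (\<Oplus>k \<in> ?I. \<Oplus>l \<in> ?I. A (i, l) \<otimes> B (l, k) \<otimes> C (k, j))"
          by (rule add.finprod_cong')
             (use ij A B C in \<open>auto simp: entry intro!: finsum_closed finsum_ldistr\<close>)
        also have "\<dots> = (\<Oplus>l \<in> ?I. \<Oplus>k \<in> ?I. A (i, l) \<otimes> B (l, k) \<otimes> C (k, j))"
          by (rule finsum_swap) (use ij A B C in \<open>auto simp: entry\<close>)
        also have "\<dots> = (\<Oplus>l \<in> ?I. \<Oplus>k \<in> ?I. A (i, l) \<otimes> (B (l, k) \<otimes> C (k, j)))"
          by (intro add.finprod_cong')
             (use ij A B C in \<open>auto simp: entry m_assoc intro!: finsum_closed\<close>)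
        also have "\<dots> = (\<Oplus>l \<in> ?I. A (i, l) \<otimes> (\<Oplus>k \<in> ?I. B (l, k) \<otimes> C (k, j)))"
          by (rule add.finprod_cong')
             (use ij A B C in \<open>auto simp: entry intro!: finsum_closed finsum_rdistr[symmetric]\<close>)
        also have "\<dots> = (A \<otimes>\<^bsub>Mat n R\<^esub> (B \<otimes>\<^bsub>Mat n R\<^esub> C)) (i, j)"
          unfolding mult_entry[OF ij]
          by (rule add.finprod_cong')
             (use ij A B C in \<open>auto simp: mult_entry entry intro!: finsum_closed\<close>)
        finally show "((A \<otimes>\<^bsub>Mat n R\<^esub> B) \<otimes>\<^bsub>Mat n R\<^esub> C) (i, j) =
          (A \<otimes>\<^bsub>Mat n R\<^esub> (B \<otimes>\<^bsub>Mat n R\<^esub> C)) (i, j)" .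
      qed (use A B C in \<open>simp_all add: closed\<close>)
    next
      fix A assume A: "A \<in> carrier (Mat n R)"
      show "\<one>\<^bsub>Mat n R\<^esub> \<otimes>\<^bsub>Mat n R\<^esub> A = A"
      proof (rule eqI)
        fix i j assume ij: "i < n" "j < n"
        have "(\<one>\<^bsub>Mat n R\<^esub> \<otimes>\<^bsub>Mat n R\<^esub> A) (i, j) = (\<Oplus>k \<in> ?I. if i = k then A (k, j) else \<zero>)"
          unfolding mult_entry[OF ij]
          by (rule add.finprod_cong') (use ij A in \<open>auto simp: one_entry entry\<close>)
        also have "\<dots> = A (i, j)"
          by (rule add.finprod_singleton) (use ij A in \<open>auto simp: entry\<close>)
        finally show "(\<one>\<^bsub>Mat n R\<^esub> \<otimes>\<^bsub>Mat n R\<^esub> A) (i, j) = A (i, j)" .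
      qed (use A in \<open>simp_all add: closed\<close>)
      show "A \<otimes>\<^bsub>Mat n R\<^esub> \<one>\<^bsub>Mat n R\<^esub> = A"
      proof (rule eqI)
        fix i j assume ij: "i < n" "j < n"
        have "(A \<otimes>\<^bsub>Mat n R\<^esub> \<one>\<^bsub>Mat n R\<^esub>) (i, j) = (\<Oplus>k \<in> ?I. if j = k then A (i, k) else \<zero>)"
          unfolding mult_entry[OF ij]
          by (rule add.finprod_cong') (use ij A in \<open>auto simp: one_entry entry\<close>)
        also have "\<dots> = A (i, j)"
          by (rule add.finprod_singleton) (use ij A in \<open>auto simp: entry\<close>)
        finally show "(A \<otimes>\<^bsub>Mat n R\<^esub> \<one>\<^bsub>Mat n R\<^esub>) (i, j) = A (i, j)" .
      qed (use A in \<open>simp_all add: closed\<close>)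
    qed (simp_all add: closed)
  next
    fix A B C assume A: "A \<in> carrier (Mat n R)" and B: "B \<in> carrier (Mat n R)"
      and C: "C \<in> carrier (Mat n R)"
    show "(A \<oplus>\<^bsub>Mat n R\<^esub> B) \<otimes>\<^bsub>Mat n R\<^esub> C =
        A \<otimes>\<^bsub>Mat n R\<^esub> C \<oplus>\<^bsub>Mat n R\<^esub> B \<otimes>\<^bsub>Mat n R\<^esub> C"
    proof (rule eqI)
      fix i j assume ij: "i < n" "j < n"
      have "((A \<oplus>\<^bsub>Mat n R\<^esub> B) \<otimes>\<^bsub>Mat n R\<^esub> C) (i, j) =
          (\<Oplus>k \<in> ?I. A (i, k) \<otimes> C (k, j) \<oplus> B (i, k) \<otimes> C (k, j))"
        unfolding mult_entry[OF ij]
        by (rule add.finprod_cong') (use ij A B C in \<open>auto simp: add_entry entry l_distr\<close>)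
      also have "\<dots> = (A \<otimes>\<^bsub>Mat n R\<^esub> C \<oplus>\<^bsub>Mat n R\<^esub> B \<otimes>\<^bsub>Mat n R\<^esub> C) (i, j)"
        unfolding add_entry[OF ij] mult_entry[OF ij]
        by (rule finsum_addf) (use ij A B C in \<open>auto simp: entry\<close>)
      finally show "((A \<oplus>\<^bsub>Mat n R\<^esub> B) \<otimes>\<^bsub>Mat n R\<^esub> C) (i, j) =
        (A \<otimes>\<^bsub>Mat n R\<^esub> C \<oplus>\<^bsub>Mat n R\<^esub> B \<otimes>\<^bsub>Mat n R\<^esub> C) (i, j)" .
    qed (use A B C in \<open>simp_all add: closed\<close>)
    show "C \<otimes>\<^bsub>Mat n R\<^esub> (A \<oplus>\<^bsub>Mat n R\<^esub> B) =
        C \<otimes>\<^bsub>Mat n R\<^esub> A \<oplus>\<^bsub>Mat n R\<^esub> C \<otimes>\<^bsub>Mat n R\<^esub> B"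
    proof (rule eqI)
      fix i j assume ij: "i < n" "j < n"
      have "(C \<otimes>\<^bsub>Mat n R\<^esub> (A \<oplus>\<^bsub>Mat n R\<^esub> B)) (i, j) =
          (\<Oplus>k \<in> ?I. C (i, k) \<otimes> A (k, j) \<oplus> C (i, k) \<otimes> B (k, j))"
        unfolding mult_entry[OF ij]
        by (rule add.finprod_cong') (use ij A B C in \<open>auto simp: add_entry entry r_distr\<close>)
      also have "\<dots> = (C \<otimes>\<^bsub>Mat n R\<^esub> A \<oplus>\<^bsub>Mat n R\<^esub> C \<otimes>\<^bsub>Mat n R\<^esub> B) (i, j)"
        unfolding add_entry[OF ij] mult_entry[OF ij]
        by (rule finsum_addf) (use ij A B C in \<open>auto simp: entry\<close>)
      finally show "(C \<otimes>\<^bsub>Mat n R\<^esub> (A \<oplus>\<^bsub>Mat n R\<^esub> B)) (i, j) =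
        (C \<otimes>\<^bsub>Mat n R\<^esub> A \<oplus>\<^bsub>Mat n R\<^esub> C \<otimes>\<^bsub>Mat n R\<^esub> B) (i, j)" .
    qed (use A B C in \<open>simp_all add: closed\<close>)
  qed
qed

end

theory Submission
  imports Defs
begin

text \<open>
  Write \<open>F\<close> for the free module of rank \<open>n\<close>.  The condition that ties everything together is that
  \<open>F\<close> is relatively CS-Rickart to the ring, because maps from \<open>F\<close> to the ring can be treated one
  coordinate at a time.

  If it holds, consider the coordinates \<open>f\<^sub>0, f\<^sub>1, \<dots>\<close> of an endomorphism \<open>f\<close> of \<open>F\<close>.  The property
  passes to direct summands (\<open>relatively_CS_Rickart_retract\<close>), so starting with \<open>D\<^sub>0 = F\<close> one can
  split \<open>D\<^sub>i = E\<^sub>i \<oplus> D\<^sub>i\<^sub>+\<^sub>1\<close>, where the kernel of \<open>f\<^sub>i\<close> on \<open>D\<^sub>i\<close> is essential in \<open>D\<^sub>i\<^sub>+\<^sub>1\<close>, and hence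
  \<open>f\<^sub>i\<close> is injective on \<open>E\<^sub>i\<close> (\<open>common_kernel_chain\<close>).  The kernel of \<open>f\<close>, which is the intersection of
  the kernels of the coordinates, is then essential in the summand \<open>D\<^sub>n\<close>, so \<open>F\<close> is CS-Rickart.
  Moreover \<open>f\<close> keeps the sum of the \<open>E\<^sub>i\<close> and \<open>D\<^sub>n\<close> direct.  So the image of \<open>f\<close>, an arbitrary
  \<open>n\<close>-generated submodule, is the direct sum of the modules \<open>f E\<^sub>i\<close>, which are isomorphic to \<open>E\<^sub>i\<close> and
  embedded in the ring by the \<open>i\<close>-th coordinate, and of \<open>f D\<^sub>n\<close>, which is singular as a quotient by an
  essential submodule.  For a map to the ring the same argument with a single step decomposes
  the \<open>n\<close>-generated right ideals.

  Conversely, suppose that the image of a map \<open>f\<close> on \<open>F\<close> is \<open>P \<oplus> S\<close> with \<open>P\<close> projective and \<open>S\<close>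
  singular.  The component of \<open>f\<close> in \<open>P\<close> splits, so its kernel \<open>D\<close> is a direct summand of \<open>F\<close>, and
  since \<open>F\<close> is free of finite rank and \<open>f\<close> maps \<open>D\<close> to a singular module, the kernel of \<open>f\<close> is
  essential in \<open>D\<close> (\<open>kernel_essential_in_summand\<close>).

  An \<open>n\<close>-generated projective module is a retract of \<open>F\<close>, which gives the condition on these
  modules.  The condition on matrices is the one on endomorphisms of \<open>F\<close> in another language: being
  essential in a direct summand is a property of the ordered set of submodules, the submodules of
  \<open>F\<close> correspond to the right ideals of the matrix ring, and the kernel of an endomorphism
  corresponds to the right annihilator of its matrix.
\<close>

section \<open>Submodules\<close>

lemma (in right_module) smult_minus_one:
  assumes "x \<in> carrier M"
  shows "(\<ominus> \<one>) \<odot>\<^bsub>M\<^esub> x = \<ominus>\<^bsub>M\<^esub> x"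
proof -
  have "(\<ominus> \<one>) \<odot>\<^bsub>M\<^esub> x \<oplus>\<^bsub>M\<^esub> x = (\<ominus> \<one> \<oplus> \<one>) \<odot>\<^bsub>M\<^esub> x"
    using assms by (simp add: smult_ring_distr smult_one del: R.l_neg)
  also have "\<dots> = \<zero>\<^bsub>M\<^esub>"
    using assms by (simp add: R.l_neg smult_zero_left)
  finally show ?thesis
    using assms by (metis M.minus_equality R.a_inv_closed R.one_closed smult_closed)
qed

text \<open>
  Closure under negation comes for free from the action of \<open>-1\<close>, and the inverses of
  \<^term>\<open>M\<lparr>carrier := N\<rparr>\<close> do not have to be compared with those of \<^term>\<open>M\<close>.
\<close>

lemma (in right_module) submodule_iff:
  "submodule N R M \<longleftrightarrow> N \<subseteq> carrier M \<and> \<zero>\<^bsub>M\<^esub> \<in> N \<and>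
     (\<forall>x \<in> N. \<forall>y \<in> N. x \<oplus>\<^bsub>M\<^esub> y \<in> N) \<and> (\<forall>r \<in> carrier R. \<forall>x \<in> N. r \<odot>\<^bsub>M\<^esub> x \<in> N)"
  (is "?L \<longleftrightarrow> ?C")
proof
  assume ?L
  then interpret submodule N R M .
  show ?C
    using subset one_closed m_closed smult_closed by auto
next
  assume C: ?C
  have "\<ominus>\<^bsub>M\<^esub> x \<in> N" if "x \<in> N" for x
    using C that smult_minus_one[of x] by (metis R.a_inv_closed R.one_closed subsetD)
  then show ?L
    using C
    by (intro submodule.intro subgroup.intro submodule_axioms.intro) (auto simp: a_inv_def)
qed

lemma (in right_module) submodule_minus:
  assumes "submodule N R M" and "x \<in> N" and "y \<in> N"
  shows "x \<ominus>\<^bsub>M\<^esub> y \<in> N"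
proof -
  have "\<ominus>\<^bsub>M\<^esub> y \<in> N"
    using assms smult_minus_one[of y] unfolding submodule_iff
    by (metis R.a_inv_closed R.one_closed subsetD)
  then show ?thesis
    using assms unfolding submodule_iff a_minus_def by blast
qed

lemma (in right_module) minus_eq_zero_iff:
  assumes "x \<in> carrier M" and "y \<in> carrier M"
  shows "x \<ominus>\<^bsub>M\<^esub> y = \<zero>\<^bsub>M\<^esub> \<longleftrightarrow> x = y"
  using assms by (metis M.add.inv_solve_right' M.l_zero M.minus_eq M.r_neg M.zero_closed)

lemma (in right_module) eq_minus_iff:
  assumes "x \<in> carrier M" and "y \<in> carrier M" and "z \<in> carrier M"
  shows "z = x \<ominus>\<^bsub>M\<^esub> y \<longleftrightarrow> x = z \<oplus>\<^bsub>M\<^esub> y"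
  using assms by (metis M.add.inv_solve_right M.minus_eq)

lemma (in right_module) right_module_submodule:
  assumes "submodule N R M"
  shows "right_module R (M\<lparr>carrier := N\<rparr>)"
proof -
  have N: "N \<subseteq> carrier M" "\<zero>\<^bsub>M\<^esub> \<in> N" "\<And>x y. x \<in> N \<Longrightarrow> y \<in> N \<Longrightarrow> x \<oplus>\<^bsub>M\<^esub> y \<in> N"
    "\<And>r x. r \<in> carrier R \<Longrightarrow> x \<in> N \<Longrightarrow> r \<odot>\<^bsub>M\<^esub> x \<in> N"
    using assms by (auto simp: submodule_iff)
  note inM = subsetD[OF N(1)]
  show ?thesis
  proof (intro right_module.intro right_module_axioms.intro abelian_groupI)
    fix x assume "x \<in> carrier (M\<lparr>carrier := N\<rparr>)"
    then have "(\<ominus> \<one>) \<odot>\<^bsub>M\<^esub> x \<in> N" and "(\<ominus> \<one>) \<odot>\<^bsub>M\<^esub> x \<oplus>\<^bsub>M\<^esub> x = \<zero>\<^bsub>M\<^esub>"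
      using N(4)[of "\<ominus> \<one>" x] inM[of x] by (simp_all add: smult_minus_one M.l_neg)
    then show "\<exists>y\<in>carrier (M\<lparr>carrier := N\<rparr>). y \<oplus>\<^bsub>M\<lparr>carrier := N\<rparr>\<^esub> x = \<zero>\<^bsub>M\<lparr>carrier := N\<rparr>\<^esub>"
      by auto
  qed (use N(2-4) in \<open>simp_all add: inM M.a_ac smult_ring_distr smult_module_distr
         smult_assoc smult_one R.ring_axioms\<close>)
qed

lemma (in right_module) submodule_of_submodule:
  assumes "submodule N R M"
  shows "submodule K R (M\<lparr>carrier := N\<rparr>) \<longleftrightarrow> submodule K R M \<and> K \<subseteq> N"
  using assms unfolding submodule_iff right_module.submodule_iff[OF right_module_submodule[OF assms]]
  by auto

lemma (in right_module) submodule_carrier: "submodule (carrier M) R M"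
  by (auto simp: submodule_iff smult_closed)

lemma (in right_module) submodule_zero: "submodule {\<zero>\<^bsub>M\<^esub>} R M"
  by (auto simp: submodule_iff smult_zero_right)

lemma (in right_module) submodule_Int:
  "submodule A R M \<Longrightarrow> submodule B R M \<Longrightarrow> submodule (A \<inter> B) R M"
  by (auto simp: submodule_iff)

lemma (in right_module) submodule_cyclic:
  assumes x: "x \<in> carrier M"
  shows "submodule ((\<lambda>r. r \<odot>\<^bsub>M\<^esub> x) ` carrier R) R M"
proof -
  have "\<zero>\<^bsub>M\<^esub> \<in> (\<lambda>r. r \<odot>\<^bsub>M\<^esub> x) ` carrier R"
    using smult_zero_left[OF x] by (metis R.zero_closed imageI)
  moreover have "r \<odot>\<^bsub>M\<^esub> x \<oplus>\<^bsub>M\<^esub> s \<odot>\<^bsub>M\<^esub> x \<in> (\<lambda>r. r \<odot>\<^bsub>M\<^esub> x) ` carrier R"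
    if "r \<in> carrier R" "s \<in> carrier R" for r s
    using that smult_ring_distr[of r s x] x by (metis R.a_closed imageI)
  moreover have "s \<odot>\<^bsub>M\<^esub> (r \<odot>\<^bsub>M\<^esub> x) \<in> (\<lambda>r. r \<odot>\<^bsub>M\<^esub> x) ` carrier R"
    if "r \<in> carrier R" "s \<in> carrier R" for r s
    using that smult_assoc[of r s x] x by (metis R.m_closed imageI)
  ultimately show ?thesis
    using x by (auto simp: submodule_iff smult_closed)
qed

lemma (in right_module) set_add_mem:
  "x \<in> A <+>\<^bsub>M\<^esub> B \<longleftrightarrow> (\<exists>a \<in> A. \<exists>b \<in> B. x = a \<oplus>\<^bsub>M\<^esub> b)"
  by (auto simp: set_add_def set_mult_def)

lemma (in right_module) set_add_image:
  "A <+>\<^bsub>M\<^esub> B = (\<lambda>(a, b). a \<oplus>\<^bsub>M\<^esub> b) ` (A \<times> B)"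
  unfolding set_eq_iff by (auto simp: set_add_mem image_iff Bex_def)

lemma (in right_module) submodule_set_add:
  assumes A: "submodule A R M" and B: "submodule B R M"
  shows "submodule (A <+>\<^bsub>M\<^esub> B) R M"
proof -
  have c: "A \<subseteq> carrier M" "B \<subseteq> carrier M" "\<zero>\<^bsub>M\<^esub> \<in> A" "\<zero>\<^bsub>M\<^esub> \<in> B"
    using A B by (auto simp: submodule_iff)
  show ?thesis
    unfolding submodule_iff
  proof (intro conjI ballI)
    show "A <+>\<^bsub>M\<^esub> B \<subseteq> carrier M"
      using c by (auto simp: set_add_mem subset_iff)
    show "\<zero>\<^bsub>M\<^esub> \<in> A <+>\<^bsub>M\<^esub> B"
      using c by (auto simp: set_add_mem intro!: bexI[of _ "\<zero>\<^bsub>M\<^esub>"])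
    fix x y assume "x \<in> A <+>\<^bsub>M\<^esub> B" "y \<in> A <+>\<^bsub>M\<^esub> B"
    then obtain a b a' b' where *: "a \<in> A" "b \<in> B" "a' \<in> A" "b' \<in> B"
      "x = a \<oplus>\<^bsub>M\<^esub> b" "y = a' \<oplus>\<^bsub>M\<^esub> b'"
      by (auto simp: set_add_mem)
    then have "x \<oplus>\<^bsub>M\<^esub> y = (a \<oplus>\<^bsub>M\<^esub> a') \<oplus>\<^bsub>M\<^esub> (b \<oplus>\<^bsub>M\<^esub> b')"
      using c by (simp add: subset_iff M.a_ac)
    moreover have "a \<oplus>\<^bsub>M\<^esub> a' \<in> A" "b \<oplus>\<^bsub>M\<^esub> b' \<in> B"
      using * A B by (auto simp: submodule_iff)
    ultimately show "x \<oplus>\<^bsub>M\<^esub> y \<in> A <+>\<^bsub>M\<^esub> B"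
      unfolding set_add_mem by blast
  next
    fix r x assume r: "r \<in> carrier R" and "x \<in> A <+>\<^bsub>M\<^esub> B"
    then obtain a b where *: "a \<in> A" "b \<in> B" "x = a \<oplus>\<^bsub>M\<^esub> b"
      by (auto simp: set_add_mem)
    then have "r \<odot>\<^bsub>M\<^esub> x = r \<odot>\<^bsub>M\<^esub> a \<oplus>\<^bsub>M\<^esub> r \<odot>\<^bsub>M\<^esub> b"
      using r c by (simp add: subset_iff smult_module_distr)
    moreover have "r \<odot>\<^bsub>M\<^esub> a \<in> A" "r \<odot>\<^bsub>M\<^esub> b \<in> B"
      using r * A B by (auto simp: submodule_iff)
    ultimately show "r \<odot>\<^bsub>M\<^esub> x \<in> A <+>\<^bsub>M\<^esub> B"
      unfolding set_add_mem by blast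
  qed
qed

lemma (in right_module) submodule_finsum:
  assumes N: "submodule N R M" and "finite I" and x: "\<And>i. i \<in> I \<Longrightarrow> x i \<in> N"
  shows "(\<Oplus>\<^bsub>M\<^esub>i \<in> I. x i) \<in> N"
  using \<open>finite I\<close> x
proof (induction I rule: finite_induct)
  case empty
  then show ?case using N by (simp add: submodule_iff)
next
  case (insert a F)
  then have "x \<in> F \<rightarrow> carrier M" "x a \<in> carrier M"
    using N by (auto simp: submodule_iff)
  then show ?case
    using insert N by (simp add: submodule_iff)
qed

lemma module_hom_minus:
  assumes M: "right_module R M" and N: "right_module R N" and f: "f \<in> module_hom R M N"
    and x: "x \<in> carrier M" and y: "y \<in> carrier M"
  shows "f (x \<ominus>\<^bsub>M\<^esub> y) = f x \<ominus>\<^bsub>N\<^esub> f y"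
proof -
  interpret M: right_module R M by fact
  interpret N: right_module R N by fact
  have "f (\<ominus>\<^bsub>M\<^esub> y) = \<ominus>\<^bsub>N\<^esub> f y"
    using module_hom_smult[OF f, of "\<ominus>\<^bsub>R\<^esub> \<one>\<^bsub>R\<^esub>" y] y
    by (simp add: M.smult_minus_one N.smult_minus_one module_hom_closed[OF f])
  then show ?thesis
    using x y by (simp add: a_minus_def module_hom_add[OF f])
qed

lemma module_hom_inj_on:
  assumes M: "right_module R M" and N: "right_module R N" and f: "f \<in> module_hom R M N"
    and A: "submodule A R M" and zero: "\<And>x. x \<in> A \<Longrightarrow> f x = \<zero>\<^bsub>N\<^esub> \<Longrightarrow> x = \<zero>\<^bsub>M\<^esub>"
  shows "inj_on f A"
proof (rule inj_onI)
  interpret M: right_module R M by fact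
  interpret N: right_module R N by fact
  fix x y assume xy: "x \<in> A" "y \<in> A" "f x = f y"
  then have c: "x \<in> carrier M" "y \<in> carrier M"
    using A by (auto simp: M.submodule_iff)
  have "f (x \<ominus>\<^bsub>M\<^esub> y) = \<zero>\<^bsub>N\<^esub>"
    using c xy by (simp add: module_hom_minus[OF M N f] module_hom_closed[OF f] N.minus_eq_zero_iff)
  then show "x = y"
    using zero[OF M.submodule_minus[OF A xy(1,2)]] c by (simp add: M.minus_eq_zero_iff)
qed

lemma submodule_image:
  assumes M: "right_module R M" and N: "right_module R N" and f: "f \<in> module_hom R M N"
    and A: "submodule A R M"
  shows "submodule (f ` A) R N"
proof -
  interpret M: right_module R M by fact
  interpret N: right_module R N by fact
  have c: "A \<subseteq> carrier M" "\<zero>\<^bsub>M\<^esub> \<in> A" "\<And>x y. x \<in> A \<Longrightarrow> y \<in> A \<Longrightarrow> x \<oplus>\<^bsub>M\<^esub> y \<in> A"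
    "\<And>r x. r \<in> carrier R \<Longrightarrow> x \<in> A \<Longrightarrow> r \<odot>\<^bsub>M\<^esub> x \<in> A"
    using A by (auto simp: M.submodule_iff)
  show ?thesis
    unfolding N.submodule_iff
  proof (intro conjI ballI)
    show "f ` A \<subseteq> carrier N"
      using c(1) module_hom_closed[OF f] by auto
    show "\<zero>\<^bsub>N\<^esub> \<in> f ` A"
      using c(2) module_hom_zero[OF M N f] by (metis imageI)
    show "x \<oplus>\<^bsub>N\<^esub> y \<in> f ` A" if "x \<in> f ` A" "y \<in> f ` A" for x y
      using that c(1,3) by (auto simp: module_hom_add[OF f, symmetric] subset_iff)
    show "r \<odot>\<^bsub>N\<^esub> x \<in> f ` A" if "r \<in> carrier R" "x \<in> f ` A" for r x
      using that c(1,4) by (auto simp: module_hom_smult[OF f, symmetric] subset_iff)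
  qed
qed

lemma a_kernel_mem: "x \<in> a_kernel M N f \<longleftrightarrow> x \<in> carrier M \<and> f x = \<zero>\<^bsub>N\<^esub>"
  by (auto simp: a_kernel_def kernel_def)

lemma submodule_a_kernel:
  assumes M: "right_module R M" and N: "right_module R N" and f: "f \<in> module_hom R M N"
  shows "submodule (a_kernel M N f) R M"
proof -
  interpret M: right_module R M by fact
  interpret N: right_module R N by fact
  show ?thesis
    by (auto simp: M.submodule_iff a_kernel_mem module_hom_zero[OF M N f] module_hom_add[OF f]
        module_hom_smult[OF f] M.smult_closed N.smult_zero_right)
qed

lemma module_hom_inclusion: "A \<subseteq> carrier M \<Longrightarrow> (\<lambda>x. x) \<in> module_hom R (M\<lparr>carrier := A\<rparr>) M"
  by (rule module_homI) auto

lemma module_hom_restrict_domain: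
  "f \<in> module_hom R M N \<Longrightarrow> A \<subseteq> carrier M \<Longrightarrow> f \<in> module_hom R (M\<lparr>carrier := A\<rparr>) N"
  by (auto simp: module_hom_def hom_def subset_iff)

lemma module_hom_restrict_codomain:
  "f \<in> module_hom R M N \<Longrightarrow> f ` carrier M \<subseteq> B \<Longrightarrow> f \<in> module_hom R M (N\<lparr>carrier := B\<rparr>)"
  by (auto simp: module_hom_def hom_def)

section \<open>Essential submodules and direct sums\<close>

text \<open>
  It suffices to test essentiality on cyclic submodules, which turns it into a statement about
  nonzero multiples of single elements.
\<close>

lemma (in right_module) essential_iff:
  "essential R M N \<longleftrightarrow> submodule N R M \<and>
     (\<forall>x \<in> carrier M. x \<noteq> \<zero>\<^bsub>M\<^esub> \<longrightarrow> (\<exists>r \<in> carrier R. r \<odot>\<^bsub>M\<^esub> x \<in> N \<and> r \<odot>\<^bsub>M\<^esub> x \<noteq> \<zero>\<^bsub>M\<^esub>))"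
  (is "_ \<longleftrightarrow> _ \<and> ?E")
proof (cases "submodule N R M")
  case N: True
  have "(\<forall>K. submodule K R M \<and> K \<noteq> {\<zero>\<^bsub>M\<^esub>} \<longrightarrow> N \<inter> K \<noteq> {\<zero>\<^bsub>M\<^esub>}) \<longleftrightarrow> ?E"
  proof (intro iffI ballI allI impI)
    fix x assume ess: "\<forall>K. submodule K R M \<and> K \<noteq> {\<zero>\<^bsub>M\<^esub>} \<longrightarrow> N \<inter> K \<noteq> {\<zero>\<^bsub>M\<^esub>}"
      and x: "x \<in> carrier M" "x \<noteq> \<zero>\<^bsub>M\<^esub>"
    let ?K = "(\<lambda>r. r \<odot>\<^bsub>M\<^esub> x) ` carrier R"
    have K: "submodule ?K R M" by (rule submodule_cyclic[OF x(1)])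
    have "x \<in> ?K" using smult_one[OF x(1)] by (metis R.one_closed imageI)
    then have "N \<inter> ?K \<noteq> {\<zero>\<^bsub>M\<^esub>}" using ess K x(2) by blast
    moreover have "\<zero>\<^bsub>M\<^esub> \<in> N \<inter> ?K" using N K by (simp add: submodule_iff)
    ultimately show "\<exists>r \<in> carrier R. r \<odot>\<^bsub>M\<^esub> x \<in> N \<and> r \<odot>\<^bsub>M\<^esub> x \<noteq> \<zero>\<^bsub>M\<^esub>" by blast
  next
    fix K assume E: ?E and K: "submodule K R M \<and> K \<noteq> {\<zero>\<^bsub>M\<^esub>}"
    then have "K \<subseteq> carrier M" "\<zero>\<^bsub>M\<^esub> \<in> K" "K \<noteq> {\<zero>\<^bsub>M\<^esub>}" by (auto simp: submodule_iff)
    then obtain x where "x \<in> K" "x \<in> carrier M" "x \<noteq> \<zero>\<^bsub>M\<^esub>" by blast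
    then obtain r where "r \<in> carrier R" "r \<odot>\<^bsub>M\<^esub> x \<in> N" "r \<odot>\<^bsub>M\<^esub> x \<noteq> \<zero>\<^bsub>M\<^esub>"
      using E by blast
    then show "N \<inter> K \<noteq> {\<zero>\<^bsub>M\<^esub>}"
      using K \<open>x \<in> K\<close> by (auto simp: submodule_iff)
  qed
  then show ?thesis by (simp add: essential_def N)
qed (simp add: essential_def)

lemma (in right_module) essential_in_submodule_iff:
  assumes D: "submodule D R M"
  shows "essential R (M\<lparr>carrier := D\<rparr>) N \<longleftrightarrow> submodule N R M \<and> N \<subseteq> D \<and>
     (\<forall>x \<in> D. x \<noteq> \<zero>\<^bsub>M\<^esub> \<longrightarrow> (\<exists>r \<in> carrier R. r \<odot>\<^bsub>M\<^esub> x \<in> N \<and> r \<odot>\<^bsub>M\<^esub> x \<noteq> \<zero>\<^bsub>M\<^esub>))"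
  unfolding right_module.essential_iff[OF right_module_submodule[OF D]]
    submodule_of_submodule[OF D] by simp

lemma (in right_module) direct_sum_unique:
  assumes "direct_sum R M A B N" and "a \<in> A" "a' \<in> A" "b \<in> B" "b' \<in> B"
    and "a \<oplus>\<^bsub>M\<^esub> b = a' \<oplus>\<^bsub>M\<^esub> b'"
  shows "a = a'" and "b = b'"
proof -
  have sub: "submodule A R M" "submodule B R M" and disj: "A \<inter> B = {\<zero>\<^bsub>M\<^esub>}"
    using assms by (auto simp: direct_sum_def)
  have c: "a \<in> carrier M" "a' \<in> carrier M" "b \<in> carrier M" "b' \<in> carrier M"
    using assms(2-5) sub by (auto simp: submodule_iff)
  have "a \<ominus>\<^bsub>M\<^esub> a' = b' \<ominus>\<^bsub>M\<^esub> b"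
  proof -
    have "a = a' \<oplus>\<^bsub>M\<^esub> b' \<ominus>\<^bsub>M\<^esub> b"
      using c assms(6) by (simp add: eq_minus_iff)
    also have "\<dots> = b' \<ominus>\<^bsub>M\<^esub> b \<oplus>\<^bsub>M\<^esub> a'"
      using c by (simp add: M.minus_eq M.a_ac)
    finally show ?thesis using c by (simp add: eq_minus_iff[symmetric])
  qed
  then have "a \<ominus>\<^bsub>M\<^esub> a' \<in> A \<inter> B"
    using submodule_minus sub assms(2-5) by (metis IntI)
  then show "a = a'" using disj c by (simp add: minus_eq_zero_iff)
  then show "b = b'" using c assms(6) by simp
qed

lemma (in right_module) direct_sum_subset:
  assumes "direct_sum R M A B N"
  shows "A \<subseteq> N" and "B \<subseteq> N"
proof -
  have "\<zero>\<^bsub>M\<^esub> \<in> A" "\<zero>\<^bsub>M\<^esub> \<in> B" "A \<subseteq> carrier M" "B \<subseteq> carrier M" and N: "A <+>\<^bsub>M\<^esub> B = N"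
    using assms by (auto simp: direct_sum_def submodule_iff)
  then have "a = a \<oplus>\<^bsub>M\<^esub> \<zero>\<^bsub>M\<^esub>" "b = \<zero>\<^bsub>M\<^esub> \<oplus>\<^bsub>M\<^esub> b" if "a \<in> A" "b \<in> B" for a b
    using that by auto
  then show "A \<subseteq> N" "B \<subseteq> N"
    unfolding N[symmetric] using \<open>\<zero>\<^bsub>M\<^esub> \<in> A\<close> \<open>\<zero>\<^bsub>M\<^esub> \<in> B\<close> by (auto simp: set_add_mem; metis)+
qed

lemma (in right_module) direct_sum_submodule:
  "direct_sum R M A B N \<Longrightarrow> submodule N R M"
  using submodule_set_add by (auto simp: direct_sum_def)

lemma (in right_module) direct_sum_commute:
  assumes "direct_sum R M A B N"
  shows "direct_sum R M B A N"
proof -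
  have "A \<subseteq> carrier M" "B \<subseteq> carrier M"
    using assms by (auto simp: direct_sum_def submodule_iff)
  then have "a \<oplus>\<^bsub>M\<^esub> b = b \<oplus>\<^bsub>M\<^esub> a" if "a \<in> A" "b \<in> B" for a b
    using that by (auto intro: M.a_comm)
  then have "A <+>\<^bsub>M\<^esub> B = B <+>\<^bsub>M\<^esub> A"
    unfolding set_eq_iff set_add_mem by metis
  then show ?thesis using assms by (auto simp: direct_sum_def)
qed

lemma (in right_module) direct_sum_assoc:
  assumes AN: "direct_sum R M A N N'" and BC: "direct_sum R M B C N"
  shows "direct_sum R M C (A <+>\<^bsub>M\<^esub> B) N'"
proof -
  have sub: "submodule A R M" "submodule B R M" "submodule C R M" "submodule N R M"
    using AN BC by (auto simp: direct_sum_def)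
  then have c: "A \<subseteq> carrier M" "B \<subseteq> carrier M" "C \<subseteq> carrier M" and z: "\<zero>\<^bsub>M\<^esub> \<in> A" "\<zero>\<^bsub>M\<^esub> \<in> B" "\<zero>\<^bsub>M\<^esub> \<in> C"
    by (auto simp: submodule_iff)
  have AN': "A <+>\<^bsub>M\<^esub> N = N'" and BC': "B <+>\<^bsub>M\<^esub> C = N"
    using AN BC by (auto simp: direct_sum_def)
  have "C \<inter> (A <+>\<^bsub>M\<^esub> B) \<subseteq> {\<zero>\<^bsub>M\<^esub>}"
  proof
    fix x assume "x \<in> C \<inter> (A <+>\<^bsub>M\<^esub> B)"
    then obtain a b where x: "x \<in> C" and ab: "a \<in> A" "b \<in> B" "x = a \<oplus>\<^bsub>M\<^esub> b"
      by (auto simp: set_add_mem)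
    have N: "b \<in> N" "x \<in> N" using direct_sum_subset[OF BC] ab x by auto
    have "a \<oplus>\<^bsub>M\<^esub> b = \<zero>\<^bsub>M\<^esub> \<oplus>\<^bsub>M\<^esub> x" using ab x c by auto
    then have "a = \<zero>\<^bsub>M\<^esub>" using direct_sum_unique(1)[OF AN] ab(1) z(1) N by blast
    then have "b \<oplus>\<^bsub>M\<^esub> \<zero>\<^bsub>M\<^esub> = \<zero>\<^bsub>M\<^esub> \<oplus>\<^bsub>M\<^esub> x" using ab x c by auto
    then have "\<zero>\<^bsub>M\<^esub> = x" using direct_sum_unique(2)[OF BC] ab(2) x z by blast
    then show "x \<in> {\<zero>\<^bsub>M\<^esub>}" by simp
  qed
  moreover have "\<zero>\<^bsub>M\<^esub> \<in> C \<inter> (A <+>\<^bsub>M\<^esub> B)"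
    using sub submodule_set_add by (simp add: submodule_iff)
  moreover have "C <+>\<^bsub>M\<^esub> (A <+>\<^bsub>M\<^esub> B) = N'"
  proof -
    have "c' \<oplus>\<^bsub>M\<^esub> (a \<oplus>\<^bsub>M\<^esub> b) = a \<oplus>\<^bsub>M\<^esub> (b \<oplus>\<^bsub>M\<^esub> c')" if "a \<in> A" "b \<in> B" "c' \<in> C" for a b c'
      using that c by (simp add: subset_iff M.a_ac)
    then have "x \<in> C <+>\<^bsub>M\<^esub> (A <+>\<^bsub>M\<^esub> B) \<longleftrightarrow> x \<in> A <+>\<^bsub>M\<^esub> (B <+>\<^bsub>M\<^esub> C)" for x
      by (auto simp: set_add_mem Bex_def) metis+
    then show ?thesis
      unfolding AN'[symmetric] BC'[symmetric] by blast
  qed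
  ultimately show ?thesis
    using sub submodule_set_add by (auto simp: direct_sum_def)
qed

lemma (in right_module) direct_sum_projection:
  assumes "direct_sum R M A B N"
  obtains p where "p \<in> module_hom R (M\<lparr>carrier := N\<rparr>) (M\<lparr>carrier := A\<rparr>)"
    and "\<And>a. a \<in> A \<Longrightarrow> p a = a" and "\<And>x. x \<in> N \<Longrightarrow> x \<ominus>\<^bsub>M\<^esub> p x \<in> B"
proof -
  have sub: "submodule A R M" "submodule B R M" and N: "A <+>\<^bsub>M\<^esub> B = N"
    using assms by (auto simp: direct_sum_def)
  then have c: "A \<subseteq> carrier M" "B \<subseteq> carrier M" and z: "\<zero>\<^bsub>M\<^esub> \<in> A" "\<zero>\<^bsub>M\<^esub> \<in> B"
    and cl: "\<And>x y. x \<in> A \<Longrightarrow> y \<in> A \<Longrightarrow> x \<oplus>\<^bsub>M\<^esub> y \<in> A" "\<And>x y. x \<in> B \<Longrightarrow> y \<in> B \<Longrightarrow> x \<oplus>\<^bsub>M\<^esub> y \<in> B"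
      "\<And>r x. r \<in> carrier R \<Longrightarrow> x \<in> A \<Longrightarrow> r \<odot>\<^bsub>M\<^esub> x \<in> A" "\<And>r x. r \<in> carrier R \<Longrightarrow> x \<in> B \<Longrightarrow> r \<odot>\<^bsub>M\<^esub> x \<in> B"
    by (auto simp: submodule_iff)
  have "\<exists>a b. a \<in> A \<and> b \<in> B \<and> x = a \<oplus>\<^bsub>M\<^esub> b" if "x \<in> N" for x
    using that by (auto simp: N[symmetric] set_add_mem)
  then obtain p q where pq: "\<And>x. x \<in> N \<Longrightarrow> p x \<in> A \<and> q x \<in> B \<and> x = p x \<oplus>\<^bsub>M\<^esub> q x"
    by metis
  have p: "p x = a" if "a \<in> A" "b \<in> B" "x = a \<oplus>\<^bsub>M\<^esub> b" for x a b
  proof -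
    have "x \<in> N" using that by (auto simp: N[symmetric] set_add_mem)
    then show ?thesis using pq that direct_sum_unique(1)[OF assms] by metis
  qed
  have inM: "\<And>x. x \<in> N \<Longrightarrow> p x \<in> carrier M \<and> q x \<in> carrier M"
    using pq c by auto
  have "p \<in> module_hom R (M\<lparr>carrier := N\<rparr>) (M\<lparr>carrier := A\<rparr>)"
  proof (rule module_homI)
    fix x y assume "x \<in> carrier (M\<lparr>carrier := N\<rparr>)" "y \<in> carrier (M\<lparr>carrier := N\<rparr>)"
    then have xy: "x \<in> N" "y \<in> N" by auto
    have "p x \<oplus>\<^bsub>M\<^esub> q x \<oplus>\<^bsub>M\<^esub> (p y \<oplus>\<^bsub>M\<^esub> q y) = (p x \<oplus>\<^bsub>M\<^esub> p y) \<oplus>\<^bsub>M\<^esub> (q x \<oplus>\<^bsub>M\<^esub> q y)"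
      using inM[OF xy(1)] inM[OF xy(2)] by (simp add: M.a_ac)
    then have "x \<oplus>\<^bsub>M\<^esub> y = (p x \<oplus>\<^bsub>M\<^esub> p y) \<oplus>\<^bsub>M\<^esub> (q x \<oplus>\<^bsub>M\<^esub> q y)"
      using pq[OF xy(1)] pq[OF xy(2)] by metis
    then show "p (x \<oplus>\<^bsub>M\<lparr>carrier := N\<rparr>\<^esub> y) = p x \<oplus>\<^bsub>M\<lparr>carrier := A\<rparr>\<^esub> p y"
      using p cl pq[OF xy(1)] pq[OF xy(2)] by simp
  next
    fix r x assume r: "r \<in> carrier R" and "x \<in> carrier (M\<lparr>carrier := N\<rparr>)"
    then have x: "x \<in> N" by auto
    have "r \<odot>\<^bsub>M\<^esub> x = r \<odot>\<^bsub>M\<^esub> p x \<oplus>\<^bsub>M\<^esub> r \<odot>\<^bsub>M\<^esub> q x"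
      using r inM[OF x] pq[OF x] smult_module_distr by metis
    then show "p (r \<odot>\<^bsub>M\<lparr>carrier := N\<rparr>\<^esub> x) = r \<odot>\<^bsub>M\<lparr>carrier := A\<rparr>\<^esub> p x"
      using p cl r pq[OF x] by simp
  qed (use pq in auto)
  moreover have "p a = a" if "a \<in> A" for a
    by (rule p[of a "\<zero>\<^bsub>M\<^esub>"]) (use that c z in auto)
  moreover have "x \<ominus>\<^bsub>M\<^esub> p x = q x" if "x \<in> N" for x
  proof -
    have "x = q x \<oplus>\<^bsub>M\<^esub> p x" using pq[OF that] inM[OF that] by (metis M.a_comm)
    moreover have "x \<in> carrier M" using pq[OF that] inM[OF that] by (metis M.a_closed)
    ultimately show ?thesis using inM[OF that] eq_minus_iff[of x "p x" "q x"] by simp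
  qed
  ultimately show thesis using pq by (intro that[of p]) auto
qed

lemma (in right_module) direct_sum_in_submodule:
  assumes "submodule D R M"
  shows "direct_sum R (M\<lparr>carrier := D\<rparr>) A B N \<longleftrightarrow> direct_sum R M A B N \<and> A \<subseteq> D \<and> B \<subseteq> D"
  unfolding direct_sum_def submodule_of_submodule[OF assms]
  by (auto simp: set_add_def set_mult_def)

text \<open>
  If \<open>f a = f b\<close>, then \<open>a - b\<close> lies in the kernel and hence in \<open>B\<close>, so \<open>a\<close> lies in \<open>A \<inter> B\<close>.
\<close>

lemma direct_sum_image:
  assumes M: "right_module R M" and N: "right_module R N" and f: "f \<in> module_hom R M N"
    and AB: "direct_sum R M A B C" and ker: "\<And>x. x \<in> C \<Longrightarrow> f x = \<zero>\<^bsub>N\<^esub> \<Longrightarrow> x \<in> B"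
  shows "direct_sum R N (f ` A) (f ` B) (f ` C)"
proof -
  interpret M: right_module R M by fact
  interpret N: right_module R N by fact
  have sub: "submodule A R M" "submodule B R M" "submodule C R M"
    and disj: "A \<inter> B = {\<zero>\<^bsub>M\<^esub>}" and C: "A <+>\<^bsub>M\<^esub> B = C"
    using AB M.direct_sum_submodule[OF AB] by (auto simp: direct_sum_def)
  then have c: "A \<subseteq> carrier M" "B \<subseteq> carrier M"
    by (auto simp: M.submodule_iff)
  note AC = M.direct_sum_subset[OF AB]
  have "f a = \<zero>\<^bsub>N\<^esub>" if ab: "a \<in> A" "b \<in> B" "f a = f b" for a b
  proof -
    have "f (a \<ominus>\<^bsub>M\<^esub> b) = \<zero>\<^bsub>N\<^esub>"
      using ab c by (simp add: subset_iff module_hom_minus[OF M N f] module_hom_closed[OF f]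
          N.minus_eq_zero_iff)
    then have "a \<ominus>\<^bsub>M\<^esub> b \<in> B"
      using ker M.submodule_minus[OF sub(3)] ab AC by blast
    then have "(a \<ominus>\<^bsub>M\<^esub> b) \<oplus>\<^bsub>M\<^esub> b \<in> B"
      using sub(2) ab(2) by (auto simp: M.submodule_iff)
    moreover have "(a \<ominus>\<^bsub>M\<^esub> b) \<oplus>\<^bsub>M\<^esub> b = a"
      using ab c by (simp add: subset_iff M.minus_eq M.a_assoc M.l_neg)
    ultimately have "a \<in> A \<inter> B" using ab(1) by simp
    then show ?thesis
      using disj module_hom_zero[OF M N f] by simp
  qed
  then have "f ` A \<inter> f ` B \<subseteq> {\<zero>\<^bsub>N\<^esub>}" by auto
  moreover have "\<zero>\<^bsub>N\<^esub> \<in> f ` A \<inter> f ` B"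
    using submodule_image[OF M N f] sub(1,2) by (simp add: N.submodule_iff)
  moreover have "f ` A <+>\<^bsub>N\<^esub> f ` B = f ` C"
  proof -
    have "f a \<oplus>\<^bsub>N\<^esub> f b = f (a \<oplus>\<^bsub>M\<^esub> b)" if "a \<in> A" "b \<in> B" for a b
      using that c by (simp add: subset_iff module_hom_add[OF f])
    then have "y \<in> f ` A <+>\<^bsub>N\<^esub> f ` B \<longleftrightarrow> y \<in> f ` (A <+>\<^bsub>M\<^esub> B)" for y
      by (auto simp: N.set_add_mem M.set_add_mem image_iff Bex_def) metis+
    then show ?thesis
      unfolding C[symmetric] by blast
  qed
  ultimately show ?thesis
    using submodule_image[OF M N f] sub by (auto simp: direct_sum_def)
qed

section \<open>Free, projective and finitely generated modules\<close>

definition unit_vector :: "('r, 'k) ring_scheme \<Rightarrow> 'i set \<Rightarrow> 'i \<Rightarrow> 'i \<Rightarrow> 'r" where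
  "unit_vector R I i = (\<lambda>j \<in> I. if j = i then \<one>\<^bsub>R\<^esub> else \<zero>\<^bsub>R\<^esub>)"

lemma finsum_regular_module: "finsum (regular_module R) f A = finsum R f A"
  by (simp add: finsum_def finprod_def regular_module_def)

lemma free_module_coordinate_hom:
  "i \<in> I \<Longrightarrow> (\<lambda>v. v i) \<in> module_hom R (free_module R I) (regular_module R)"
  by (rule module_homI) (auto simp: free_module_def regular_module_def)

lemma free_module_eqI:
  assumes "v \<in> carrier (free_module R I)" and "w \<in> carrier (free_module R I)"
    and "\<And>i. i \<in> I \<Longrightarrow> v i = w i"
  shows "v = w"
  using assms by (intro PiE_ext[of v I "\<lambda>_. carrier R" w]) (auto simp: free_module_def)

lemma free_module_entry: "v \<in> carrier (free_module R I) \<Longrightarrow> i \<in> I \<Longrightarrow> v i \<in> carrier R"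
  by (auto simp: free_module_def)

lemma free_module_smult_entry: "i \<in> I \<Longrightarrow> (r \<odot>\<^bsub>free_module R I\<^esub> v) i = v i \<otimes>\<^bsub>R\<^esub> r"
  by (simp add: free_module_def)

lemma free_module_zero_entry: "i \<in> I \<Longrightarrow> \<zero>\<^bsub>free_module R I\<^esub> i = \<zero>\<^bsub>R\<^esub>"
  by (simp add: free_module_def)

lemma unit_vector_closed:
  assumes "ring R"
  shows "unit_vector R I i \<in> carrier (free_module R I)"
proof -
  interpret ring R by fact
  have "finite {j \<in> I. unit_vector R I i j \<noteq> \<zero>\<^bsub>R\<^esub>}"
    by (rule finite_subset[of _ "{i}"]) (auto simp: unit_vector_def)
  then show ?thesis
    by (auto simp: free_module_def unit_vector_def)
qed

lemma free_extension_unit_vector: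
  assumes M: "right_module R M" and a: "a \<in> I \<rightarrow> carrier M" and i: "i \<in> I"
  shows "free_extension R M I a (unit_vector R I i) = a i"
proof -
  interpret M: right_module R M by fact
  have ai: "a i \<in> carrier M" using a i by auto
  have "free_extension R M I a (unit_vector R I i) = (\<Oplus>\<^bsub>M\<^esub>j \<in> {i}. unit_vector R I i j \<odot>\<^bsub>M\<^esub> a j)"
    by (rule free_extension_superset[OF M a]) (use i in \<open>auto simp: unit_vector_def\<close>)
  also have "\<dots> = a i"
    using ai i M.smult_one by (simp add: unit_vector_def)
  finally show ?thesis .
qed

lemma free_extension_cong:
  assumes M: "right_module R M" and a: "a \<in> I \<rightarrow> carrier M" and v: "v \<in> carrier (free_module R I)"
    and ab: "\<And>i. i \<in> I \<Longrightarrow> a i = b i"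
  shows "free_extension R M I b v = free_extension R M I a v"
proof -
  interpret M: right_module R M by fact
  show ?thesis
    unfolding free_extension_def
    by (rule M.M.add.finprod_cong')
       (use a ab in \<open>auto intro!: M.smult_closed simp: free_module_entry[OF v]\<close>)
qed

lemma free_module_unit_vector_expansion:
  assumes R: "ring R" and v: "v \<in> carrier (free_module R I)"
  shows "free_extension R (free_module R I) I (unit_vector R I) v = v"
proof (rule free_module_eqI)
  let ?F = "free_module R I"
  interpret ring R by fact
  interpret F: right_module R ?F by (rule right_module_free[OF R])
  have vR: "\<And>i. i \<in> I \<Longrightarrow> v i \<in> carrier R" and fin: "finite {i \<in> I. v i \<noteq> \<zero>\<^bsub>R\<^esub>}"
    using v by (auto simp: free_module_def)
  show "free_extension R ?F I (unit_vector R I) v \<in> carrier ?F"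
    by (rule module_hom_closed[OF free_extension_hom[OF right_module_free[OF R]] v])
       (simp add: unit_vector_closed[OF R])
  fix j assume j: "j \<in> I"
  let ?S = "{i \<in> I. v i \<noteq> \<zero>\<^bsub>R\<^esub>}"
  have "free_extension R ?F I (unit_vector R I) v =
      (\<Oplus>\<^bsub>?F\<^esub>i \<in> insert j ?S. v i \<odot>\<^bsub>?F\<^esub> unit_vector R I i)"
    by (rule free_extension_superset[OF right_module_free[OF R]])
       (use fin j vR in \<open>auto simp: unit_vector_closed[OF R]\<close>)
  then have "free_extension R ?F I (unit_vector R I) v j =
      (\<Oplus>\<^bsub>?F\<^esub>i \<in> insert j ?S. v i \<odot>\<^bsub>?F\<^esub> unit_vector R I i) j" by simp
  also have "\<dots> = (\<Oplus>\<^bsub>regular_module R\<^esub>i \<in> insert j ?S. (v i \<odot>\<^bsub>?F\<^esub> unit_vector R I i) j)"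
    by (rule module_hom_finsum[OF right_module_free[OF R] right_module_regular[OF R]
          free_module_coordinate_hom[OF j]])
       (use fin j vR in \<open>auto simp: unit_vector_closed[OF R] intro!: F.smult_closed\<close>)
  also have "\<dots> = (\<Oplus>\<^bsub>R\<^esub>i \<in> insert j ?S. if j = i then v i else \<zero>\<^bsub>R\<^esub>)"
    unfolding finsum_regular_module
    by (rule add.finprod_cong')
       (use j vR in \<open>auto simp: free_module_smult_entry unit_vector_def\<close>)
  also have "\<dots> = v j"
    by (rule add.finprod_singleton) (use fin j vR in auto)
  finally show "free_extension R ?F I (unit_vector R I) v j = v j" .
qed (rule v)

lemma free_module_hom_expansion:
  assumes M: "right_module R M" and f: "f \<in> module_hom R (free_module R I) M"
    and v: "v \<in> carrier (free_module R I)"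
  shows "f v = free_extension R M I (\<lambda>i. f (unit_vector R I i)) v"
proof -
  interpret M: right_module R M by fact
  note R = M.R.ring_axioms
  let ?F = "free_module R I"
  interpret F: right_module R ?F by (rule right_module_free[OF R])
  have fin: "finite {i \<in> I. v i \<noteq> \<zero>\<^bsub>R\<^esub>}"
    using v by (auto simp: free_module_def)
  have "f v = f (free_extension R ?F I (unit_vector R I) v)"
    by (simp add: free_module_unit_vector_expansion[OF R v])
  also have "\<dots> = (\<Oplus>\<^bsub>M\<^esub>i \<in> {i \<in> I. v i \<noteq> \<zero>\<^bsub>R\<^esub>}. f (v i \<odot>\<^bsub>?F\<^esub> unit_vector R I i))"
    unfolding free_extension_def
    by (rule module_hom_finsum[OF right_module_free[OF R] M f fin])
       (use v in \<open>auto simp: free_module_entry[OF v] unit_vector_closed[OF R] F.smult_closed\<close>)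
  also have "\<dots> = (\<Oplus>\<^bsub>M\<^esub>i \<in> {i \<in> I. v i \<noteq> \<zero>\<^bsub>R\<^esub>}. v i \<odot>\<^bsub>M\<^esub> f (unit_vector R I i))"
    by (rule M.M.add.finprod_cong')
       (use v in \<open>auto simp: unit_vector_closed[OF R] free_module_entry module_hom_smult[OF f]
          intro!: M.smult_closed module_hom_closed[OF f]\<close>)
  finally show ?thesis by (simp add: free_extension_def)
qed

lemma projective_free:
  fixes R :: "('r, 'k) ring_scheme" and I :: "'i set"
  assumes R: "ring R"
  shows "projective R (free_module R I)"
  unfolding projective_def
proof (intro allI impI, elim conjE)
  fix A :: "('r, ('i \<Rightarrow> 'r) \<Rightarrow> 'r) module" and B :: "('r, 'i \<Rightarrow> 'r) module" and g h
  let ?F = "free_module R I"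
  assume A: "right_module R A" and B: "right_module R B" and g: "g \<in> module_hom R A B"
    "g ` carrier A = carrier B" and h: "h \<in> module_hom R ?F B"
  have "\<exists>a. a \<in> carrier A \<and> g a = h (unit_vector R I i)" for i
    using module_hom_closed[OF h unit_vector_closed[OF R, of I i]] g(2) by (metis imageE)
  then obtain a where a: "\<And>i. a i \<in> carrier A" "\<And>i. g (a i) = h (unit_vector R I i)"
    by metis
  have k: "free_extension R A I a \<in> module_hom R ?F A"
    by (rule free_extension_hom[OF A]) (use a in auto)
  interpret A: right_module R A by fact
  interpret B: right_module R B by fact
  show "\<exists>k \<in> module_hom R ?F A. \<forall>x \<in> carrier ?F. g (k x) = h x"
  proof (intro bexI[OF _ k] ballI)
    fix v assume v: "v \<in> carrier ?F"
    then have fin: "finite {i \<in> I. v i \<noteq> \<zero>\<^bsub>R\<^esub>}" by (auto simp: free_module_def)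
    have "g (free_extension R A I a v) =
        (\<Oplus>\<^bsub>B\<^esub>i \<in> {i \<in> I. v i \<noteq> \<zero>\<^bsub>R\<^esub>}. g (v i \<odot>\<^bsub>A\<^esub> a i))"
      unfolding free_extension_def
      by (rule module_hom_finsum[OF A B g(1) fin])
         (use a in \<open>auto simp: free_module_entry[OF v] A.smult_closed\<close>)
    also have "\<dots> = free_extension R B I (\<lambda>i. h (unit_vector R I i)) v"
      unfolding free_extension_def
      by (rule B.M.add.finprod_cong')
         (use v a in \<open>auto simp: module_hom_smult[OF g(1)] free_module_entry unit_vector_closed[OF R]
           intro!: B.smult_closed module_hom_closed[OF h]\<close>)
    also have "\<dots> = h v"
      by (rule free_module_hom_expansion[OF B h v, symmetric])
    finally show "g (free_extension R A I a v) = h v" .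
  qed
qed

text \<open>
  The two modules may live on different carrier types, so this also transports projectivity along
  isomorphisms.
\<close>

lemma projective_retract:
  fixes P :: "('r, 'm) module" and Q :: "('r, 'q) module"
  assumes Q: "right_module R Q" and proj: "projective R Q"
    and p: "p \<in> module_hom R Q P" and s: "s \<in> module_hom R P Q"
    and ps: "\<And>x. x \<in> carrier P \<Longrightarrow> p (s x) = x"
  shows "projective R P"
  unfolding projective_def
proof (intro allI impI, elim conjE)
  fix A :: "('r, 'm \<Rightarrow> 'r) module" and B :: "('r, 'm) module" and g h
  assume A: "right_module R A" and B: "right_module R B" and g: "g \<in> module_hom R A B"
    "g ` carrier A = carrier B" and h: "h \<in> module_hom R P B"
  obtain k where k: "k \<in> module_hom R Q A" "\<And>x. x \<in> carrier Q \<Longrightarrow> g (k x) = h (p x)"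
    using projective_lifting[OF Q proj A B g module_hom_compose[OF p h]] by blast
  show "\<exists>k \<in> module_hom R P A. \<forall>x \<in> carrier P. g (k x) = h x"
    by (rule bexI[OF _ module_hom_compose[OF s k(1)]])
       (simp add: k(2) module_hom_closed[OF s] ps)
qed

lemma module_hom_inverse:
  assumes f: "f \<in> module_hom R M N" and inj: "inj_on f (carrier M)" and surj: "f ` carrier M = carrier N"
    and M: "right_module R M"
  shows "inv_into (carrier M) f \<in> module_hom R N M"
proof (rule module_homI)
  interpret M: right_module R M by fact
  let ?g = "inv_into (carrier M) f"
  have g: "?g y \<in> carrier M" "f (?g y) = y" if "y \<in> carrier N" for y
    using that surj by (auto intro: inv_into_into f_inv_into_f)
  have eq: "?g y = x" if "x \<in> carrier M" "f x = y" for x y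
    using that inj by auto
  show "?g y \<in> carrier M" if "y \<in> carrier N" for y using that by (rule g)
  show "?g (y \<oplus>\<^bsub>N\<^esub> z) = ?g y \<oplus>\<^bsub>M\<^esub> ?g z" if "y \<in> carrier N" "z \<in> carrier N" for y z
    by (rule eq) (use that in \<open>simp_all add: g module_hom_add[OF f]\<close>)
  show "?g (r \<odot>\<^bsub>N\<^esub> y) = r \<odot>\<^bsub>M\<^esub> ?g y" if "r \<in> carrier R" "y \<in> carrier N" for r y
    by (rule eq) (use that in \<open>simp_all add: g module_hom_smult[OF f] M.smult_closed\<close>)
qed

lemma projective_iso_image:
  assumes M: "right_module R M" and N: "right_module R N" and f: "f \<in> module_hom R M N"
    and A: "submodule A R M" and inj: "inj_on f A" and proj: "projective R (M\<lparr>carrier := A\<rparr>)"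
  shows "projective R (N\<lparr>carrier := f ` A\<rparr>)"
proof -
  interpret M: right_module R M by fact
  let ?A = "M\<lparr>carrier := A\<rparr>" and ?B = "N\<lparr>carrier := f ` A\<rparr>"
  have A': "right_module R ?A" by (rule M.right_module_submodule[OF A])
  have f': "f \<in> module_hom R ?A ?B"
    by (rule module_hom_restrict_codomain[OF module_hom_restrict_domain[OF f]])
       (use A in \<open>auto simp: M.submodule_iff\<close>)
  have g: "inv_into A f \<in> module_hom R ?B ?A"
    using module_hom_inverse[OF f' _ _ A'] inj by simp
  show ?thesis
    by (rule projective_retract[OF A' proj f' g]) (auto simp: f_inv_into_f)
qed

lemma projective_direct_summand:
  assumes M: "right_module R M" and proj: "projective R M" and D: "direct_summand R M D"
  shows "projective R (M\<lparr>carrier := D\<rparr>)"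
proof -
  interpret right_module R M by fact
  obtain E where DE: "direct_sum R M D E (carrier M)" using D by (auto simp: direct_summand_def)
  obtain p where p: "p \<in> module_hom R (M\<lparr>carrier := carrier M\<rparr>) (M\<lparr>carrier := D\<rparr>)"
    "\<And>a. a \<in> D \<Longrightarrow> p a = a"
    using direct_sum_projection[OF DE] by metis
  have "D \<subseteq> carrier M" by (rule direct_sum_subset[OF DE])
  then show ?thesis
    using projective_retract[OF M proj _ module_hom_inclusion, of p D] p by simp
qed

text \<open>
  The lifts on the two terms are composed with the projections \<open>p\<close> and \<open>1 - p\<close> and added up.
\<close>

lemma projective_direct_sum:
  fixes M :: "('r, 'm) module"
  assumes M: "right_module R M" and PQ: "direct_sum R M P Q N"
    and projP: "projective R (M\<lparr>carrier := P\<rparr>)" and projQ: "projective R (M\<lparr>carrier := Q\<rparr>)"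
  shows "projective R (M\<lparr>carrier := N\<rparr>)"
  unfolding projective_def
proof (intro allI impI, elim conjE)
  fix A :: "('r, 'm \<Rightarrow> 'r) module" and B :: "('r, 'm) module" and g h
  let ?N = "M\<lparr>carrier := N\<rparr>"
  assume A: "right_module R A" and B: "right_module R B" and g: "g \<in> module_hom R A B"
    "g ` carrier A = carrier B" and h: "h \<in> module_hom R ?N B"
  interpret M: right_module R M by fact
  interpret A: right_module R A by fact
  interpret B: right_module R B by fact
  have sub: "submodule P R M" "submodule Q R M" "submodule N R M"
    using PQ M.direct_sum_submodule[OF PQ] by (auto simp: direct_sum_def)
  then have c: "N \<subseteq> carrier M" by (auto simp: M.submodule_iff)
  note PN = M.direct_sum_subset[OF PQ]
  obtain p where p: "p \<in> module_hom R ?N (M\<lparr>carrier := P\<rparr>)" "\<And>x. x \<in> N \<Longrightarrow> x \<ominus>\<^bsub>M\<^esub> p x \<in> Q"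
    using M.direct_sum_projection[OF PQ] by metis
  have pP: "p x \<in> P" if "x \<in> N" for x using module_hom_closed[OF p(1)] that by simp
  have q: "(\<lambda>x. x \<ominus>\<^bsub>M\<^esub> p x) \<in> module_hom R ?N (M\<lparr>carrier := Q\<rparr>)"
  proof (rule module_homI)
    fix x y assume "x \<in> carrier ?N" "y \<in> carrier ?N"
    then have xy: "x \<in> carrier M" "y \<in> carrier M" "p x \<in> carrier M" "p y \<in> carrier M"
      and p': "p (x \<oplus>\<^bsub>M\<^esub> y) = p x \<oplus>\<^bsub>M\<^esub> p y"
      using c pP PN module_hom_add[OF p(1)] by auto
    show "x \<oplus>\<^bsub>?N\<^esub> y \<ominus>\<^bsub>M\<^esub> p (x \<oplus>\<^bsub>?N\<^esub> y) = (x \<ominus>\<^bsub>M\<^esub> p x) \<oplus>\<^bsub>M\<lparr>carrier := Q\<rparr>\<^esub> (y \<ominus>\<^bsub>M\<^esub> p y)"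
      using xy by (simp add: p' M.minus_eq M.minus_add M.a_ac)
  next
    fix r x assume rx: "r \<in> carrier R" "x \<in> carrier ?N"
    then have x: "x \<in> carrier M" "p x \<in> carrier M" and p': "p (r \<odot>\<^bsub>M\<^esub> x) = r \<odot>\<^bsub>M\<^esub> p x"
      using c pP PN module_hom_smult[OF p(1)] by auto
    have "x = (x \<ominus>\<^bsub>M\<^esub> p x) \<oplus>\<^bsub>M\<^esub> p x"
      using x by (simp add: M.eq_minus_iff[symmetric])
    then have "r \<odot>\<^bsub>M\<^esub> x = r \<odot>\<^bsub>M\<^esub> (x \<ominus>\<^bsub>M\<^esub> p x) \<oplus>\<^bsub>M\<^esub> r \<odot>\<^bsub>M\<^esub> p x"
      using rx(1) x M.smult_module_distr by (metis M.minus_closed)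
    then have "r \<odot>\<^bsub>M\<^esub> (x \<ominus>\<^bsub>M\<^esub> p x) = r \<odot>\<^bsub>M\<^esub> x \<ominus>\<^bsub>M\<^esub> r \<odot>\<^bsub>M\<^esub> p x"
      using rx(1) x by (simp add: M.eq_minus_iff M.smult_closed)
    then show "r \<odot>\<^bsub>?N\<^esub> x \<ominus>\<^bsub>M\<^esub> p (r \<odot>\<^bsub>?N\<^esub> x) = r \<odot>\<^bsub>M\<lparr>carrier := Q\<rparr>\<^esub> (x \<ominus>\<^bsub>M\<^esub> p x)"
      by (simp add: p')
  qed (use p in auto)
  have lift: "\<exists>k \<in> module_hom R (M\<lparr>carrier := X\<rparr>) A. \<forall>x \<in> X. g (k x) = h x"
    if "projective R (M\<lparr>carrier := X\<rparr>)" "X \<subseteq> N" for X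
  proof -
    have "h \<in> module_hom R (M\<lparr>carrier := X\<rparr>) B"
      using module_hom_restrict_domain[OF h, of X] that(2) by simp
    then show ?thesis
      using that(1) A B g unfolding projective_def by fastforce
  qed
  obtain k where k: "k \<in> module_hom R (M\<lparr>carrier := P\<rparr>) A" "\<And>x. x \<in> P \<Longrightarrow> g (k x) = h x"
    using lift[OF projP PN(1)] by blast
  obtain l where l: "l \<in> module_hom R (M\<lparr>carrier := Q\<rparr>) A" "\<And>x. x \<in> Q \<Longrightarrow> g (l x) = h x"
    using lift[OF projQ PN(2)] by blast
  note kp = module_hom_compose[OF p(1) k(1)] and lq = module_hom_compose[OF q l(1)]
  let ?f = "\<lambda>x. k (p x) \<oplus>\<^bsub>A\<^esub> l (x \<ominus>\<^bsub>M\<^esub> p x)"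
  have "?f \<in> module_hom R ?N A"
  proof (rule module_homI)
    show "?f x \<in> carrier A" if "x \<in> carrier ?N" for x
      using that module_hom_closed[OF kp] module_hom_closed[OF lq] by auto
    show "?f (x \<oplus>\<^bsub>?N\<^esub> y) = ?f x \<oplus>\<^bsub>A\<^esub> ?f y" if xy: "x \<in> carrier ?N" "y \<in> carrier ?N" for x y
      unfolding module_hom_add[OF kp xy] module_hom_add[OF lq xy]
      using module_hom_closed[OF kp] module_hom_closed[OF lq] xy by (simp add: A.M.a_ac)
    show "?f (r \<odot>\<^bsub>?N\<^esub> x) = r \<odot>\<^bsub>A\<^esub> ?f x" if rx: "r \<in> carrier R" "x \<in> carrier ?N" for r x
      unfolding module_hom_smult[OF kp rx] module_hom_smult[OF lq rx]
      using module_hom_closed[OF kp] module_hom_closed[OF lq] rx by (simp add: A.smult_module_distr)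
  qed
  moreover have "g (?f x) = h x" if x: "x \<in> N" for x
  proof -
    have xM: "x \<in> carrier M" "p x \<in> carrier M" using x pP PN c by auto
    have "g (?f x) = g (k (p x)) \<oplus>\<^bsub>B\<^esub> g (l (x \<ominus>\<^bsub>M\<^esub> p x))"
      using module_hom_closed[OF kp] module_hom_closed[OF lq] x by (simp add: module_hom_add[OF g(1)])
    also have "\<dots> = h (p x) \<oplus>\<^bsub>B\<^esub> h (x \<ominus>\<^bsub>M\<^esub> p x)"
      using k(2) l(2) p(2) pP x by simp
    also have "\<dots> = h (p x \<oplus>\<^bsub>M\<^esub> (x \<ominus>\<^bsub>M\<^esub> p x))"
      using module_hom_add[OF h, of "p x" "x \<ominus>\<^bsub>M\<^esub> p x"] subsetD[OF PN(1) pP[OF x]]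
        subsetD[OF PN(2) p(2)[OF x]] by simp
    also have "p x \<oplus>\<^bsub>M\<^esub> (x \<ominus>\<^bsub>M\<^esub> p x) = x"
      using xM by (metis M.M.a_comm M.eq_minus_iff M.M.minus_closed)
    finally show ?thesis .
  qed
  ultimately show "\<exists>k \<in> module_hom R ?N A. \<forall>x \<in> carrier ?N. g (k x) = h x"
    by (intro bexI[of _ ?f]) auto
qed

lemma submodule_generated:
  assumes M: "right_module R M" and X: "X \<subseteq> carrier M"
  shows "submodule (generated_submodule R M X) R M" and "X \<subseteq> generated_submodule R M X"
    and "\<And>N. submodule N R M \<Longrightarrow> X \<subseteq> N \<Longrightarrow> generated_submodule R M X \<subseteq> N"
proof -
  interpret right_module R M by fact
  show "submodule (generated_submodule R M X) R M"
  proof -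
    have "generated_submodule R M X \<subseteq> carrier M"
      using submodule_carrier X by (auto simp: generated_submodule_def)
    then show ?thesis
      by (auto simp: submodule_iff generated_submodule_def)
  qed
qed (auto simp: generated_submodule_def)

text \<open>
  A set of fewer than \<open>n\<close> generators is padded with zeros, so that the unit vectors can be mapped
  onto it.
\<close>

lemma n_generated_iff_image_of_free:
  assumes M: "right_module R M"
  shows "n_generated R n M \<longleftrightarrow>
    (\<exists>f \<in> module_hom R (free_module R {..<n}) M. f ` carrier (free_module R {..<n}) = carrier M)"
    (is "_ \<longleftrightarrow> (\<exists>f \<in> module_hom R ?F M. _)")
proof
  interpret M: right_module R M by fact
  note R = M.R.ring_axioms
  note F = right_module_free[OF R, of "{..<n}"]
  interpret F: right_module R ?F by (rule F)
  {
    assume "n_generated R n M"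
    then obtain X where X: "X \<subseteq> carrier M" "finite X" "card X \<le> n"
      "generated_submodule R M X = carrier M"
      by (auto simp: n_generated_def)
    obtain e where e: "bij_betw e {..<card X} X"
      using ex_bij_betw_nat_finite[OF X(2)] by (auto simp: atLeast0LessThan)
    define a where "a i = (if i < card X then e i else \<zero>\<^bsub>M\<^esub>)" for i
    have a: "a i \<in> carrier M" for i
      using e X(1) by (auto simp: a_def bij_betw_def)
    have XA: "X \<subseteq> a ` {..<n}"
    proof
      fix x assume "x \<in> X"
      then obtain i where "i < card X" "e i = x" using e by (force simp: bij_betw_def)
      then show "x \<in> a ` {..<n}" using X(3) by (intro image_eqI[of _ _ i]) (auto simp: a_def)
    qed
    let ?f = "free_extension R M {..<n} a"
    have f: "?f \<in> module_hom R ?F M"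
      by (rule free_extension_hom[OF M]) (use a in auto)
    have "?f (unit_vector R {..<n} i) = a i" if "i < n" for i
      by (rule free_extension_unit_vector[OF M]) (use that a in auto)
    then have "a i \<in> ?f ` carrier ?F" if "i < n" for i
      using that unit_vector_closed[OF R, of "{..<n}" i] by (metis imageI)
    then have "X \<subseteq> ?f ` carrier ?F"
      using XA by (auto dest: subsetD)
    then have "generated_submodule R M X \<subseteq> ?f ` carrier ?F"
      by (rule submodule_generated(3)[OF M X(1) submodule_image[OF F M f F.submodule_carrier]])
    then show "\<exists>f \<in> module_hom R ?F M. f ` carrier ?F = carrier M"
      using f X(4) module_hom_closed[OF f] by (intro bexI[OF _ f]) auto
  next
    assume "\<exists>f \<in> module_hom R ?F M. f ` carrier ?F = carrier M"
    then obtain f where f: "f \<in> module_hom R ?F M" "f ` carrier ?F = carrier M" by blast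
    let ?X = "(\<lambda>i. f (unit_vector R {..<n} i)) ` {..<n}"
    have X: "?X \<subseteq> carrier M"
      using module_hom_closed[OF f(1) unit_vector_closed[OF R]] by auto
    have "f v \<in> generated_submodule R M ?X" if v: "v \<in> carrier ?F" for v
    proof -
      have "f v = (\<Oplus>\<^bsub>M\<^esub>i \<in> {i \<in> {..<n}. v i \<noteq> \<zero>\<^bsub>R\<^esub>}. v i \<odot>\<^bsub>M\<^esub> f (unit_vector R {..<n} i))"
        by (rule free_module_hom_expansion[OF M f(1) v, unfolded free_extension_def])
      also have "\<dots> \<in> generated_submodule R M ?X"
      proof (rule M.submodule_finsum[OF submodule_generated(1)[OF M X]])
        fix i assume "i \<in> {i \<in> {..<n}. v i \<noteq> \<zero>\<^bsub>R\<^esub>}"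
        then have "f (unit_vector R {..<n} i) \<in> generated_submodule R M ?X" "v i \<in> carrier R"
          using submodule_generated(2)[OF M X] free_module_entry[OF v] by auto
        then show "v i \<odot>\<^bsub>M\<^esub> f (unit_vector R {..<n} i) \<in> generated_submodule R M ?X"
          using submodule_generated(1)[OF M X] by (simp add: M.submodule_iff)
      qed simp
      finally show ?thesis .
    qed
    then have "f ` carrier ?F \<subseteq> generated_submodule R M ?X"
      by (rule image_subsetI)
    then have "carrier M \<subseteq> generated_submodule R M ?X"
      by (simp only: f(2))
    then have "generated_submodule R M ?X = carrier M"
      using submodule_generated(1)[OF M X] by (auto simp: M.submodule_iff)
    then show "n_generated R n M"
      unfolding n_generated_def
      using X card_image_le[of "{..<n}" "\<lambda>i. f (unit_vector R {..<n} i)"]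
      by (intro exI[of _ ?X]) auto
  }
qed

section \<open>Kernels essential in direct summands\<close>

lemma CS_Rickart_iff: "CS_Rickart R M \<longleftrightarrow> relatively_CS_Rickart R M M"
  by (simp add: CS_Rickart_def relatively_CS_Rickart_def)

text \<open>Composition with an injective map does not change kernels.\<close>

lemma relatively_CS_Rickart_embedding:
  assumes N: "right_module R N" and N': "right_module R N'" and i: "i \<in> module_hom R N N'"
    and inj: "inj_on i (carrier N)" and M: "relatively_CS_Rickart R M N'"
  shows "relatively_CS_Rickart R M N"
  unfolding relatively_CS_Rickart_def
proof
  interpret N: right_module R N by fact
  fix f assume f: "f \<in> module_hom R M N"
  have "i (f x) = \<zero>\<^bsub>N'\<^esub> \<longleftrightarrow> f x = \<zero>\<^bsub>N\<^esub>" if "x \<in> carrier M" for x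
    using inj_on_eq_iff[OF inj module_hom_closed[OF f that] N.M.zero_closed]
    by (simp add: module_hom_zero[OF N N' i])
  then have "a_kernel M N' (\<lambda>x. i (f x)) = a_kernel M N f"
    by (simp add: set_eq_iff a_kernel_mem cong: conj_cong)
  moreover have "essential_in_summand R M (a_kernel M N' (\<lambda>x. i (f x)))"
    using M module_hom_compose[OF f i] by (simp add: relatively_CS_Rickart_def)
  ultimately show "essential_in_summand R M (a_kernel M N f)" by simp
qed

text \<open>
  Given \<open>f\<close> on the retract \<open>M\<close>, the kernel of \<open>f \<circ> p\<close> is essential in a summand \<open>D\<close> of \<open>F\<close>.
  As \<open>D\<close> contains the kernel of \<open>p\<close>, the decomposition \<open>F = D \<oplus> E\<close> is carried by \<open>p\<close> to a
  decomposition of \<open>M\<close>, and \<open>s\<close> maps \<open>p D\<close> back into \<open>D\<close>.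
\<close>

lemma relatively_CS_Rickart_retract:
  assumes F: "right_module R F" and M: "right_module R M" and N: "right_module R N"
    and p: "p \<in> module_hom R F M" and s: "s \<in> module_hom R M F"
    and ps: "\<And>x. x \<in> carrier M \<Longrightarrow> p (s x) = x"
    and FN: "relatively_CS_Rickart R F N"
  shows "relatively_CS_Rickart R M N"
  unfolding relatively_CS_Rickart_def
proof
  interpret F: right_module R F by fact
  interpret M: right_module R M by fact
  interpret N: right_module R N by fact
  fix f assume f: "f \<in> module_hom R M N"
  note fp = module_hom_compose[OF p f]
  obtain D E where DE: "direct_sum R F D E (carrier F)"
    and ess: "essential R (F\<lparr>carrier := D\<rparr>) (a_kernel F N (\<lambda>x. f (p x)))"
    using FN fp unfolding relatively_CS_Rickart_def essential_in_summand_def direct_summand_def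
    by blast
  have D: "submodule D R F" using DE by (simp add: direct_sum_def)
  note ess = ess[unfolded F.essential_in_submodule_iff[OF D]]
  have kerD: "a_kernel F N (\<lambda>x. f (p x)) \<subseteq> D" using ess by blast
  have kerp: "x \<in> D" if "x \<in> carrier F" "p x = \<zero>\<^bsub>M\<^esub>" for x
    using that kerD module_hom_zero[OF M N f] by (auto simp: a_kernel_mem)
  have surj: "p ` carrier F = carrier M"
    using module_hom_closed[OF p] module_hom_closed[OF s] ps by (force simp: image_iff)
  have "direct_sum R M (p ` E) (p ` D) (carrier M)"
    using direct_sum_image[OF F M p F.direct_sum_commute[OF DE]] kerp surj by simp
  then have summand: "direct_summand R M (p ` D)"
    unfolding direct_summand_def using M.direct_sum_commute by blast
  have "essential R (M\<lparr>carrier := p ` D\<rparr>) (a_kernel M N f)"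
    unfolding M.essential_in_submodule_iff[OF submodule_image[OF F M p D]]
  proof (intro conjI ballI impI)
    show "submodule (a_kernel M N f) R M" by (rule submodule_a_kernel[OF M N f])
    show "a_kernel M N f \<subseteq> p ` D"
    proof
      fix x assume "x \<in> a_kernel M N f"
      then have "x \<in> carrier M" "s x \<in> D"
        using kerD module_hom_closed[OF s] ps by (auto simp: a_kernel_mem)
      then show "x \<in> p ` D" using ps by (metis imageI)
    qed
  next
    fix x assume x: "x \<in> p ` D" "x \<noteq> \<zero>\<^bsub>M\<^esub>"
    then obtain d where d: "d \<in> D" "x = p d" by blast
    have c: "d \<in> carrier F" "x \<in> carrier M" "s x \<in> carrier F"
      using d D module_hom_closed[OF p] module_hom_closed[OF s] by (auto simp: F.submodule_iff)
    \<comment> \<open>As \<open>d\<close> and \<open>s x\<close> have the same image under \<open>p\<close>, they differ by an element of \<open>D\<close>.\<close>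
    have "p (d \<ominus>\<^bsub>F\<^esub> s x) = \<zero>\<^bsub>M\<^esub>"
      using c d(2) by (simp add: module_hom_minus[OF F M p] ps M.minus_eq_zero_iff)
    then have "d \<ominus>\<^bsub>F\<^esub> s x \<in> D" using kerp c by simp
    then have "d \<ominus>\<^bsub>F\<^esub> (d \<ominus>\<^bsub>F\<^esub> s x) \<in> D" by (rule F.submodule_minus[OF D d(1)])
    moreover have "s x = d \<ominus>\<^bsub>F\<^esub> (d \<ominus>\<^bsub>F\<^esub> s x)"
      using c by (metis F.M.a_comm F.M.minus_closed F.eq_minus_iff)
    ultimately have "s x \<in> D" by simp
    moreover have "s x \<noteq> \<zero>\<^bsub>F\<^esub>"
      using x(2) ps[OF c(2)] module_hom_zero[OF F M p] by auto
    ultimately obtain r where r: "r \<in> carrier R" "r \<odot>\<^bsub>F\<^esub> s x \<in> a_kernel F N (\<lambda>x. f (p x))"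
      "r \<odot>\<^bsub>F\<^esub> s x \<noteq> \<zero>\<^bsub>F\<^esub>"
      using ess by blast
    have rx: "r \<odot>\<^bsub>F\<^esub> s x = s (r \<odot>\<^bsub>M\<^esub> x)" "r \<odot>\<^bsub>M\<^esub> x \<in> carrier M"
      using r(1) c by (simp_all add: module_hom_smult[OF s] M.smult_closed)
    have "r \<odot>\<^bsub>M\<^esub> x \<in> a_kernel M N f"
      using r(2) rx by (simp add: a_kernel_mem ps)
    moreover have "r \<odot>\<^bsub>M\<^esub> x \<noteq> \<zero>\<^bsub>M\<^esub>"
      using r(3) rx module_hom_zero[OF M F s] by auto
    ultimately show "\<exists>r \<in> carrier R. r \<odot>\<^bsub>M\<^esub> x \<in> a_kernel M N f \<and> r \<odot>\<^bsub>M\<^esub> x \<noteq> \<zero>\<^bsub>M\<^esub>"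
      using r(1) by blast
  qed
  with summand show "essential_in_summand R M (a_kernel M N f)"
    by (auto simp: essential_in_summand_def)
qed

lemma relatively_CS_Rickart_summand:
  assumes M: "right_module R M" and N: "right_module R N" and MN: "relatively_CS_Rickart R M N"
    and D: "direct_summand R M D"
  shows "relatively_CS_Rickart R (M\<lparr>carrier := D\<rparr>) N"
proof -
  interpret M: right_module R M by fact
  obtain E where DE: "direct_sum R M D E (carrier M)" using D by (auto simp: direct_summand_def)
  obtain p where p: "p \<in> module_hom R (M\<lparr>carrier := carrier M\<rparr>) (M\<lparr>carrier := D\<rparr>)"
    "\<And>a. a \<in> D \<Longrightarrow> p a = a"
    using M.direct_sum_projection[OF DE] by metis
  have D: "submodule D R M" using DE by (simp add: direct_sum_def)
  show ?thesis
    by (rule relatively_CS_Rickart_retract[OF M M.right_module_submodule[OF D] N, of p "\<lambda>x. x"])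
       (use p MN D in \<open>auto simp: M.submodule_iff intro: module_hom_inclusion\<close>)
qed

lemma direct_summand_trans:
  assumes M: "right_module R M" and D: "direct_summand R M D" and E: "direct_sum R M E E' D"
  shows "direct_summand R M E"
proof -
  interpret M: right_module R M by fact
  obtain C where "direct_sum R M D C (carrier M)" using D by (auto simp: direct_summand_def)
  then have "direct_sum R M C D (carrier M)" by (rule M.direct_sum_commute)
  then show ?thesis
    using M.direct_sum_assoc[OF _ M.direct_sum_commute[OF E]] unfolding direct_summand_def by blast
qed

lemma kernel_splitting:
  assumes M: "right_module R M" and N: "right_module R N" and f: "f \<in> module_hom R M N"
    and ess: "essential_in_summand R M (a_kernel M N f)"
  obtains D E where "direct_sum R M D E (carrier M)"
    and "essential R (M\<lparr>carrier := D\<rparr>) (a_kernel M N f)" and "inj_on f E"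
proof -
  interpret M: right_module R M by fact
  obtain D E where DE: "direct_sum R M D E (carrier M)"
    and ess: "essential R (M\<lparr>carrier := D\<rparr>) (a_kernel M N f)"
    using ess unfolding essential_in_summand_def direct_summand_def by blast
  have sub: "submodule D R M" "submodule E R M" and disj: "D \<inter> E = {\<zero>\<^bsub>M\<^esub>}"
    using DE by (auto simp: direct_sum_def)
  have "a_kernel M N f \<subseteq> D" using ess M.essential_in_submodule_iff[OF sub(1)] by blast
  then have "x = \<zero>\<^bsub>M\<^esub>" if "x \<in> E" "f x = \<zero>\<^bsub>N\<^esub>" for x
  proof -
    have "x \<in> a_kernel M N f" using that sub(2) by (auto simp: a_kernel_mem M.submodule_iff)
    then have "x \<in> D \<inter> E" using that(1) \<open>a_kernel M N f \<subseteq> D\<close> by blast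
    then show ?thesis using disj by simp
  qed
  then have "inj_on f E"
    by (rule module_hom_inj_on[OF M N f sub(2)])
  then show thesis using that DE ess by blast
qed

text \<open>
  Splitting off the maps one at a time, each step decomposes the current
  summand \<open>D i\<close> as \<open>E i \<oplus> D (Suc i)\<close>, where the kernel of \<open>f i\<close> on \<open>D i\<close> is essential in
  \<open>D (Suc i)\<close> and \<open>f i\<close> is injective on \<open>E i\<close>.  Since essentiality is transitive, the common
  kernel of all the maps is essential in the last summand.
\<close>

lemma common_kernel_chain:
  assumes M: "right_module R M" and N: "right_module R N" and MN: "relatively_CS_Rickart R M N"
    and f: "\<And>i. i < k \<Longrightarrow> f i \<in> module_hom R M N"
  shows "\<exists>D E. D 0 = carrier M \<and>
    (\<forall>i < k. direct_sum R M (E i) (D (Suc i)) (D i) \<and> inj_on (f i) (E i)) \<and>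
    direct_summand R M (D k) \<and>
    essential R (M\<lparr>carrier := D k\<rparr>) {x \<in> carrier M. \<forall>i < k. f i x = \<zero>\<^bsub>N\<^esub>}"
  using f
proof (induction k)
  case 0
  interpret M: right_module R M by fact
  have "direct_sum R M (carrier M) {\<zero>\<^bsub>M\<^esub>} (carrier M)"
    using M.submodule_carrier M.submodule_zero
    by (auto simp: direct_sum_def M.set_add_mem)
  then have "direct_summand R M (carrier M)" by (auto simp: direct_summand_def)
  moreover have "essential R (M\<lparr>carrier := carrier M\<rparr>) (carrier M)"
    unfolding M.essential_in_submodule_iff[OF M.submodule_carrier]
    using M.submodule_carrier M.smult_one by (auto intro!: bexI[of _ "\<one>\<^bsub>R\<^esub>"])
  ultimately show ?case by (intro exI[of _ "\<lambda>_. carrier M"]) auto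
next
  case (Suc k)
  interpret M: right_module R M by fact
  interpret N: right_module R N by fact
  let ?K = "{x \<in> carrier M. \<forall>i < k. f i x = \<zero>\<^bsub>N\<^esub>}"
  obtain D E where 0: "D 0 = carrier M"
    and step: "\<forall>i < k. direct_sum R M (E i) (D (Suc i)) (D i) \<and> inj_on (f i) (E i)"
    and Dk: "direct_summand R M (D k)" and ess: "essential R (M\<lparr>carrier := D k\<rparr>) ?K"
    using Suc.IH Suc.prems by auto
  have sub: "submodule (D k) R M" using Dk by (auto simp: direct_summand_def direct_sum_def)
  note essk = ess[unfolded M.essential_in_submodule_iff[OF sub]]
  let ?D = "M\<lparr>carrier := D k\<rparr>"
  have D': "right_module R ?D" by (rule M.right_module_submodule[OF sub])
  interpret D: right_module R ?D by (rule D')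
  have fk: "f k \<in> module_hom R M N" using Suc.prems by simp
  have fD: "f k \<in> module_hom R ?D N"
    by (rule module_hom_restrict_domain[OF fk]) (use sub in \<open>auto simp: M.submodule_iff\<close>)
  have "essential_in_summand R ?D (a_kernel ?D N (f k))"
    using relatively_CS_Rickart_summand[OF M N MN Dk] fD by (simp add: relatively_CS_Rickart_def)
  then obtain D' E' where DE: "direct_sum R ?D D' E' (carrier ?D)"
    and ess': "essential R (?D\<lparr>carrier := D'\<rparr>) (a_kernel ?D N (f k))" and inj: "inj_on (f k) E'"
    by (rule kernel_splitting[OF D' N fD])
  have DE': "direct_sum R M D' E' (D k)" using DE M.direct_sum_in_submodule[OF sub] by simp
  have subD': "submodule D' R M" and D'k: "D' \<subseteq> D k"
    using DE' M.direct_sum_subset[OF DE'] by (auto simp: direct_sum_def)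
  have ess': "essential R (M\<lparr>carrier := D'\<rparr>) (a_kernel ?D N (f k))" using ess' by simp
  note ess' = ess'[unfolded M.essential_in_submodule_iff[OF subD']]
  let ?K' = "{x \<in> carrier M. \<forall>i < Suc k. f i x = \<zero>\<^bsub>N\<^esub>}"
  have K': "?K' = ?K \<inter> a_kernel M N (f k)" by (auto simp: a_kernel_mem less_Suc_eq)
  have "essential R (M\<lparr>carrier := D'\<rparr>) ?K'"
    unfolding M.essential_in_submodule_iff[OF subD']
  proof (intro conjI ballI impI)
    show "submodule ?K' R M"
      unfolding K' using essk submodule_a_kernel[OF M N fk] M.submodule_Int by blast
    have "?K' \<subseteq> a_kernel ?D N (f k)"
      using essk unfolding K' by (auto simp: a_kernel_mem)
    then show "?K' \<subseteq> D'" using ess' by blast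
  next
    fix x assume x: "x \<in> D'" "x \<noteq> \<zero>\<^bsub>M\<^esub>"
    then obtain r where r: "r \<in> carrier R" "r \<odot>\<^bsub>M\<^esub> x \<in> a_kernel ?D N (f k)" "r \<odot>\<^bsub>M\<^esub> x \<noteq> \<zero>\<^bsub>M\<^esub>"
      using ess' by blast
    have rx: "r \<odot>\<^bsub>M\<^esub> x \<in> D k" "f k (r \<odot>\<^bsub>M\<^esub> x) = \<zero>\<^bsub>N\<^esub>"
      using r(2) by (auto simp: a_kernel_mem)
    then obtain t where t: "t \<in> carrier R" "t \<odot>\<^bsub>M\<^esub> (r \<odot>\<^bsub>M\<^esub> x) \<in> ?K" "t \<odot>\<^bsub>M\<^esub> (r \<odot>\<^bsub>M\<^esub> x) \<noteq> \<zero>\<^bsub>M\<^esub>"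
      using essk r(3) by blast
    have c: "x \<in> carrier M" "r \<odot>\<^bsub>M\<^esub> x \<in> carrier M"
      using x subD' r(1) M.smult_closed by (auto simp: M.submodule_iff)
    have "f k (t \<odot>\<^bsub>M\<^esub> (r \<odot>\<^bsub>M\<^esub> x)) = \<zero>\<^bsub>N\<^esub>"
      using t(1) c rx by (simp add: module_hom_smult[OF fk] N.smult_zero_right)
    then have "t \<odot>\<^bsub>M\<^esub> (r \<odot>\<^bsub>M\<^esub> x) \<in> ?K'"
      using t(2) by (auto simp: less_Suc_eq)
    moreover have eq: "t \<odot>\<^bsub>M\<^esub> (r \<odot>\<^bsub>M\<^esub> x) = (r \<otimes>\<^bsub>R\<^esub> t) \<odot>\<^bsub>M\<^esub> x"
      using M.smult_assoc r(1) t(1) c by simp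
    ultimately have "(r \<otimes>\<^bsub>R\<^esub> t) \<odot>\<^bsub>M\<^esub> x \<in> ?K' \<and> (r \<otimes>\<^bsub>R\<^esub> t) \<odot>\<^bsub>M\<^esub> x \<noteq> \<zero>\<^bsub>M\<^esub>"
      using t(3) unfolding eq by blast
    then show "\<exists>r \<in> carrier R. r \<odot>\<^bsub>M\<^esub> x \<in> ?K' \<and> r \<odot>\<^bsub>M\<^esub> x \<noteq> \<zero>\<^bsub>M\<^esub>"
      by (rule bexI) (rule M.R.m_closed[OF r(1) t(1)])
  qed
  moreover have "direct_summand R M D'" by (rule direct_summand_trans[OF M Dk DE'])
  moreover define D1 where "D1 = D(Suc k := D')"
  moreover define E1 where "E1 = E(k := E')"
  moreover have "direct_sum R M (E1 i) (D1 (Suc i)) (D1 i) \<and> inj_on (f i) (E1 i)" if "i < Suc k" for i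
  proof (cases "i = k")
    case True
    then show ?thesis
      using inj M.direct_sum_commute[OF DE'] by (simp add: D1_def E1_def)
  next
    case False
    then show ?thesis
      using step[rule_format, of i] that by (simp add: D1_def E1_def)
  qed
  ultimately have "D1 0 = carrier M \<and>
    (\<forall>i < Suc k. direct_sum R M (E1 i) (D1 (Suc i)) (D1 i) \<and> inj_on (f i) (E1 i)) \<and>
    direct_summand R M (D1 (Suc k)) \<and> essential R (M\<lparr>carrier := D1 (Suc k)\<rparr>) ?K'"
    using 0 by simp
  then show ?case by (intro exI)
qed

text \<open>
  For \<open>x\<close> in \<open>D\<close>, the annihilator of \<open>f x\<close> consists of the \<open>r\<close> with \<open>x r\<close> in the kernel.  Given
  \<open>a \<noteq> 0\<close>, either \<open>x a = 0\<close>, and \<open>a\<close> itself annihilates, or some nonzero multiple \<open>x a r\<close> lies in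
  the kernel, and then \<open>a r\<close> is a nonzero annihilator.
\<close>

lemma singular_image:
  assumes M: "right_module R M" and N: "right_module R N" and f: "f \<in> module_hom R M N"
    and D: "submodule D R M" and ess: "essential R (M\<lparr>carrier := D\<rparr>) (a_kernel M N f)"
  shows "singular R (N\<lparr>carrier := f ` D\<rparr>)"
  unfolding singular_def
proof
  interpret M: right_module R M by fact
  interpret N: right_module R N by fact
  interpret RR: right_module R "regular_module R" by (rule right_module_regular[OF M.R.ring_axioms])
  fix y assume "y \<in> carrier (N\<lparr>carrier := f ` D\<rparr>)"
  then obtain x where x: "x \<in> D" "y = f x" by auto
  have c: "x \<in> carrier M" "y \<in> carrier N"
    using x D module_hom_closed[OF f] by (auto simp: M.submodule_iff)
  let ?I = "right_annihilator R (N\<lparr>carrier := f ` D\<rparr>) y"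
  have I: "r \<in> ?I \<longleftrightarrow> r \<in> carrier R \<and> r \<odot>\<^bsub>M\<^esub> x \<in> a_kernel M N f" for r
    using c x M.smult_closed by (auto simp: right_annihilator_def a_kernel_mem module_hom_smult[OF f])
  note ess = ess[unfolded M.essential_in_submodule_iff[OF D]]
  have K: "submodule (a_kernel M N f) R M" using ess by blast
  show "essential R (regular_module R) ?I"
    unfolding RR.essential_iff
  proof (intro conjI ballI impI)
    show "submodule ?I R (regular_module R)"
      using K c(1) unfolding RR.submodule_iff M.submodule_iff
      by (auto simp: I regular_module_def M.smult_zero_left M.smult_ring_distr M.smult_assoc)
    fix a assume "a \<in> carrier (regular_module R)" and a: "a \<noteq> \<zero>\<^bsub>regular_module R\<^esub>"
    then have aR: "a \<in> carrier R" by (simp add: regular_module_def)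
    then have ax: "a \<odot>\<^bsub>M\<^esub> x \<in> D" using D x by (simp add: M.submodule_iff)
    show "\<exists>r \<in> carrier R. r \<odot>\<^bsub>regular_module R\<^esub> a \<in> ?I \<and> r \<odot>\<^bsub>regular_module R\<^esub> a \<noteq> \<zero>\<^bsub>regular_module R\<^esub>"
    proof (cases "a \<odot>\<^bsub>M\<^esub> x = \<zero>\<^bsub>M\<^esub>")
      case True
      then have "a \<in> ?I" using K aR by (simp add: I M.submodule_iff)
      then show ?thesis using a aR by (intro bexI[of _ "\<one>\<^bsub>R\<^esub>"]) (auto simp: regular_module_def)
    next
      case False
      then obtain r where r: "r \<in> carrier R" "r \<odot>\<^bsub>M\<^esub> (a \<odot>\<^bsub>M\<^esub> x) \<in> a_kernel M N f"
        "r \<odot>\<^bsub>M\<^esub> (a \<odot>\<^bsub>M\<^esub> x) \<noteq> \<zero>\<^bsub>M\<^esub>"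
        using ess ax by blast
      have eq: "(a \<otimes>\<^bsub>R\<^esub> r) \<odot>\<^bsub>M\<^esub> x = r \<odot>\<^bsub>M\<^esub> (a \<odot>\<^bsub>M\<^esub> x)"
        using M.smult_assoc aR r(1) c by simp
      then have "a \<otimes>\<^bsub>R\<^esub> r \<noteq> \<zero>\<^bsub>R\<^esub>"
        using r(3) M.smult_zero_left[OF c(1)] by auto
      then show ?thesis
        using r eq aR by (intro bexI[of _ r]) (auto simp: I regular_module_def)
    qed
  qed
qed

section \<open>Finite direct sums\<close>

lemma (in right_module) direct_sum_iff_bij_betw:
  "direct_sum R M A B N \<longleftrightarrow> submodule A R M \<and> submodule B R M \<and>
     bij_betw (\<lambda>(a, b). a \<oplus>\<^bsub>M\<^esub> b) (A \<times> B) N"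
proof (intro iffI conjI)
  assume AB: "direct_sum R M A B N"
  then show "submodule A R M" "submodule B R M" by (auto simp: direct_sum_def)
  have "(\<lambda>(a, b). a \<oplus>\<^bsub>M\<^esub> b) ` (A \<times> B) = N"
    using AB by (simp add: direct_sum_def set_add_image)
  moreover have "inj_on (\<lambda>(a, b). a \<oplus>\<^bsub>M\<^esub> b) (A \<times> B)"
    using direct_sum_unique[OF AB] by (auto simp: inj_on_def)
  ultimately show "bij_betw (\<lambda>(a, b). a \<oplus>\<^bsub>M\<^esub> b) (A \<times> B) N"
    by (simp add: bij_betw_def)
next
  assume *: "submodule A R M \<and> submodule B R M \<and> bij_betw (\<lambda>(a, b). a \<oplus>\<^bsub>M\<^esub> b) (A \<times> B) N"
  then have c: "A \<subseteq> carrier M" "\<zero>\<^bsub>M\<^esub> \<in> A" "\<zero>\<^bsub>M\<^esub> \<in> B"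
    and inj: "inj_on (\<lambda>(a, b). a \<oplus>\<^bsub>M\<^esub> b) (A \<times> B)"
    and im: "(\<lambda>(a, b). a \<oplus>\<^bsub>M\<^esub> b) ` (A \<times> B) = N"
    unfolding submodule_iff bij_betw_def by blast+
  have "x = \<zero>\<^bsub>M\<^esub>" if x: "x \<in> A" "x \<in> B" for x
  proof -
    have "x \<oplus>\<^bsub>M\<^esub> \<zero>\<^bsub>M\<^esub> = \<zero>\<^bsub>M\<^esub> \<oplus>\<^bsub>M\<^esub> x" using subsetD[OF c(1) x(1)] by simp
    moreover have "(x, \<zero>\<^bsub>M\<^esub>) \<in> A \<times> B" "(\<zero>\<^bsub>M\<^esub>, x) \<in> A \<times> B" using x c by blast+
    ultimately have "(x, \<zero>\<^bsub>M\<^esub>) = (\<zero>\<^bsub>M\<^esub>, x)"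
      by (rule inj_onD[OF inj, of "(x, \<zero>\<^bsub>M\<^esub>)" "(\<zero>\<^bsub>M\<^esub>, x)", unfolded prod.case])
    then show ?thesis by (rule Pair_inject)
  qed
  then have "A \<inter> B = {\<zero>\<^bsub>M\<^esub>}" using c(2,3) by blast
  moreover have "A <+>\<^bsub>M\<^esub> B = N"
    by (simp add: im[symmetric] set_add_image)
  ultimately show "direct_sum R M A B N"
    using * by (simp add: direct_sum_def)
qed

lemma (in right_module) submodule_sums:
  assumes I: "finite I" and A: "\<And>i. i \<in> I \<Longrightarrow> submodule (A i) R M"
  shows "submodule ((\<lambda>x. \<Oplus>\<^bsub>M\<^esub>i \<in> I. x i) ` (\<Pi>\<^sub>E i \<in> I. A i)) R M" (is "submodule (?S ` ?P) R M")
proof -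
  have A': "A i \<subseteq> carrier M" "\<zero>\<^bsub>M\<^esub> \<in> A i" "\<And>x y. x \<in> A i \<Longrightarrow> y \<in> A i \<Longrightarrow> x \<oplus>\<^bsub>M\<^esub> y \<in> A i"
    "\<And>r x. r \<in> carrier R \<Longrightarrow> x \<in> A i \<Longrightarrow> r \<odot>\<^bsub>M\<^esub> x \<in> A i" if "i \<in> I" for i
    using A[OF that] by (auto simp: submodule_iff)
  have P: "x \<in> I \<rightarrow> carrier M" if "x \<in> ?P" for x
    using that A'(1) by (auto simp: PiE_iff)
  show ?thesis
    unfolding submodule_iff
  proof (intro conjI ballI)
    show "?S ` ?P \<subseteq> carrier M"
      using P by (auto intro!: M.finsum_closed)
    have "?S (\<lambda>i \<in> I. \<zero>\<^bsub>M\<^esub>) = (\<Oplus>\<^bsub>M\<^esub>i \<in> I. \<zero>\<^bsub>M\<^esub>)"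
      by (rule M.add.finprod_cong') auto
    then have "?S (\<lambda>i \<in> I. \<zero>\<^bsub>M\<^esub>) = \<zero>\<^bsub>M\<^esub>" by simp
    moreover have "(\<lambda>i \<in> I. \<zero>\<^bsub>M\<^esub>) \<in> ?P" using A'(2) by auto
    ultimately show "\<zero>\<^bsub>M\<^esub> \<in> ?S ` ?P" by (rule image_eqI[where f = ?S, OF sym])
  next
    fix u v assume "u \<in> ?S ` ?P" "v \<in> ?S ` ?P"
    then obtain x y where xy: "x \<in> ?P" "y \<in> ?P" "u = ?S x" "v = ?S y" by blast
    have "?S (\<lambda>i \<in> I. x i \<oplus>\<^bsub>M\<^esub> y i) = (\<Oplus>\<^bsub>M\<^esub>i \<in> I. x i \<oplus>\<^bsub>M\<^esub> y i)"
      by (rule M.add.finprod_cong') (use P[OF xy(1)] P[OF xy(2)] in auto)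
    also have "\<dots> = u \<oplus>\<^bsub>M\<^esub> v"
      using M.finsum_addf[OF P[OF xy(1)] P[OF xy(2)]] xy by simp
    finally have "?S (\<lambda>i \<in> I. x i \<oplus>\<^bsub>M\<^esub> y i) = u \<oplus>\<^bsub>M\<^esub> v" .
    moreover have "(\<lambda>i \<in> I. x i \<oplus>\<^bsub>M\<^esub> y i) \<in> ?P" using A'(3) xy by (auto simp: PiE_iff)
    ultimately show "u \<oplus>\<^bsub>M\<^esub> v \<in> ?S ` ?P" by (rule image_eqI[where f = ?S, OF sym])
  next
    fix r u assume r: "r \<in> carrier R" and "u \<in> ?S ` ?P"
    then obtain x where x: "x \<in> ?P" "u = ?S x" by blast
    have "?S (\<lambda>i \<in> I. r \<odot>\<^bsub>M\<^esub> x i) = (\<Oplus>\<^bsub>M\<^esub>i \<in> I. r \<odot>\<^bsub>M\<^esub> x i)"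
      by (rule M.add.finprod_cong') (use P[OF x(1)] r smult_closed in auto)
    also have "\<dots> = r \<odot>\<^bsub>M\<^esub> u"
      using smult_finsum[OF I r P[OF x(1)]] x by simp
    finally have "?S (\<lambda>i \<in> I. r \<odot>\<^bsub>M\<^esub> x i) = r \<odot>\<^bsub>M\<^esub> u" .
    moreover have "(\<lambda>i \<in> I. r \<odot>\<^bsub>M\<^esub> x i) \<in> ?P" using A'(4) r x by (auto simp: PiE_iff)
    ultimately show "r \<odot>\<^bsub>M\<^esub> u \<in> ?S ` ?P" by (rule image_eqI[where f = ?S, OF sym])
  qed
qed

text \<open>
  Peeling off one term reduces finite families to binary direct sums: a family indexed by
  \<open>insert a I\<close> is a pair of its value at \<open>a\<close> and a family indexed by \<open>I\<close>.
\<close>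

lemma (in right_module) direct_sum_family_insert:
  assumes I: "finite I" and a: "a \<notin> I"
  shows "direct_sum_family R M (insert a I) A N \<longleftrightarrow>
    (\<exists>B. direct_sum_family R M I A B \<and> direct_sum R M (A a) B N)"
proof (cases "\<forall>i \<in> insert a I. submodule (A i) R M")
  case True
  let ?S = "\<lambda>x. \<Oplus>\<^bsub>M\<^esub>i \<in> I. x i" and ?P = "\<Pi>\<^sub>E i \<in> I. A i"
  let ?c = "\<lambda>(y, g). g(a := y)" and ?T = "\<lambda>x. \<Oplus>\<^bsub>M\<^esub>i \<in> insert a I. x i"
  have A: "A i \<subseteq> carrier M" "\<zero>\<^bsub>M\<^esub> \<in> A i" if "i \<in> insert a I" for i
    using True that by (auto simp: submodule_iff)
  have P: "x \<in> I \<rightarrow> carrier M" if "x \<in> ?P" for x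
    using that A(1) by (auto simp: PiE_iff)
  have S: "submodule (?S ` ?P) R M" by (rule submodule_sums[OF I]) (use True in auto)
  have c: "bij_betw ?c (A a \<times> ?P) (\<Pi>\<^sub>E i \<in> insert a I. A i)"
    using inj_combinator[OF a, of A] by (simp add: bij_betw_def PiE_insert_eq)
  have Tc: "?T (?c z) = fst z \<oplus>\<^bsub>M\<^esub> ?S (snd z)" if "z \<in> A a \<times> ?P" for z
  proof -
    obtain y g where z: "z = (y, g)" "y \<in> A a" "g \<in> ?P" using \<open>z \<in> A a \<times> ?P\<close> by (rule SigmaE)
    have "?T (g(a := y)) = (g(a := y)) a \<oplus>\<^bsub>M\<^esub> (\<Oplus>\<^bsub>M\<^esub>i \<in> I. (g(a := y)) i)"
      by (rule M.finsum_insert[OF I a]) (use z A P[OF z(3)] a in auto)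
    also have "(\<Oplus>\<^bsub>M\<^esub>i \<in> I. (g(a := y)) i) = ?S g"
      by (rule M.add.finprod_cong') (use P[OF z(3)] a in auto)
    finally show ?thesis using z by simp
  qed
  have fam: "direct_sum_family R M (insert a I) A N \<longleftrightarrow>
      bij_betw (\<lambda>z. fst z \<oplus>\<^bsub>M\<^esub> ?S (snd z)) (A a \<times> ?P) N"
  proof -
    have "direct_sum_family R M (insert a I) A N \<longleftrightarrow> bij_betw ?T (\<Pi>\<^sub>E i \<in> insert a I. A i) N"
      using True by (simp add: direct_sum_family_def)
    also have "\<dots> \<longleftrightarrow> bij_betw (?T \<circ> ?c) (A a \<times> ?P) N"
      by (rule bij_betw_comp_iff[OF c])
    also have "\<dots> \<longleftrightarrow> bij_betw (\<lambda>z. fst z \<oplus>\<^bsub>M\<^esub> ?S (snd z)) (A a \<times> ?P) N"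
      by (rule bij_betw_cong) (unfold comp_def, rule Tc)
    finally show ?thesis .
  qed
  show ?thesis
  proof
    assume "direct_sum_family R M (insert a I) A N"
    then have inj: "inj_on (\<lambda>z. fst z \<oplus>\<^bsub>M\<^esub> ?S (snd z)) (A a \<times> ?P)"
      and im: "(\<lambda>z. fst z \<oplus>\<^bsub>M\<^esub> ?S (snd z)) ` (A a \<times> ?P) = N"
      by (simp_all add: fam bij_betw_def)
    have "inj_on ?S ?P"
    proof (rule inj_onI)
      fix x y assume "x \<in> ?P" "y \<in> ?P" "?S x = ?S y"
      then show "x = y"
        using inj_onD[OF inj, of "(\<zero>\<^bsub>M\<^esub>, x)" "(\<zero>\<^bsub>M\<^esub>, y)"] A(2)[of a] by simp
    qed
    then have 1: "direct_sum_family R M I A (?S ` ?P)"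
      using True by (simp add: direct_sum_family_def bij_betw_def)
    have "inj_on (\<lambda>(a, b). a \<oplus>\<^bsub>M\<^esub> b) (A a \<times> ?S ` ?P)"
    proof (rule inj_onI)
      fix u v assume "u \<in> A a \<times> ?S ` ?P" "v \<in> A a \<times> ?S ` ?P"
        and eq: "(case u of (a, b) \<Rightarrow> a \<oplus>\<^bsub>M\<^esub> b) = (case v of (a, b) \<Rightarrow> a \<oplus>\<^bsub>M\<^esub> b)"
      then obtain y g y' g' where *: "u = (y, ?S g)" "v = (y', ?S g')" "(y, g) \<in> A a \<times> ?P"
        "(y', g') \<in> A a \<times> ?P" by blast
      then show "u = v" using inj_onD[OF inj _ *(3,4)] eq by simp
    qed
    moreover have "(\<lambda>(a, b). a \<oplus>\<^bsub>M\<^esub> b) ` (A a \<times> ?S ` ?P) = N"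
      unfolding im[symmetric] by force
    ultimately have "direct_sum R M (A a) (?S ` ?P) N"
      unfolding direct_sum_iff_bij_betw using True S by (simp add: bij_betw_def)
    with 1 show "\<exists>B. direct_sum_family R M I A B \<and> direct_sum R M (A a) B N" by blast
  next
    assume "\<exists>B. direct_sum_family R M I A B \<and> direct_sum R M (A a) B N"
    then obtain B where "bij_betw ?S ?P B" and 2: "bij_betw (\<lambda>(a, b). a \<oplus>\<^bsub>M\<^esub> b) (A a \<times> B) N"
      unfolding direct_sum_iff_bij_betw direct_sum_family_def by blast
    then have "bij_betw (map_prod id ?S) (A a \<times> ?P) (A a \<times> B)"
      by (intro bij_betw_map_prod) auto
    from bij_betw_trans[OF this 2] show "direct_sum_family R M (insert a I) A N"
      unfolding fam by (simp add: comp_def case_prod_unfold map_prod_def)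
  qed
next
  case False
  then show ?thesis by (auto simp: direct_sum_family_def direct_sum_def)
qed

lemma (in right_module) direct_sum_family_empty:
  "direct_sum_family R M {} A N \<longleftrightarrow> N = {\<zero>\<^bsub>M\<^esub>}"
  by (auto simp: direct_sum_family_def bij_betw_def)

lemma (in right_module) direct_sum_zero:
  assumes "submodule D R M"
  shows "direct_sum R M D {\<zero>\<^bsub>M\<^esub>} D"
proof -
  have "a \<oplus>\<^bsub>M\<^esub> \<zero>\<^bsub>M\<^esub> = a" if "a \<in> D" for a
    using that assms by (auto simp: submodule_iff)
  then have "D <+>\<^bsub>M\<^esub> {\<zero>\<^bsub>M\<^esub>} = D"
    by (simp add: set_eq_iff set_add_mem cong: bex_cong)
  then show ?thesis
    using assms submodule_zero by (auto simp: direct_sum_def submodule_iff)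
qed

lemma projective_zero:
  fixes M :: "('r, 'm) module"
  assumes M: "right_module R M"
  shows "projective R (M\<lparr>carrier := {\<zero>\<^bsub>M\<^esub>}\<rparr>)"
  unfolding projective_def
proof (intro allI impI, elim conjE)
  interpret M: right_module R M by fact
  let ?Z = "M\<lparr>carrier := {\<zero>\<^bsub>M\<^esub>}\<rparr>"
  fix A :: "('r, 'm \<Rightarrow> 'r) module" and B :: "('r, 'm) module" and g h
  assume A: "right_module R A" and B: "right_module R B" and g: "g \<in> module_hom R A B"
    and h: "h \<in> module_hom R ?Z B"
  interpret A: right_module R A by fact
  have k: "(\<lambda>_. \<zero>\<^bsub>A\<^esub>) \<in> module_hom R ?Z A"
    by (rule module_homI) (auto simp: A.smult_zero_right)
  have "h \<zero>\<^bsub>M\<^esub> = \<zero>\<^bsub>B\<^esub>"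
    using module_hom_zero[OF M.right_module_submodule[OF M.submodule_zero] B h] by simp
  then show "\<exists>k \<in> module_hom R ?Z A. \<forall>x \<in> carrier ?Z. g (k x) = h x"
    using module_hom_zero[OF A B g] by (intro bexI[OF _ k]) simp
qed

lemma projective_direct_sum_family:
  assumes M: "right_module R M" and "finite I" and "direct_sum_family R M I A N"
    and "\<And>i. i \<in> I \<Longrightarrow> projective R (M\<lparr>carrier := A i\<rparr>)"
  shows "projective R (M\<lparr>carrier := N\<rparr>)"
  using assms(2-4)
proof (induction I arbitrary: N rule: finite_induct)
  interpret M: right_module R M by fact
  case empty
  then show ?case by (simp add: M.direct_sum_family_empty projective_zero[OF M])
next
  interpret M: right_module R M by fact
  case (insert a I)
  then obtain B where B: "direct_sum_family R M I A B" "direct_sum R M (A a) B N"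
    using M.direct_sum_family_insert[OF insert.hyps] by blast
  have "projective R (M\<lparr>carrier := B\<rparr>)" by (rule insert.IH[OF B(1)]) (simp add: insert.prems)
  then show ?case using projective_direct_sum[OF M B(2)] insert.prems(2) by simp
qed

text \<open>
  The chain is assembled from its lower end, each step adding one term to the family already
  obtained for the next member.
\<close>

lemma (in right_module) direct_sum_family_of_chain:
  assumes chain: "\<And>i. i < n \<Longrightarrow> direct_sum R M (E i) (D (Suc i)) (D i)"
    and Dn: "submodule (D n) R M" and "k \<le> n"
  shows "direct_sum_family R M {k..n} (E(n := D n)) (D k)"
  using \<open>k \<le> n\<close>
proof (induction rule: inc_induct)
  case base
  have "direct_sum_family R M {} (E(n := D n)) {\<zero>\<^bsub>M\<^esub>}"
    by (simp add: direct_sum_family_empty)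
  then show ?case
    using direct_sum_family_insert[of "{}" n "E(n := D n)"] direct_sum_zero[OF Dn]
    by (auto simp del: fun_upd_apply simp: fun_upd_same)
next
  case (step i)
  have "{i..n} = insert i {Suc i..n}" using step.hyps by auto
  moreover have "(E(n := D n)) i = E i" using step.hyps by simp
  ultimately show ?case
    using direct_sum_family_insert[of "{Suc i..n}" i "E(n := D n)"] step.IH chain[OF step.hyps(2)]
    by (auto simp del: fun_upd_apply)
qed

section \<open>Images that split into a projective and a singular part\<close>

text \<open>
  The multiplier \<open>r\<close> is built up coordinate by coordinate: a coordinate that has already become
  zero needs no further multiplication, and any other one can be moved into its ideal without
  becoming zero.
\<close>

lemma essential_ideals_multiplier:
  fixes n :: nat
  assumes R: "ring R" and v: "v \<in> carrier (free_module R {..<n})" "v \<noteq> \<zero>\<^bsub>free_module R {..<n}\<^esub>"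
    and I: "\<And>i. i < n \<Longrightarrow> essential R (regular_module R) (I i)"
  shows "\<exists>r \<in> carrier R. r \<odot>\<^bsub>free_module R {..<n}\<^esub> v \<noteq> \<zero>\<^bsub>free_module R {..<n}\<^esub> \<and> (\<forall>i < n. v i \<otimes>\<^bsub>R\<^esub> r \<in> I i)"
proof -
  let ?F = "free_module R {..<n}"
  interpret ring R by fact
  interpret RR: right_module R "regular_module R" by (rule right_module_regular[OF R])
  interpret F: right_module R ?F by (rule right_module_free[OF R])
  have vR: "v i \<in> carrier R" if "i < n" for i using free_module_entry[OF v(1)] that by simp
  have ideal: "\<zero>\<^bsub>R\<^esub> \<in> I i" "\<And>x r. x \<in> I i \<Longrightarrow> r \<in> carrier R \<Longrightarrow> x \<otimes>\<^bsub>R\<^esub> r \<in> I i" if "i < n" for i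
    using I[OF that] unfolding RR.essential_iff RR.submodule_iff by (auto simp: regular_module_def)
  have "\<exists>r \<in> carrier R. r \<odot>\<^bsub>?F\<^esub> v \<noteq> \<zero>\<^bsub>?F\<^esub> \<and> (\<forall>i < k. v i \<otimes>\<^bsub>R\<^esub> r \<in> I i)"
    if "k \<le> n" for k :: nat
    using \<open>k \<le> n\<close>
  proof (induction k)
    case 0
    then show ?case using v F.smult_one by (intro bexI[of _ "\<one>\<^bsub>R\<^esub>"]) auto
  next
    case (Suc k)
    then obtain r where r: "r \<in> carrier R" "r \<odot>\<^bsub>?F\<^esub> v \<noteq> \<zero>\<^bsub>?F\<^esub>" "\<And>i. i < k \<Longrightarrow> v i \<otimes>\<^bsub>R\<^esub> r \<in> I i"
      by auto
    have k: "k < n" using Suc.prems by simp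
    show ?case
    proof (cases "v k \<otimes>\<^bsub>R\<^esub> r = \<zero>\<^bsub>R\<^esub>")
      case True
      then show ?thesis using r ideal(1)[OF k] by (intro bexI[of _ r]) (auto simp: less_Suc_eq)
    next
      case False
      then obtain t where t: "t \<in> carrier R" "v k \<otimes>\<^bsub>R\<^esub> r \<otimes>\<^bsub>R\<^esub> t \<in> I k" "v k \<otimes>\<^bsub>R\<^esub> r \<otimes>\<^bsub>R\<^esub> t \<noteq> \<zero>\<^bsub>R\<^esub>"
        using I[OF k] vR[OF k] r(1) unfolding RR.essential_iff by (auto simp: regular_module_def)
      have assoc: "v i \<otimes>\<^bsub>R\<^esub> (r \<otimes>\<^bsub>R\<^esub> t) = v i \<otimes>\<^bsub>R\<^esub> r \<otimes>\<^bsub>R\<^esub> t" if "i < n" for i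
        using vR[OF that] r(1) t(1) by (simp add: m_assoc)
      have "((r \<otimes>\<^bsub>R\<^esub> t) \<odot>\<^bsub>?F\<^esub> v) k \<noteq> \<zero>\<^bsub>R\<^esub>"
        using t(3) k by (simp add: free_module_smult_entry assoc)
      then have "(r \<otimes>\<^bsub>R\<^esub> t) \<odot>\<^bsub>?F\<^esub> v \<noteq> \<zero>\<^bsub>?F\<^esub>"
        using k by (auto simp: free_module_zero_entry)
      moreover have "v i \<otimes>\<^bsub>R\<^esub> (r \<otimes>\<^bsub>R\<^esub> t) \<in> I i" if "i < Suc k" for i
        using that k t(1,2) r(3) ideal(2) by (auto simp: less_Suc_eq assoc)
      ultimately show ?thesis using r(1) t(1) by (intro bexI[of _ "r \<otimes>\<^bsub>R\<^esub> t"]) auto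
    qed
  qed
  then show ?thesis by blast
qed

text \<open>
  The composite of \<open>f\<close> with the projection onto \<open>P\<close> splits, so its kernel \<open>D\<close> is a summand, and
  \<open>f\<close> maps \<open>D\<close> into \<open>S\<close>.  An element of \<open>D\<close> is a combination of unit vectors, which need not lie in
  \<open>D\<close> themselves.  But \<open>f\<close> composed with the projection onto \<open>D\<close> maps all of them into \<open>S\<close>, so
  their images have essential annihilators, and it suffices to multiply the element into the kernel
  coordinate by coordinate.
\<close>

lemma kernel_essential_in_summand:
  fixes n :: nat
  assumes N: "right_module R N" and f: "f \<in> module_hom R (free_module R {..<n}) N"
    and PS: "direct_sum R N P S (f ` carrier (free_module R {..<n}))"
    and P: "projective R (N\<lparr>carrier := P\<rparr>)" and S: "singular R (N\<lparr>carrier := S\<rparr>)"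
  shows "essential_in_summand R (free_module R {..<n}) (a_kernel (free_module R {..<n}) N f)"
proof -
  let ?F = "free_module R {..<n}" and ?P = "N\<lparr>carrier := P\<rparr>"
  interpret N: right_module R N by fact
  note R = N.R.ring_axioms
  note F = right_module_free[OF R, of "{..<n}"]
  interpret F: right_module R ?F by (rule F)
  have sub: "submodule P R N" "submodule S R N" using PS by (auto simp: direct_sum_def)
  note P' = N.right_module_submodule[OF sub(1)]
  obtain q where q: "q \<in> module_hom R (N\<lparr>carrier := f ` carrier ?F\<rparr>) ?P"
    "\<And>a. a \<in> P \<Longrightarrow> q a = a" "\<And>x. x \<in> f ` carrier ?F \<Longrightarrow> x \<ominus>\<^bsub>N\<^esub> q x \<in> S"
    using N.direct_sum_projection[OF PS] by metis
  have qS: "f x \<in> S" if x: "x \<in> carrier ?F" "q (f x) = \<zero>\<^bsub>N\<^esub>" for x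
  proof -
    have "f x \<ominus>\<^bsub>N\<^esub> \<zero>\<^bsub>N\<^esub> \<in> S" using q(3)[of "f x"] x by simp
    moreover have "f x \<ominus>\<^bsub>N\<^esub> \<zero>\<^bsub>N\<^esub> = f x"
      using module_hom_closed[OF f x(1)] N.eq_minus_iff[of "f x" "\<zero>\<^bsub>N\<^esub>" "f x"] by simp
    ultimately show ?thesis by simp
  qed
  let ?g = "\<lambda>x. q (f x)"
  have g: "?g \<in> module_hom R ?F ?P"
    by (rule module_hom_compose[OF module_hom_restrict_codomain[OF f] q(1)]) simp
  have "x \<in> ?g ` carrier ?F" if "x \<in> P" for x
    using N.direct_sum_subset(1)[OF PS] that q(2)[OF that] by (force simp: image_iff)
  then have surj: "?g ` carrier ?F = carrier ?P"
    using module_hom_closed[OF g] by auto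
  obtain k where k: "k \<in> module_hom R ?P ?F" "\<And>x. x \<in> P \<Longrightarrow> ?g (k x) = x"
    using projective_lifting[OF P' P F P' g surj module_homI, of "\<lambda>x. x"] by auto
  define D where "D = a_kernel ?F ?P ?g"
  have D: "x \<in> D \<longleftrightarrow> x \<in> carrier ?F \<and> ?g x = \<zero>\<^bsub>N\<^esub>" for x
    by (simp add: D_def a_kernel_mem)
  have subD: "submodule D R ?F" unfolding D_def by (rule submodule_a_kernel[OF F P' g])
  interpret P: right_module R ?P by (rule P')
  have DE: "direct_sum R ?F D (k ` P) (carrier ?F)"
    unfolding direct_sum_def
  proof (intro conjI)
    have "submodule (k ` P) R ?F"
      using submodule_image[OF P' F k(1) P.submodule_carrier] by simp
    then show subE: "submodule (k ` P) R ?F" .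
    have "x = \<zero>\<^bsub>?F\<^esub>" if x: "x \<in> D \<inter> k ` P" for x
    proof -
      obtain y where y: "y \<in> P" "x = k y" using x by blast
      then have "y = \<zero>\<^bsub>N\<^esub>" using x k(2)[of y] by (simp add: D)
      then show ?thesis using y module_hom_zero[OF P' F k(1)] by simp
    qed
    moreover have "\<zero>\<^bsub>?F\<^esub> \<in> D" "\<zero>\<^bsub>?F\<^esub> \<in> k ` P"
      using subD subE by (simp_all only: F.submodule_iff)
    ultimately show "D \<inter> k ` P = {\<zero>\<^bsub>?F\<^esub>}" by blast
    show "D <+>\<^bsub>?F\<^esub> k ` P = carrier ?F"
    proof
      show "D <+>\<^bsub>?F\<^esub> k ` P \<subseteq> carrier ?F"
        using F.submodule_set_add[OF subD subE] by (simp add: F.submodule_iff)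
      show "carrier ?F \<subseteq> D <+>\<^bsub>?F\<^esub> k ` P"
      proof
        fix x assume x: "x \<in> carrier ?F"
        have gx: "?g x \<in> P" using module_hom_closed[OF g x] by simp
        have kx: "k (?g x) \<in> carrier ?F" using module_hom_closed[OF k(1)] gx by simp
        have "?g (x \<ominus>\<^bsub>?F\<^esub> k (?g x)) = ?g x \<ominus>\<^bsub>?P\<^esub> ?g (k (?g x))"
          by (rule module_hom_minus[OF F P' g x kx])
        also have "\<dots> = \<zero>\<^bsub>?P\<^esub>"
          unfolding k(2)[OF gx] by (subst P.minus_eq_zero_iff) (use gx in auto)
        finally have "x \<ominus>\<^bsub>?F\<^esub> k (?g x) \<in> D"
          using x kx by (simp add: D)
        moreover have "x = (x \<ominus>\<^bsub>?F\<^esub> k (?g x)) \<oplus>\<^bsub>?F\<^esub> k (?g x)"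
          using x kx by (simp add: F.eq_minus_iff[symmetric])
        ultimately show "x \<in> D <+>\<^bsub>?F\<^esub> k ` P"
          using gx unfolding F.set_add_mem by blast
      qed
    qed
  qed (rule subD)
  obtain p where p: "p \<in> module_hom R (?F\<lparr>carrier := carrier ?F\<rparr>) (?F\<lparr>carrier := D\<rparr>)"
    "\<And>a. a \<in> D \<Longrightarrow> p a = a"
    using F.direct_sum_projection[OF DE] by metis
  have pF: "p \<in> module_hom R ?F ?F"
    using module_hom_compose[OF p(1) module_hom_inclusion] subD by (simp add: F.submodule_iff)
  have pD: "p x \<in> D" if "x \<in> carrier ?F" for x
    using module_hom_closed[OF p(1)] that by simp
  note fp = module_hom_compose[OF pF f]
  define I where "I i = right_annihilator R (N\<lparr>carrier := S\<rparr>) (f (p (unit_vector R {..<n} i)))" for i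
  have "f (p (unit_vector R {..<n} i)) \<in> S" for i
    using qS pD[OF unit_vector_closed[OF R]] by (auto simp: D)
  then have I: "essential R (regular_module R) (I i)" for i
    using S by (simp add: singular_def I_def)
  have "essential R (?F\<lparr>carrier := D\<rparr>) (a_kernel ?F N f)"
    unfolding F.essential_in_submodule_iff[OF subD]
  proof (intro conjI ballI impI)
    show "submodule (a_kernel ?F N f) R ?F" by (rule submodule_a_kernel[OF F N f])
    show "a_kernel ?F N f \<subseteq> D"
      using q(2)[of "\<zero>\<^bsub>N\<^esub>"] sub(1) by (auto simp: a_kernel_mem D N.submodule_iff)
  next
    fix x assume x: "x \<in> D" "x \<noteq> \<zero>\<^bsub>?F\<^esub>"
    then have xF: "x \<in> carrier ?F" by (simp add: D)
    obtain r where r: "r \<in> carrier R" "r \<odot>\<^bsub>?F\<^esub> x \<noteq> \<zero>\<^bsub>?F\<^esub>" "\<And>i. i < n \<Longrightarrow> x i \<otimes>\<^bsub>R\<^esub> r \<in> I i"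
      using essential_ideals_multiplier[OF R xF x(2), of I] I by blast
    have rx: "r \<odot>\<^bsub>?F\<^esub> x \<in> carrier ?F" "r \<odot>\<^bsub>?F\<^esub> x \<in> D"
      using r(1) x(1) subD by (auto simp: F.submodule_iff)
    have "f (r \<odot>\<^bsub>?F\<^esub> x) = f (p (r \<odot>\<^bsub>?F\<^esub> x))" by (simp add: p(2)[OF rx(2)])
    also have "\<dots> = free_extension R N {..<n} (\<lambda>i. f (p (unit_vector R {..<n} i))) (r \<odot>\<^bsub>?F\<^esub> x)"
      by (rule free_module_hom_expansion[OF N fp rx(1)])
    also have "\<dots> = (\<Oplus>\<^bsub>N\<^esub>i \<in> {i \<in> {..<n}. (r \<odot>\<^bsub>?F\<^esub> x) i \<noteq> \<zero>\<^bsub>R\<^esub>}. \<zero>\<^bsub>N\<^esub>)"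
      unfolding free_extension_def
      by (rule N.M.add.finprod_cong')
         (use r(3) in \<open>auto simp: free_module_smult_entry I_def right_annihilator_def\<close>)
    also have "\<dots> = \<zero>\<^bsub>N\<^esub>" by simp
    finally have "r \<odot>\<^bsub>?F\<^esub> x \<in> a_kernel ?F N f" using rx by (simp add: a_kernel_mem)
    then show "\<exists>r \<in> carrier R. r \<odot>\<^bsub>?F\<^esub> x \<in> a_kernel ?F N f \<and> r \<odot>\<^bsub>?F\<^esub> x \<noteq> \<zero>\<^bsub>?F\<^esub>"
      using r(1,2) by blast
  qed
  then show ?thesis
    using DE unfolding essential_in_summand_def direct_summand_def by blast
qed

section \<open>Matrices\<close>

text \<open>
  Being essential in a direct summand, expressed in the ordered set \<open>L\<close> of all submodules alone:
  the zero submodule and the whole module occur as least and greatest element.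
\<close>

definition essential_in_complemented :: "'a set set \<Rightarrow> 'a set \<Rightarrow> bool" where
  "essential_in_complemented L N \<longleftrightarrow> (\<exists>D \<in> L. \<exists>E \<in> L. N \<subseteq> D \<and>
     (\<forall>K \<in> L. K \<subseteq> D \<and> K \<subseteq> E \<longrightarrow> (\<forall>Z \<in> L. K \<subseteq> Z)) \<and>
     (\<forall>K \<in> L. D \<subseteq> K \<and> E \<subseteq> K \<longrightarrow> (\<forall>T \<in> L. T \<subseteq> K)) \<and>
     (\<forall>K \<in> L. K \<subseteq> D \<and> (\<forall>J \<in> L. J \<subseteq> N \<and> J \<subseteq> K \<longrightarrow> (\<forall>Z \<in> L. J \<subseteq> Z)) \<longrightarrow> (\<forall>Z \<in> L. K \<subseteq> Z)))"

lemma essential_in_complemented_image: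
  assumes le: "\<And>A B. A \<in> L \<Longrightarrow> B \<in> L \<Longrightarrow> u A \<subseteq> u B \<longleftrightarrow> A \<subseteq> B" and N: "N \<in> L"
  shows "essential_in_complemented (u ` L) (u N) \<longleftrightarrow> essential_in_complemented L N"
  unfolding essential_in_complemented_def bex_simps ball_simps
  using N by (simp add: le cong: ball_cong bex_cong)

lemma (in right_module) essential_in_summand_iff_complemented:
  assumes N: "submodule N R M"
  shows "essential_in_summand R M N \<longleftrightarrow> essential_in_complemented {K. submodule K R M} N"
proof -
  let ?L = "{K. submodule K R M}"
  have zero: "(\<forall>Z \<in> ?L. K \<subseteq> Z) \<longleftrightarrow> K = {\<zero>\<^bsub>M\<^esub>}" if "K \<in> ?L" for K
  proof
    assume "\<forall>Z \<in> ?L. K \<subseteq> Z"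
    then have "K \<subseteq> {\<zero>\<^bsub>M\<^esub>}" using submodule_zero by blast
    then show "K = {\<zero>\<^bsub>M\<^esub>}" using that by (auto simp: submodule_iff)
  qed (simp add: submodule_iff)
  have top: "(\<forall>T \<in> ?L. T \<subseteq> K) \<longleftrightarrow> carrier M \<subseteq> K" for K
    using submodule_carrier by (auto simp: submodule_iff)
  have meet: "(\<forall>K \<in> ?L. K \<subseteq> A \<and> K \<subseteq> B \<longrightarrow> (\<forall>Z \<in> ?L. K \<subseteq> Z)) \<longleftrightarrow> A \<inter> B = {\<zero>\<^bsub>M\<^esub>}"
    if A: "A \<in> ?L" and B: "B \<in> ?L" for A B
  proof
    have AB: "A \<inter> B \<in> ?L" using A B submodule_Int by simp
    show "A \<inter> B = {\<zero>\<^bsub>M\<^esub>}" if "\<forall>K \<in> ?L. K \<subseteq> A \<and> K \<subseteq> B \<longrightarrow> (\<forall>Z \<in> ?L. K \<subseteq> Z)"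
      using that[rule_format, OF AB] zero[OF AB] by blast
    assume AB0: "A \<inter> B = {\<zero>\<^bsub>M\<^esub>}"
    show "\<forall>K \<in> ?L. K \<subseteq> A \<and> K \<subseteq> B \<longrightarrow> (\<forall>Z \<in> ?L. K \<subseteq> Z)"
    proof (intro ballI impI)
      fix K Z assume "K \<in> ?L" "K \<subseteq> A \<and> K \<subseteq> B" "Z \<in> ?L"
      then have "K \<subseteq> {\<zero>\<^bsub>M\<^esub>}" "\<zero>\<^bsub>M\<^esub> \<in> Z" using AB0 by (blast, simp add: submodule_iff)
      then show "K \<subseteq> Z" by blast
    qed
  qed
  have join: "(\<forall>K \<in> ?L. A \<subseteq> K \<and> B \<subseteq> K \<longrightarrow> (\<forall>T \<in> ?L. T \<subseteq> K)) \<longleftrightarrow> A <+>\<^bsub>M\<^esub> B = carrier M"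
    if A: "A \<in> ?L" and B: "B \<in> ?L" for A B
  proof
    have AB: "A <+>\<^bsub>M\<^esub> B \<in> ?L" using A B submodule_set_add by simp
    have c: "\<zero>\<^bsub>M\<^esub> \<in> A" "\<zero>\<^bsub>M\<^esub> \<in> B" "A \<subseteq> carrier M" "B \<subseteq> carrier M"
      using A B by (simp_all add: submodule_iff)
    have "a = a \<oplus>\<^bsub>M\<^esub> \<zero>\<^bsub>M\<^esub>" "b = \<zero>\<^bsub>M\<^esub> \<oplus>\<^bsub>M\<^esub> b" if "a \<in> A" "b \<in> B" for a b
      using that c by auto
    then have "A \<subseteq> A <+>\<^bsub>M\<^esub> B" "B \<subseteq> A <+>\<^bsub>M\<^esub> B"
      unfolding subset_iff set_add_mem using c(1,2) by metis+
    then show "A <+>\<^bsub>M\<^esub> B = carrier M"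
      if "\<forall>K \<in> ?L. A \<subseteq> K \<and> B \<subseteq> K \<longrightarrow> (\<forall>T \<in> ?L. T \<subseteq> K)"
      using that[rule_format, OF AB] AB submodule_carrier by (simp add: submodule_iff subset_antisym)
    assume eq: "A <+>\<^bsub>M\<^esub> B = carrier M"
    show "\<forall>K \<in> ?L. A \<subseteq> K \<and> B \<subseteq> K \<longrightarrow> (\<forall>T \<in> ?L. T \<subseteq> K)"
    proof (intro ballI impI)
      fix K T assume K: "K \<in> ?L" "A \<subseteq> K \<and> B \<subseteq> K" and T: "T \<in> ?L"
      have "A <+>\<^bsub>M\<^esub> B \<subseteq> K"
      proof
        fix x assume "x \<in> A <+>\<^bsub>M\<^esub> B"
        then obtain a b where "a \<in> K" "b \<in> K" "x = a \<oplus>\<^bsub>M\<^esub> b"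
          using K(2) by (auto simp: set_add_mem)
        then show "x \<in> K" using K(1) by (simp add: submodule_iff)
      qed
      moreover have "T \<subseteq> carrier M" using T by (simp add: submodule_iff)
      ultimately show "T \<subseteq> K" using eq by blast
    qed
  qed
  have ess: "essential R (M\<lparr>carrier := D\<rparr>) N \<longleftrightarrow> N \<subseteq> D \<and>
      (\<forall>K \<in> ?L. K \<subseteq> D \<and> (\<forall>J \<in> ?L. J \<subseteq> N \<and> J \<subseteq> K \<longrightarrow> (\<forall>Z \<in> ?L. J \<subseteq> Z)) \<longrightarrow> (\<forall>Z \<in> ?L. K \<subseteq> Z))"
    if D: "D \<in> ?L" for D
  proof -
    have sub: "submodule D R M" and NL: "N \<in> ?L" using D N by simp_all
    have "(\<forall>K \<in> ?L. K \<subseteq> D \<and> (\<forall>J \<in> ?L. J \<subseteq> N \<and> J \<subseteq> K \<longrightarrow> (\<forall>Z \<in> ?L. J \<subseteq> Z)) \<longrightarrow> (\<forall>Z \<in> ?L. K \<subseteq> Z))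
      \<longleftrightarrow> (\<forall>K \<in> ?L. K \<subseteq> D \<and> N \<inter> K = {\<zero>\<^bsub>M\<^esub>} \<longrightarrow> K = {\<zero>\<^bsub>M\<^esub>})"
      by (rule ball_cong[OF refl]) (simp only: meet[OF NL] zero)
    also have "\<dots> \<longleftrightarrow> (\<forall>K. submodule K R (M\<lparr>carrier := D\<rparr>) \<and> K \<noteq> {\<zero>\<^bsub>M\<^esub>} \<longrightarrow> N \<inter> K \<noteq> {\<zero>\<^bsub>M\<^esub>})"
      unfolding submodule_of_submodule[OF sub] by blast
    finally show ?thesis
      using N by (simp add: essential_def submodule_of_submodule[OF sub])
  qed
  have summand: "direct_summand R M D \<longleftrightarrow> D \<in> ?L \<and> (\<exists>E \<in> ?L.
      (\<forall>K \<in> ?L. K \<subseteq> D \<and> K \<subseteq> E \<longrightarrow> (\<forall>Z \<in> ?L. K \<subseteq> Z)) \<and>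
      (\<forall>K \<in> ?L. D \<subseteq> K \<and> E \<subseteq> K \<longrightarrow> (\<forall>T \<in> ?L. T \<subseteq> K)))" for D
  proof (cases "D \<in> ?L")
    case True
    have "direct_summand R M D \<longleftrightarrow> (\<exists>E \<in> ?L. D \<inter> E = {\<zero>\<^bsub>M\<^esub>} \<and> D <+>\<^bsub>M\<^esub> E = carrier M)"
      using True by (auto simp: direct_summand_def direct_sum_def)
    also have "\<dots> \<longleftrightarrow> (\<exists>E \<in> ?L.
      (\<forall>K \<in> ?L. K \<subseteq> D \<and> K \<subseteq> E \<longrightarrow> (\<forall>Z \<in> ?L. K \<subseteq> Z)) \<and>
      (\<forall>K \<in> ?L. D \<subseteq> K \<and> E \<subseteq> K \<longrightarrow> (\<forall>T \<in> ?L. T \<subseteq> K)))"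
      by (rule bex_cong[OF refl]) (simp only: meet[OF True] join[OF True])
    finally show ?thesis using True by blast
  qed (auto simp: direct_summand_def direct_sum_def)
  have swap: "(D \<in> L \<and> (\<exists>E \<in> L. A E \<and> B E)) \<and> C \<and> G \<longleftrightarrow> (\<exists>E \<in> L. C \<and> A E \<and> B E \<and> G)"
    if "D \<in> L" for L :: "'c set set" and D A B C G
    using that by blast
  have "essential_in_summand R M N \<longleftrightarrow>
      (\<exists>D \<in> ?L. direct_summand R M D \<and> essential R (M\<lparr>carrier := D\<rparr>) N)"
    unfolding essential_in_summand_def using summand by blast
  also have "\<dots> \<longleftrightarrow> essential_in_complemented ?L N"
    unfolding essential_in_complemented_def
  proof (rule bex_cong[OF refl], unfold summand)
    fix D assume D: "D \<in> ?L"
    show "(D \<in> ?L \<and> (\<exists>E \<in> ?L.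
        (\<forall>K \<in> ?L. K \<subseteq> D \<and> K \<subseteq> E \<longrightarrow> (\<forall>Z \<in> ?L. K \<subseteq> Z)) \<and>
        (\<forall>K \<in> ?L. D \<subseteq> K \<and> E \<subseteq> K \<longrightarrow> (\<forall>T \<in> ?L. T \<subseteq> K)))) \<and>
        essential R (M\<lparr>carrier := D\<rparr>) N \<longleftrightarrow>
      (\<exists>E \<in> ?L. N \<subseteq> D \<and>
        (\<forall>K \<in> ?L. K \<subseteq> D \<and> K \<subseteq> E \<longrightarrow> (\<forall>Z \<in> ?L. K \<subseteq> Z)) \<and>
        (\<forall>K \<in> ?L. D \<subseteq> K \<and> E \<subseteq> K \<longrightarrow> (\<forall>T \<in> ?L. T \<subseteq> K)) \<and>
        (\<forall>K \<in> ?L. K \<subseteq> D \<and> (\<forall>J \<in> ?L. J \<subseteq> N \<and> J \<subseteq> K \<longrightarrow> (\<forall>Z \<in> ?L. J \<subseteq> Z)) \<longrightarrow> (\<forall>Z \<in> ?L. K \<subseteq> Z)))"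
      unfolding ess[OF D] by (rule swap[OF D])
  qed
  finally show ?thesis .
qed

text \<open>
  A bijection \<open>u\<close> between the submodules of two modules over different rings that respects
  inclusion in both directions therefore preserves the property.
\<close>

lemma essential_in_summand_order_isomorphism:
  assumes M: "right_module R M" and M': "right_module R' M'"
    and up: "\<And>N. submodule N R M \<Longrightarrow> submodule (u N) R' M' \<and> d (u N) = N"
    and down: "\<And>J. submodule J R' M' \<Longrightarrow> submodule (d J) R M \<and> u (d J) = J"
    and mono_up: "\<And>A B. A \<subseteq> B \<Longrightarrow> u A \<subseteq> u B" and mono_down: "\<And>A B. A \<subseteq> B \<Longrightarrow> d A \<subseteq> d B"
    and N: "submodule N R M"
  shows "essential_in_summand R M N \<longleftrightarrow> essential_in_summand R' M' (u N)"
proof -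
  interpret M: right_module R M by fact
  interpret M': right_module R' M' by fact
  have image: "{J. submodule J R' M'} = u ` {K. submodule K R M}"
  proof (intro equalityI subsetI)
    fix J assume "J \<in> {J. submodule J R' M'}"
    then have "J = u (d J)" "d J \<in> {K. submodule K R M}" using down by simp_all
    then show "J \<in> u ` {K. submodule K R M}" by (rule image_eqI)
  qed (use up in auto)
  have "u A \<subseteq> u B \<longleftrightarrow> A \<subseteq> B" if "submodule A R M" "submodule B R M" for A B
    using mono_up[of A B] mono_down[of "u A" "u B"] up that by auto
  then show ?thesis
    unfolding M.essential_in_summand_iff_complemented[OF N]
      M'.essential_in_summand_iff_complemented[OF conjunct1[OF up[OF N]]] image
    using N by (subst essential_in_complemented_image) auto
qed

definition matrix_column :: "nat \<Rightarrow> (nat \<times> nat \<Rightarrow> 'r) \<Rightarrow> nat \<Rightarrow> nat \<Rightarrow> 'r" where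
  "matrix_column n A j = (\<lambda>i \<in> {..<n}. A (i, j))"

definition matrix_of_columns :: "nat \<Rightarrow> (nat \<Rightarrow> nat \<Rightarrow> 'r) \<Rightarrow> nat \<times> nat \<Rightarrow> 'r" where
  "matrix_of_columns n c = restrict (\<lambda>(i, j). c j i) ({..<n} \<times> {..<n})"

lemma matrix_column_closed:
  "A \<in> carrier (Mat n R) \<Longrightarrow> j < n \<Longrightarrow> matrix_column n A j \<in> carrier (free_module R {..<n})"
  by (auto simp: matrix_column_def free_module_def Mat_def)

lemma matrix_of_columns_closed:
  "(\<And>j. j < n \<Longrightarrow> c j \<in> carrier (free_module R {..<n})) \<Longrightarrow> matrix_of_columns n c \<in> carrier (Mat n R)"
  by (auto simp: matrix_of_columns_def free_module_def Mat_def)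

lemma matrix_column_of_columns:
  "j < n \<Longrightarrow> c j \<in> carrier (free_module R {..<n}) \<Longrightarrow> matrix_column n (matrix_of_columns n c) j = c j"
  by (auto simp: matrix_of_columns_def matrix_column_def free_module_def PiE_iff extensional_def
      restrict_def fun_eq_iff)

lemma matrix_eqI:
  assumes "A \<in> carrier (Mat n R)" and "B \<in> carrier (Mat n R)"
    and col: "\<And>j. j < n \<Longrightarrow> matrix_column n A j = matrix_column n B j"
  shows "A = B"
proof (rule PiE_ext[of A "{..<n} \<times> {..<n}" "\<lambda>_. carrier R" B])
  fix z :: "nat \<times> nat" assume "z \<in> {..<n} \<times> {..<n}"
  then obtain i j where z: "z = (i, j)" "i < n" "j < n" by auto
  then show "A z = B z" using fun_cong[OF col[OF z(3)], of i] by (simp add: matrix_column_def)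
qed (use assms in \<open>simp_all add: Mat_def\<close>)

lemma matrix_column_add:
  "j < n \<Longrightarrow> matrix_column n (A \<oplus>\<^bsub>Mat n R\<^esub> B) j =
     matrix_column n A j \<oplus>\<^bsub>free_module R {..<n}\<^esub> matrix_column n B j"
  by (auto simp: matrix_column_def Mat_def free_module_def fun_eq_iff)

lemma matrix_column_zero: "j < n \<Longrightarrow> matrix_column n \<zero>\<^bsub>Mat n R\<^esub> j = \<zero>\<^bsub>free_module R {..<n}\<^esub>"
  by (auto simp: matrix_column_def Mat_def free_module_def fun_eq_iff)

text \<open>
  The linear map with matrix \<open>A\<close>; multiplying by \<open>A\<close> applies it to every column.
\<close>

definition matrix_map ::
    "('r, 'k) ring_scheme \<Rightarrow> nat \<Rightarrow> (nat \<times> nat \<Rightarrow> 'r) \<Rightarrow> (nat \<Rightarrow> 'r) \<Rightarrow> nat \<Rightarrow> 'r" where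
  "matrix_map R n A = free_extension R (free_module R {..<n}) {..<n} (matrix_column n A)"

lemma matrix_map_hom:
  "ring R \<Longrightarrow> A \<in> carrier (Mat n R) \<Longrightarrow>
    matrix_map R n A \<in> module_hom R (free_module R {..<n}) (free_module R {..<n})"
  unfolding matrix_map_def
  by (rule free_extension_hom[OF right_module_free]) (auto intro: matrix_column_closed)

lemma matrix_map_unit_vector:
  "ring R \<Longrightarrow> A \<in> carrier (Mat n R) \<Longrightarrow> k < n \<Longrightarrow>
    matrix_map R n A (unit_vector R {..<n} k) = matrix_column n A k"
  unfolding matrix_map_def
  by (rule free_extension_unit_vector[OF right_module_free]) (auto intro: matrix_column_closed)

lemma matrix_column_mult:
  assumes R: "ring R" and A: "A \<in> carrier (Mat n R)" and B: "B \<in> carrier (Mat n R)" and j: "j < n"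
  shows "matrix_column n (A \<otimes>\<^bsub>Mat n R\<^esub> B) j = matrix_map R n A (matrix_column n B j)"
proof (rule free_module_eqI)
  let ?F = "free_module R {..<n}"
  note F = right_module_free[OF R, of "{..<n}"]
  interpret ring R by fact
  interpret S: ring "Mat n R" by (rule ring_Mat[OF R])
  interpret F: right_module R ?F by (rule F)
  have Bj: "matrix_column n B j \<in> carrier ?F" by (rule matrix_column_closed[OF B j])
  show "matrix_column n (A \<otimes>\<^bsub>Mat n R\<^esub> B) j \<in> carrier ?F"
    using matrix_column_closed[OF S.m_closed[OF A B] j] .
  show "matrix_map R n A (matrix_column n B j) \<in> carrier ?F"
    by (rule module_hom_closed[OF matrix_map_hom[OF R A] Bj])
  fix i assume i: "i \<in> {..<n}"
  have entry: "A (k, l) \<in> carrier R" "B (k, l) \<in> carrier R" if "k < n" "l < n" for k l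
    using A B that by (auto simp: Mat_def)
  have "matrix_map R n A (matrix_column n B j) =
      (\<Oplus>\<^bsub>?F\<^esub>k \<in> {..<n}. matrix_column n B j k \<odot>\<^bsub>?F\<^esub> matrix_column n A k)"
    unfolding matrix_map_def
    by (rule free_extension_superset[OF F])
       (use matrix_column_closed[OF A] free_module_entry[OF Bj] in auto)
  then have "matrix_map R n A (matrix_column n B j) i =
      (\<Oplus>\<^bsub>?F\<^esub>k \<in> {..<n}. matrix_column n B j k \<odot>\<^bsub>?F\<^esub> matrix_column n A k) i" by simp
  also have "\<dots> = (\<Oplus>\<^bsub>regular_module R\<^esub>k \<in> {..<n}. (matrix_column n B j k \<odot>\<^bsub>?F\<^esub> matrix_column n A k) i)"
    by (rule module_hom_finsum[OF F right_module_regular[OF R] free_module_coordinate_hom[OF i]])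
       (use matrix_column_closed[OF A] free_module_entry[OF Bj] F.smult_closed in auto)
  also have "\<dots> = (\<Oplus>\<^bsub>R\<^esub>k \<in> {..<n}. A (i, k) \<otimes>\<^bsub>R\<^esub> B (k, j))"
    unfolding finsum_regular_module
    by (rule add.finprod_cong')
       (use i j entry in \<open>auto simp: free_module_smult_entry matrix_column_def\<close>)
  also have "\<dots> = matrix_column n (A \<otimes>\<^bsub>Mat n R\<^esub> B) j i"
    using i j by (simp add: matrix_column_def Mat_def)
  finally show "matrix_column n (A \<otimes>\<^bsub>Mat n R\<^esub> B) j i = matrix_map R n A (matrix_column n B j) i" ..
qed

text \<open>
  The matrix with \<open>1\<close> in position \<open>(k, j)\<close>, scaled by \<open>r\<close>: multiplying by it on the right moves
  column \<open>k\<close>, times \<open>r\<close>, to position \<open>j\<close> and deletes everything else.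
\<close>

definition elementary_matrix ::
    "('r, 'k) ring_scheme \<Rightarrow> nat \<Rightarrow> nat \<Rightarrow> nat \<Rightarrow> 'r \<Rightarrow> nat \<times> nat \<Rightarrow> 'r" where
  "elementary_matrix R n k j r = matrix_of_columns n (\<lambda>l. if l = j
     then r \<odot>\<^bsub>free_module R {..<n}\<^esub> unit_vector R {..<n} k else \<zero>\<^bsub>free_module R {..<n}\<^esub>)"

lemma
  assumes R: "ring R" and r: "r \<in> carrier R"
  shows elementary_matrix_closed: "elementary_matrix R n k j r \<in> carrier (Mat n R)"
    and matrix_column_mult_elementary:
      "A \<in> carrier (Mat n R) \<Longrightarrow> k < n \<Longrightarrow> l < n \<Longrightarrow>
        matrix_column n (A \<otimes>\<^bsub>Mat n R\<^esub> elementary_matrix R n k j r) l =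
        (if l = j then r \<odot>\<^bsub>free_module R {..<n}\<^esub> matrix_column n A k else \<zero>\<^bsub>free_module R {..<n}\<^esub>)"
proof -
  let ?F = "free_module R {..<n}"
  note F = right_module_free[OF R, of "{..<n}"]
  interpret F: right_module R ?F by (rule F)
  have e: "r \<odot>\<^bsub>?F\<^esub> unit_vector R {..<n} k \<in> carrier ?F"
    by (rule F.smult_closed[OF r unit_vector_closed[OF R]])
  show E: "elementary_matrix R n k j r \<in> carrier (Mat n R)"
    unfolding elementary_matrix_def by (rule matrix_of_columns_closed) (simp add: e)
  assume A: "A \<in> carrier (Mat n R)" and k: "k < n" and l: "l < n"
  note f = matrix_map_hom[OF R A]
  have "matrix_column n (elementary_matrix R n k j r) l =
      (if l = j then r \<odot>\<^bsub>?F\<^esub> unit_vector R {..<n} k else \<zero>\<^bsub>?F\<^esub>)"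
    unfolding elementary_matrix_def by (rule matrix_column_of_columns[OF l, where R = R]) (simp add: e)
  then show "matrix_column n (A \<otimes>\<^bsub>Mat n R\<^esub> elementary_matrix R n k j r) l =
      (if l = j then r \<odot>\<^bsub>?F\<^esub> matrix_column n A k else \<zero>\<^bsub>?F\<^esub>)"
    by (simp add: matrix_column_mult[OF R A E l] module_hom_zero[OF F F f]
        module_hom_smult[OF f r unit_vector_closed[OF R]] matrix_map_unit_vector[OF R A k])
qed

text \<open>
  The right ideals of the matrix ring correspond to the submodules of the free module: a submodule
  \<open>K\<close> gives the ideal of all matrices with columns in \<open>K\<close>, and a right ideal is recovered from the
  first columns of its members, as its members may be multiplied by elementary matrices.
\<close>

definition matrices_with_columns_in ::
    "('r, 'k) ring_scheme \<Rightarrow> nat \<Rightarrow> (nat \<Rightarrow> 'r) set \<Rightarrow> (nat \<times> nat \<Rightarrow> 'r) set" where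
  "matrices_with_columns_in R n K = {A \<in> carrier (Mat n R). \<forall>j < n. matrix_column n A j \<in> K}"

lemma submodule_matrices_with_columns_in:
  assumes R: "ring R" and n: "n \<ge> 1" and K: "submodule K R (free_module R {..<n})"
  shows "submodule (matrices_with_columns_in R n K) (Mat n R) (regular_module (Mat n R))"
    and "(\<lambda>A. matrix_column n A 0) ` matrices_with_columns_in R n K = K"
proof -
  let ?F = "free_module R {..<n}"
  note F = right_module_free[OF R, of "{..<n}"]
  interpret F: right_module R ?F by (rule F)
  interpret S: ring "Mat n R" by (rule ring_Mat[OF R])
  interpret SS: right_module "Mat n R" "regular_module (Mat n R)"
    by (rule right_module_regular[OF ring_Mat[OF R]])
  have c: "K \<subseteq> carrier ?F" "\<zero>\<^bsub>?F\<^esub> \<in> K" "\<And>x y. x \<in> K \<Longrightarrow> y \<in> K \<Longrightarrow> x \<oplus>\<^bsub>?F\<^esub> y \<in> K"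
    "\<And>r x. r \<in> carrier R \<Longrightarrow> x \<in> K \<Longrightarrow> r \<odot>\<^bsub>?F\<^esub> x \<in> K"
    using K by (auto simp: F.submodule_iff)
  have mult: "matrix_column n (A \<otimes>\<^bsub>Mat n R\<^esub> B) j \<in> K"
    if A: "A \<in> carrier (Mat n R)" and AK: "\<forall>j < n. matrix_column n A j \<in> K"
      and B: "B \<in> carrier (Mat n R)" and j: "j < n" for A B j
    unfolding matrix_column_mult[OF R A B j] matrix_map_def free_extension_def
    by (rule F.submodule_finsum[OF K])
       (use AK free_module_entry[OF matrix_column_closed[OF B j]] c(4) in auto)
  show "submodule (matrices_with_columns_in R n K) (Mat n R) (regular_module (Mat n R))"
    unfolding SS.submodule_iff
    using c(2,3) mult
    by (auto simp: matrices_with_columns_in_def regular_module_def matrix_column_add matrix_column_zero)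
  show "(\<lambda>A. matrix_column n A 0) ` matrices_with_columns_in R n K = K"
  proof (intro equalityI subsetI)
    fix x assume x: "x \<in> K"
    let ?c = "\<lambda>j :: nat. if j = 0 then x else \<zero>\<^bsub>?F\<^esub>"
    have cj: "?c j \<in> carrier ?F" "?c j \<in> K" for j using x c by auto
    have col: "matrix_column n (matrix_of_columns n ?c) j = ?c j" if "j < n" for j
      using matrix_column_of_columns[OF that, of ?c R] cj(1) by simp
    have "matrix_of_columns n ?c \<in> matrices_with_columns_in R n K"
      using matrix_of_columns_closed[of n ?c R] cj col by (simp add: matrices_with_columns_in_def)
    moreover have "x = matrix_column n (matrix_of_columns n ?c) 0"
      using col[of 0] n by simp
    ultimately show "x \<in> (\<lambda>A. matrix_column n A 0) ` matrices_with_columns_in R n K"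
      by (rule rev_image_eqI[where f = "\<lambda>A. matrix_column n A 0"])
  qed (use n in \<open>auto simp: matrices_with_columns_in_def\<close>)
qed

lemma submodule_first_columns:
  assumes R: "ring R" and n: "n \<ge> 1" and J: "submodule J (Mat n R) (regular_module (Mat n R))"
  shows "submodule ((\<lambda>A. matrix_column n A 0) ` J) R (free_module R {..<n})"
    and "matrices_with_columns_in R n ((\<lambda>A. matrix_column n A 0) ` J) = J"
proof -
  let ?F = "free_module R {..<n}" and ?d = "(\<lambda>A. matrix_column n A 0) ` J" and ?E = "elementary_matrix R n"
  note F = right_module_free[OF R, of "{..<n}"]
  interpret ring R by fact
  interpret F: right_module R ?F by (rule F)
  interpret S: ring "Mat n R" by (rule ring_Mat[OF R])
  interpret SS: right_module "Mat n R" "regular_module (Mat n R)"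
    by (rule right_module_regular[OF ring_Mat[OF R]])
  have n0: "0 < n" using n by simp
  have c: "J \<subseteq> carrier (Mat n R)" "\<zero>\<^bsub>Mat n R\<^esub> \<in> J"
    "\<And>A B. A \<in> J \<Longrightarrow> B \<in> J \<Longrightarrow> A \<oplus>\<^bsub>Mat n R\<^esub> B \<in> J"
    "\<And>A B. A \<in> J \<Longrightarrow> B \<in> carrier (Mat n R) \<Longrightarrow> A \<otimes>\<^bsub>Mat n R\<^esub> B \<in> J"
    using J unfolding SS.submodule_iff by (auto simp: regular_module_def)
  note JS = subsetD[OF c(1)]
  show sub: "submodule ?d R ?F"
    unfolding F.submodule_iff
  proof (intro conjI ballI)
    show "?d \<subseteq> carrier ?F" using JS matrix_column_closed n0 by blast
    show "\<zero>\<^bsub>?F\<^esub> \<in> ?d"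
      by (rule image_eqI[OF _ c(2)]) (simp add: matrix_column_zero[OF n0])
  next
    fix x y assume "x \<in> ?d" "y \<in> ?d"
    then obtain A B where AB: "A \<in> J" "B \<in> J" "x = matrix_column n A 0" "y = matrix_column n B 0" by blast
    show "x \<oplus>\<^bsub>?F\<^esub> y \<in> ?d"
      by (rule image_eqI[OF _ c(3)[OF AB(1,2)]]) (simp add: matrix_column_add[OF n0] AB)
  next
    fix r x assume r: "r \<in> carrier R" and "x \<in> ?d"
    then obtain A where A: "A \<in> J" "x = matrix_column n A 0" by blast
    show "r \<odot>\<^bsub>?F\<^esub> x \<in> ?d"
      by (rule image_eqI[OF _ c(4)[OF A(1) elementary_matrix_closed[OF R r, of n 0 0]]])
         (simp add: matrix_column_mult_elementary[OF R r JS[OF A(1)] n0 n0] A)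
  qed
  show "matrices_with_columns_in R n ?d = J"
  proof (intro equalityI subsetI)
    fix A assume A: "A \<in> J"
    have "matrix_column n A j \<in> ?d" if j: "j < n" for j
    proof (rule image_eqI[OF _ c(4)[OF A elementary_matrix_closed[OF R one_closed, of n j 0]]])
      show "matrix_column n A j = matrix_column n (A \<otimes>\<^bsub>Mat n R\<^esub> ?E j 0 \<one>\<^bsub>R\<^esub>) 0"
        using F.smult_one[OF matrix_column_closed[OF JS[OF A] j]]
        by (simp add: matrix_column_mult_elementary[OF R one_closed JS[OF A] j n0])
    qed
    then show "A \<in> matrices_with_columns_in R n ?d"
      using JS[OF A] by (simp add: matrices_with_columns_in_def)
  next
    fix A assume "A \<in> matrices_with_columns_in R n ?d"
    then have A: "A \<in> carrier (Mat n R)" and "\<forall>j < n. \<exists>C \<in> J. matrix_column n A j = matrix_column n C 0"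
      by (auto simp: matrices_with_columns_in_def image_iff)
    then obtain C where C: "\<And>j. j < n \<Longrightarrow> C j \<in> J" "\<And>j. j < n \<Longrightarrow> matrix_column n (C j) 0 = matrix_column n A j"
      by metis
    \<comment> \<open>\<open>T m\<close> consists of the first \<open>m\<close> columns of \<open>A\<close>, followed by zeros; these matrices are built up
      inside \<open>J\<close> by moving the first column of \<open>C m\<close> to position \<open>m\<close>.\<close>
    let ?c = "\<lambda>m j. if j < m then matrix_column n A j else \<zero>\<^bsub>?F\<^esub>"
    define T where "T m = matrix_of_columns n (?c m)" for m
    have cF: "?c m j \<in> carrier ?F" if "j < n" for m j
      using matrix_column_closed[OF A that] by simp
    have T: "T m \<in> carrier (Mat n R)" for m
      unfolding T_def by (rule matrix_of_columns_closed) (rule cF)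
    have Tcol: "matrix_column n (T m) j = ?c m j" if "j < n" for m j
      unfolding T_def by (rule matrix_column_of_columns[OF that]) (rule cF[OF that])
    have "T m \<in> J" if "m \<le> n" for m
      using that
    proof (induction m)
      case 0
      have "T 0 = \<zero>\<^bsub>Mat n R\<^esub>"
        by (rule matrix_eqI[OF T S.zero_closed]) (simp add: Tcol matrix_column_zero)
      then show ?case using c(2) by simp
    next
      case (Suc m)
      then have m: "m < n" by simp
      note Cm = C(1)[OF m]
      have Em: "C m \<otimes>\<^bsub>Mat n R\<^esub> ?E 0 m \<one>\<^bsub>R\<^esub> \<in> J"
        by (rule c(4)[OF Cm elementary_matrix_closed[OF R one_closed]])
      have "T (Suc m) = T m \<oplus>\<^bsub>Mat n R\<^esub> C m \<otimes>\<^bsub>Mat n R\<^esub> ?E 0 m \<one>\<^bsub>R\<^esub>"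
      proof (rule matrix_eqI[OF T S.a_closed[OF T JS[OF Em]]])
        fix j assume j: "j < n"
        have Aj: "matrix_column n A j \<in> carrier ?F" by (rule matrix_column_closed[OF A j])
        show "matrix_column n (T (Suc m)) j = matrix_column n (T m \<oplus>\<^bsub>Mat n R\<^esub> C m \<otimes>\<^bsub>Mat n R\<^esub> ?E 0 m \<one>\<^bsub>R\<^esub>) j"
          unfolding matrix_column_add[OF j] Tcol[OF j]
            matrix_column_mult_elementary[OF R one_closed JS[OF Cm] n0 j] C(2)[OF m]
          using Aj F.smult_one[OF Aj] by (auto simp: less_Suc_eq)
      qed
      then show ?case using c(3)[OF Suc.IH Em] m by simp
    qed
    moreover have "T n = A"
      by (rule matrix_eqI[OF T A]) (simp add: Tcol)
    ultimately show "A \<in> J" by blast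
  qed
qed

text \<open>A product \<open>A B\<close> vanishes when the map with matrix \<open>A\<close> kills every column of \<open>B\<close>.\<close>

lemma right_annihilator_matrix:
  assumes R: "ring R" and A: "A \<in> carrier (Mat n R)"
  shows "right_annihilator (Mat n R) (regular_module (Mat n R)) A =
    matrices_with_columns_in R n (a_kernel (free_module R {..<n}) (free_module R {..<n}) (matrix_map R n A))"
proof -
  interpret S: ring "Mat n R" by (rule ring_Mat[OF R])
  have "A \<otimes>\<^bsub>Mat n R\<^esub> B = \<zero>\<^bsub>Mat n R\<^esub> \<longleftrightarrow>
      (\<forall>j < n. matrix_map R n A (matrix_column n B j) = \<zero>\<^bsub>free_module R {..<n}\<^esub>)"
    if B: "B \<in> carrier (Mat n R)" for B
  proof
    assume *: "\<forall>j < n. matrix_map R n A (matrix_column n B j) = \<zero>\<^bsub>free_module R {..<n}\<^esub>"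
    show "A \<otimes>\<^bsub>Mat n R\<^esub> B = \<zero>\<^bsub>Mat n R\<^esub>"
      by (rule matrix_eqI[OF S.m_closed[OF A B] S.zero_closed])
         (simp add: matrix_column_mult[OF R A B] matrix_column_zero *)
  qed (simp add: matrix_column_mult[OF R A B, symmetric] matrix_column_zero)
  then show ?thesis
    by (auto simp: right_annihilator_def matrices_with_columns_in_def a_kernel_mem regular_module_def
        matrix_column_closed)
qed

lemma endomorphism_eq_matrix_map:
  assumes R: "ring R" and f: "f \<in> module_hom R (free_module R {..<n}) (free_module R {..<n})"
  obtains A where "A \<in> carrier (Mat n R)"
    and "\<And>v. v \<in> carrier (free_module R {..<n}) \<Longrightarrow> f v = matrix_map R n A v"
proof
  let ?F = "free_module R {..<n}"
  note F = right_module_free[OF R, of "{..<n}"]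
  let ?A = "matrix_of_columns n (\<lambda>j. f (unit_vector R {..<n} j))"
  have fe: "f (unit_vector R {..<n} j) \<in> carrier ?F" for j
    by (rule module_hom_closed[OF f unit_vector_closed[OF R]])
  show A: "?A \<in> carrier (Mat n R)" by (rule matrix_of_columns_closed) (rule fe)
  have col: "matrix_column n ?A j = f (unit_vector R {..<n} j)" if "j < n" for j
    by (rule matrix_column_of_columns[OF that fe])
  fix v assume v: "v \<in> carrier ?F"
  have "f v = free_extension R ?F {..<n} (\<lambda>j. f (unit_vector R {..<n} j)) v"
    by (rule free_module_hom_expansion[OF F f v])
  also have "\<dots> = matrix_map R n ?A v"
    unfolding matrix_map_def
    by (rule free_extension_cong[OF F _ v])
       (use fe col in auto)
  finally show "f v = matrix_map R n ?A v" .
qed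

lemma CS_Rickart_free_iff_right_ACS_Mat:
  assumes R: "ring R" and n: "n \<ge> 1"
  shows "CS_Rickart R (free_module R {..<n}) \<longleftrightarrow> right_ACS (Mat n R)"
proof -
  let ?F = "free_module R {..<n}" and ?S = "Mat n R"
  note F = right_module_free[OF R, of "{..<n}"]
  have transfer: "essential_in_summand R ?F (a_kernel ?F ?F (matrix_map R n A)) \<longleftrightarrow>
      essential_in_summand ?S (regular_module ?S) (right_annihilator ?S (regular_module ?S) A)"
    if A: "A \<in> carrier ?S" for A
    unfolding right_annihilator_matrix[OF R A]
    by (rule essential_in_summand_order_isomorphism[OF F right_module_regular[OF ring_Mat[OF R]],
          where d = "\<lambda>J. (\<lambda>A. matrix_column n A 0) ` J"])
       (use submodule_matrices_with_columns_in[OF R n] submodule_first_columns[OF R n]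
          submodule_a_kernel[OF F F matrix_map_hom[OF R A]] in
        \<open>auto simp: matrices_with_columns_in_def\<close>)
  show ?thesis
  proof
    assume "CS_Rickart R ?F"
    then show "right_ACS ?S"
      using transfer matrix_map_hom[OF R] by (auto simp: CS_Rickart_def right_ACS_def)
  next
    assume ACS: "right_ACS ?S"
    show "CS_Rickart R ?F"
      unfolding CS_Rickart_def
    proof
      fix f assume f: "f \<in> module_hom R ?F ?F"
      obtain A where A: "A \<in> carrier ?S" "\<And>v. v \<in> carrier ?F \<Longrightarrow> f v = matrix_map R n A v"
        using endomorphism_eq_matrix_map[OF R f] by blast
      have "a_kernel ?F ?F f = a_kernel ?F ?F (matrix_map R n A)"
        using A(2) by (auto simp: a_kernel_mem)
      then show "essential_in_summand R ?F (a_kernel ?F ?F f)"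
        using transfer[OF A(1)] ACS A(1) by (simp add: right_ACS_def)
    qed
  qed
qed

section \<open>The equivalences\<close>

lemma n_generated_free_module:
  assumes "ring R"
  shows "n_generated R n (free_module R {..<n})"
  unfolding n_generated_iff_image_of_free[OF right_module_free[OF assms]]
  by (rule bexI[of _ "\<lambda>x. x"]) (auto intro: module_homI)

text \<open>
  A surjection from the free module onto \<open>M\<close> splits, so \<open>M\<close> is a retract of the free module as
  the domain of maps, and embeds into it as the codomain.
\<close>

lemma CS_Rickart_of_n_generated_projective:
  assumes R: "ring R" and F: "CS_Rickart R (free_module R {..<n})"
    and M: "right_module R M" and proj: "projective R M" and gen: "n_generated R n M"
  shows "CS_Rickart R M"
proof -
  let ?F = "free_module R {..<n}"
  note F' = right_module_free[OF R, of "{..<n}"]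
  obtain p where p: "p \<in> module_hom R ?F M" "p ` carrier ?F = carrier M"
    using gen unfolding n_generated_iff_image_of_free[OF M] by blast
  obtain s where s: "s \<in> module_hom R M ?F" "\<And>x. x \<in> carrier M \<Longrightarrow> p (s x) = x"
    using projective_lifting[OF M proj F' M p module_homI, of "\<lambda>x. x"] by auto
  have inj: "inj_on s (carrier M)" by (rule inj_on_inverseI) (rule s(2))
  have "relatively_CS_Rickart R M ?F"
    by (rule relatively_CS_Rickart_retract[OF F' M F' p(1) s(1)])
       (use F s(2) in \<open>simp_all add: CS_Rickart_iff\<close>)
  then show ?thesis
    unfolding CS_Rickart_iff by (rule relatively_CS_Rickart_embedding[OF M F' s(1) inj])
qed

lemma first_coordinate_embedding:
  assumes R: "ring R" and n: "(n :: nat) \<ge> 1"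
  shows "\<exists>i \<in> module_hom R (regular_module R) (free_module R {..<n}). inj_on i (carrier (regular_module R))"
proof -
  interpret ring R by fact
  have "(\<lambda>x. \<lambda>j \<in> {..<n}. if j = 0 then x else \<zero>\<^bsub>R\<^esub>) \<in> module_hom R (regular_module R) (free_module R {..<n})"
    by (rule module_homI) (auto simp: regular_module_def free_module_def fun_eq_iff)
  moreover have "inj_on (\<lambda>x. \<lambda>j \<in> {..<n}. if j = 0 then x else \<zero>\<^bsub>R\<^esub>) (carrier (regular_module R))"
    using n by (auto simp: inj_on_def dest: fun_cong[of _ _ 0])
  ultimately show ?thesis by blast
qed

text \<open>
  The common kernel of the coordinates of \<open>f\<close> is the kernel of \<open>f\<close>, so the chain of summands of
  \<open>common_kernel_chain\<close> ends in a summand in which the kernel of \<open>f\<close> is essential.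
\<close>

lemma coordinate_kernel_chain:
  assumes R: "ring R" and F: "relatively_CS_Rickart R (free_module R {..<n}) (regular_module R)"
    and f: "f \<in> module_hom R (free_module R {..<n}) (free_module R {..<n})"
  shows "\<exists>D E. D 0 = carrier (free_module R {..<n}) \<and>
    (\<forall>i < n. direct_sum R (free_module R {..<n}) (E i) (D (Suc i)) (D i) \<and> inj_on (\<lambda>x. f x i) (E i)) \<and>
    direct_summand R (free_module R {..<n}) (D n) \<and>
    essential R ((free_module R {..<n})\<lparr>carrier := D n\<rparr>)
      (a_kernel (free_module R {..<n}) (free_module R {..<n}) f)"
proof -
  let ?F = "free_module R {..<n}"
  note F' = right_module_free[OF R, of "{..<n}"] and R' = right_module_regular[OF R]
  interpret F: right_module R ?F by (rule F')
  have hom: "(\<lambda>x. f x i) \<in> module_hom R ?F (regular_module R)" if "i < n" for i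
    by (rule module_hom_compose[OF f free_module_coordinate_hom]) (simp add: that)
  have "f x = \<zero>\<^bsub>?F\<^esub> \<longleftrightarrow> (\<forall>i < n. f x i = \<zero>\<^bsub>regular_module R\<^esub>)" if x: "x \<in> carrier ?F" for x
  proof
    assume "\<forall>i < n. f x i = \<zero>\<^bsub>regular_module R\<^esub>"
    then show "f x = \<zero>\<^bsub>?F\<^esub>"
      by (intro free_module_eqI[OF module_hom_closed[OF f x] F.M.zero_closed])
         (simp add: free_module_zero_entry regular_module_def)
  qed (simp add: free_module_zero_entry regular_module_def)
  then have "{x \<in> carrier ?F. \<forall>i < n. f x i = \<zero>\<^bsub>regular_module R\<^esub>} = a_kernel ?F ?F f"
    by (simp add: set_eq_iff a_kernel_mem cong: conj_cong)
  then show ?thesis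
    using common_kernel_chain[OF F' R' F, of n "\<lambda>i x. f x i"] hom by simp
qed

lemma CS_Rickart_free_iff_relative:
  assumes R: "ring R" and n: "(n :: nat) \<ge> 1"
  shows "CS_Rickart R (free_module R {..<n}) \<longleftrightarrow>
    relatively_CS_Rickart R (free_module R {..<n}) (regular_module R)"
proof
  let ?F = "free_module R {..<n}"
  assume "CS_Rickart R ?F"
  then show "relatively_CS_Rickart R ?F (regular_module R)"
    unfolding CS_Rickart_iff
    using first_coordinate_embedding[OF R n]
      relatively_CS_Rickart_embedding[OF right_module_regular[OF R] right_module_free[OF R]] by blast
next
  let ?F = "free_module R {..<n}"
  assume *: "relatively_CS_Rickart R ?F (regular_module R)"
  show "CS_Rickart R ?F"
    unfolding CS_Rickart_def essential_in_summand_def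
    using coordinate_kernel_chain[OF R *] by blast
qed

text \<open>
  The submodule is the image of an endomorphism \<open>f\<close>.  Applying \<open>f\<close> to the chain of summands keeps
  every step direct, since the kernel of \<open>f\<close> lies in the last member and hence in all of them.
\<close>

lemma direct_sum_family_decomposition:
  assumes R: "ring R" and F: "relatively_CS_Rickart R (free_module R {..<n}) (regular_module R)"
    and N: "submodule N R (free_module R {..<n})"
    and gen: "n_generated R n ((free_module R {..<n})\<lparr>carrier := N\<rparr>)"
  shows "\<exists>P S. direct_sum_family R (free_module R {..<n}) {..n} (P(n := S)) N \<and>
    (\<forall>i < n. projective R ((free_module R {..<n})\<lparr>carrier := P i\<rparr>) \<and>
       (\<exists>J. submodule J R (regular_module R) \<and>
            module_iso R ((free_module R {..<n})\<lparr>carrier := P i\<rparr>)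
                         ((regular_module R)\<lparr>carrier := J\<rparr>))) \<and>
    singular R ((free_module R {..<n})\<lparr>carrier := S\<rparr>)"
proof -
  let ?F = "free_module R {..<n}"
  note F' = right_module_free[OF R, of "{..<n}"] and R' = right_module_regular[OF R]
  interpret F: right_module R ?F by (rule F')
  obtain f where f: "f \<in> module_hom R ?F ?F" and im: "f ` carrier ?F = N"
  proof -
    obtain g where g: "g \<in> module_hom R ?F (?F\<lparr>carrier := N\<rparr>)" "g ` carrier ?F = N"
      using gen n_generated_iff_image_of_free[OF F.right_module_submodule[OF N], of n] by auto
    have "g \<in> module_hom R ?F ?F"
      using module_hom_compose[OF g(1) module_hom_inclusion] N by (simp add: F.submodule_iff)
    then show thesis using g(2) that by blast
  qed
  obtain D E where 0: "D 0 = carrier ?F"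
    and chain: "\<And>i. i < n \<Longrightarrow> direct_sum R ?F (E i) (D (Suc i)) (D i)"
    and inj: "\<And>i. i < n \<Longrightarrow> inj_on (\<lambda>x. f x i) (E i)"
    and Dn: "direct_summand R ?F (D n)"
    and ess: "essential R (?F\<lparr>carrier := D n\<rparr>) (a_kernel ?F ?F f)"
    using coordinate_kernel_chain[OF R F f] by blast
  have subDn: "submodule (D n) R ?F" using Dn by (auto simp: direct_summand_def direct_sum_def)
  have kerDn: "a_kernel ?F ?F f \<subseteq> D n" using ess F.essential_in_submodule_iff[OF subDn] by blast

  have summandD: "direct_summand R ?F (D i)" if "i \<le> n" for i
    using that
  proof (induction i)
    case 0
    have "direct_sum R ?F (carrier ?F) {\<zero>\<^bsub>?F\<^esub>} (carrier ?F)"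
      by (rule F.direct_sum_zero[OF F.submodule_carrier])
    then show ?case using \<open>D 0 = carrier ?F\<close> by (auto simp: direct_summand_def)
  next
    case (Suc i)
    then show ?case
      using direct_summand_trans[OF F' _ F.direct_sum_commute[OF chain[of i]]] by simp
  qed
  have sub: "D n \<subseteq> D i" if "i \<le> n" for i
    using that
  proof (induction rule: inc_induct)
    case (step i)
    then show ?case using F.direct_sum_subset(2)[OF chain[of i]] by blast
  qed simp
  have chain': "direct_sum R ?F (f ` E i) (f ` D (Suc i)) (f ` D i)" if i: "i < n" for i
  proof (rule direct_sum_image[OF F' F' f chain[OF i]])
    fix x assume "x \<in> D i" "f x = \<zero>\<^bsub>?F\<^esub>"
    then have "x \<in> a_kernel ?F ?F f"
      using summandD[of i] i by (auto simp: a_kernel_mem direct_summand_def direct_sum_def F.submodule_iff)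
    then show "x \<in> D (Suc i)" using kerDn sub[of "Suc i"] i by auto
  qed
  have "direct_sum_family R ?F {0..n} ((\<lambda>i. f ` E i)(n := f ` D n)) (f ` D 0)"
    by (rule F.direct_sum_family_of_chain[OF chain' submodule_image[OF F' F' f subDn]]) simp_all
  then have family: "direct_sum_family R ?F {..n} ((\<lambda>i. f ` E i)(n := f ` D n)) N"
    by (simp add: 0 im atLeast0AtMost)
  have "projective R (?F\<lparr>carrier := f ` E i\<rparr>) \<and> (\<exists>J. submodule J R (regular_module R) \<and>
      module_iso R (?F\<lparr>carrier := f ` E i\<rparr>) ((regular_module R)\<lparr>carrier := J\<rparr>))" if i: "i < n" for i
  proof
    have subE: "submodule (E i) R ?F" using chain[OF i] by (simp add: direct_sum_def)
    have "inj_on f (E i)" using inj[OF i] by (auto simp: inj_on_def)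
    moreover have "direct_summand R ?F (E i)"
      using direct_summand_trans[OF F' summandD chain] i by simp
    ultimately show "projective R (?F\<lparr>carrier := f ` E i\<rparr>)"
      using projective_iso_image[OF F' F' f subE] projective_direct_summand[OF F' projective_free[OF R]]
      by blast
    let ?c = "\<lambda>v :: nat \<Rightarrow> 'a. v i"
    have c: "?c \<in> module_hom R ?F (regular_module R)"
      by (rule free_module_coordinate_hom) (simp add: i)
    have sub': "submodule (f ` E i) R ?F" by (rule submodule_image[OF F' F' f subE])
    have "?c \<in> module_hom R (?F\<lparr>carrier := f ` E i\<rparr>) ((regular_module R)\<lparr>carrier := ?c ` f ` E i\<rparr>)"
      by (rule module_hom_restrict_codomain[OF module_hom_restrict_domain[OF c]])
         (use sub' in \<open>auto simp: F.submodule_iff\<close>)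
    moreover have "bij_betw ?c (f ` E i) (?c ` f ` E i)"
      using inj[OF i] by (auto simp: bij_betw_def inj_on_def)
    ultimately have "module_iso R (?F\<lparr>carrier := f ` E i\<rparr>) ((regular_module R)\<lparr>carrier := ?c ` f ` E i\<rparr>)"
      by (auto simp: module_iso_def)
    then show "\<exists>J. submodule J R (regular_module R) \<and>
        module_iso R (?F\<lparr>carrier := f ` E i\<rparr>) ((regular_module R)\<lparr>carrier := J\<rparr>)"
      using submodule_image[OF F' R' c sub'] by blast
  qed
  then show ?thesis
    using family singular_image[OF F' F' f subDn ess]
    by (intro exI[of _ "\<lambda>i. f ` E i"] exI[of _ "f ` D n"]) blast
qed

text \<open>
  For a map to the ring itself there is only one coordinate, and a single splitting is enough.
\<close>

lemma direct_sum_decomposition: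
  assumes R: "ring R" and F: "relatively_CS_Rickart R (free_module R {..<n}) (regular_module R)"
    and I: "submodule I R (regular_module R)" and gen: "n_generated R n ((regular_module R)\<lparr>carrier := I\<rparr>)"
  shows "\<exists>P S. direct_sum R (regular_module R) P S I \<and>
    projective R ((regular_module R)\<lparr>carrier := P\<rparr>) \<and> singular R ((regular_module R)\<lparr>carrier := S\<rparr>)"
proof -
  let ?F = "free_module R {..<n}" and ?R = "regular_module R"
  note F' = right_module_free[OF R, of "{..<n}"] and R' = right_module_regular[OF R]
  interpret F: right_module R ?F by (rule F')
  interpret RR: right_module R ?R by (rule R')
  obtain f where f: "f \<in> module_hom R ?F ?R" and im: "f ` carrier ?F = I"
  proof -
    obtain g where g: "g \<in> module_hom R ?F (?R\<lparr>carrier := I\<rparr>)" "g ` carrier ?F = I"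
      using gen n_generated_iff_image_of_free[OF RR.right_module_submodule[OF I], of n] by auto
    have "g \<in> module_hom R ?F ?R"
      using module_hom_compose[OF g(1) module_hom_inclusion] I by (simp add: RR.submodule_iff)
    then show thesis using g(2) that by blast
  qed
  have "essential_in_summand R ?F (a_kernel ?F ?R f)"
    using F f by (simp add: relatively_CS_Rickart_def)
  then obtain D E where DE: "direct_sum R ?F D E (carrier ?F)"
    and ess: "essential R (?F\<lparr>carrier := D\<rparr>) (a_kernel ?F ?R f)" and inj: "inj_on f E"
    by (rule kernel_splitting[OF F' R' f])
  have sub: "submodule D R ?F" "submodule E R ?F" using DE by (auto simp: direct_sum_def)
  note ED = F.direct_sum_commute[OF DE]
  have "x \<in> D" if "x \<in> carrier ?F" "f x = \<zero>\<^bsub>?R\<^esub>" for x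
    using that ess F.essential_in_submodule_iff[OF sub(1)] by (auto simp: a_kernel_mem)
  then have "direct_sum R ?R (f ` E) (f ` D) I"
    using direct_sum_image[OF F' R' f ED] im by simp
  moreover have "projective R (?R\<lparr>carrier := f ` E\<rparr>)"
    using projective_iso_image[OF F' R' f sub(2) inj] projective_direct_summand[OF F' projective_free[OF R]] ED
    unfolding direct_summand_def by blast
  ultimately show ?thesis
    using singular_image[OF F' R' f sub(1) ess] by blast
qed

lemma n_generated_image:
  assumes R: "ring R" and N: "right_module R N" and f: "f \<in> module_hom R (free_module R {..<n}) N"
  shows "submodule (f ` carrier (free_module R {..<n})) R N"
    and "n_generated R n (N\<lparr>carrier := f ` carrier (free_module R {..<n})\<rparr>)"
proof -
  let ?F = "free_module R {..<n}"
  note F = right_module_free[OF R, of "{..<n}"]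
  interpret N: right_module R N by fact
  interpret F: right_module R ?F by (rule F)
  show sub: "submodule (f ` carrier ?F) R N"
    by (rule submodule_image[OF F N f F.submodule_carrier])
  show "n_generated R n (N\<lparr>carrier := f ` carrier ?F\<rparr>)"
    unfolding n_generated_iff_image_of_free[OF N.right_module_submodule[OF sub]]
    by (rule bexI[OF _ module_hom_restrict_codomain[OF f]]) auto
qed

lemma relatively_CS_Rickart_of_decomposition:
  assumes R: "ring R"
    and dec: "\<And>I. submodule I R (regular_module R) \<Longrightarrow> n_generated R n ((regular_module R)\<lparr>carrier := I\<rparr>) \<Longrightarrow>
      \<exists>P S. direct_sum R (regular_module R) P S I \<and>
        projective R ((regular_module R)\<lparr>carrier := P\<rparr>) \<and> singular R ((regular_module R)\<lparr>carrier := S\<rparr>)"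
  shows "relatively_CS_Rickart R (free_module R {..<n}) (regular_module R)"
  unfolding relatively_CS_Rickart_def
proof
  note R' = right_module_regular[OF R]
  fix f assume f: "f \<in> module_hom R (free_module R {..<n}) (regular_module R)"
  show "essential_in_summand R (free_module R {..<n}) (a_kernel (free_module R {..<n}) (regular_module R) f)"
    using dec[OF n_generated_image[OF R R' f]] kernel_essential_in_summand[OF R' f] by blast
qed

lemma CS_Rickart_of_family_decomposition:
  assumes R: "ring R"
    and dec: "\<And>N. submodule N R (free_module R {..<n}) \<Longrightarrow>
      n_generated R n ((free_module R {..<n})\<lparr>carrier := N\<rparr>) \<Longrightarrow>
      \<exists>P S. direct_sum_family R (free_module R {..<n}) {..n} (P(n := S)) N \<and>
        (\<forall>i < n. projective R ((free_module R {..<n})\<lparr>carrier := P i\<rparr>)) \<and>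
        singular R ((free_module R {..<n})\<lparr>carrier := S\<rparr>)"
  shows "CS_Rickart R (free_module R {..<n})"
  unfolding CS_Rickart_def
proof
  let ?F = "free_module R {..<n}"
  note F' = right_module_free[OF R, of "{..<n}"]
  interpret F: right_module R ?F by (rule F')
  fix f assume f: "f \<in> module_hom R ?F ?F"
  obtain P S where PS: "direct_sum_family R ?F {..n} (P(n := S)) (f ` carrier ?F)"
    and P: "\<And>i. i < n \<Longrightarrow> projective R (?F\<lparr>carrier := P i\<rparr>)" and S: "singular R (?F\<lparr>carrier := S\<rparr>)"
    using dec[OF n_generated_image[OF R F' f]] by blast
  have "{..n} = insert n {..<n}" by auto
  then obtain B where B: "direct_sum_family R ?F {..<n} (P(n := S)) B"
    and SB: "direct_sum R ?F ((P(n := S)) n) B (f ` carrier ?F)"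
    using PS F.direct_sum_family_insert[of "{..<n}" n "P(n := S)"] by auto
  have "projective R (?F\<lparr>carrier := B\<rparr>)"
    by (rule projective_direct_sum_family[OF F' _ B]) (use P in auto)
  moreover have "direct_sum R ?F B S (f ` carrier ?F)"
    using F.direct_sum_commute[OF SB] by simp
  ultimately show "essential_in_summand R ?F (a_kernel ?F ?F f)"
    using kernel_essential_in_summand[OF F' f] S by blast
qed

theorem theorem4p3:
  fixes R :: "('r, 'k) ring_scheme" and n :: nat
  assumes "ring R" and "\<one>\<^bsub>R\<^esub> \<noteq> \<zero>\<^bsub>R\<^esub>" and "n \<ge> 1"
  shows "all_equivalent [
    (\<forall>M :: ('r, 'm) module.
       right_module R M \<and> projective R M \<and> n_generated R n M \<longrightarrow> CS_Rickart R M) \<and>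
    (\<forall>M :: ('r, nat \<Rightarrow> 'r) module.
       right_module R M \<and> projective R M \<and> n_generated R n M \<longrightarrow> CS_Rickart R M),
    CS_Rickart R (free_module R {..<n}),
    right_ACS (Mat n R),
    \<forall>I. submodule I R (regular_module R) \<and> n_generated R n ((regular_module R)\<lparr>carrier := I\<rparr>) \<longrightarrow>
      (\<exists>P S. direct_sum R (regular_module R) P S I \<and>
             projective R ((regular_module R)\<lparr>carrier := P\<rparr>) \<and>
             singular R ((regular_module R)\<lparr>carrier := S\<rparr>)),
    relatively_CS_Rickart R (free_module R {..<n}) (regular_module R),
    \<forall>N. submodule N R (free_module R {..<n}) \<and>
        n_generated R n ((free_module R {..<n})\<lparr>carrier := N\<rparr>) \<longrightarrow>
      (\<exists>P S. direct_sum_family R (free_module R {..<n}) {..n} (P(n := S)) N \<and>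
             (\<forall>i < n. projective R ((free_module R {..<n})\<lparr>carrier := P i\<rparr>) \<and>
                (\<exists>J. submodule J R (regular_module R) \<and>
                     module_iso R ((free_module R {..<n})\<lparr>carrier := P i\<rparr>)
                                  ((regular_module R)\<lparr>carrier := J\<rparr>))) \<and>
             singular R ((free_module R {..<n})\<lparr>carrier := S\<rparr>))]"
  (is "all_equivalent [?proj1 \<and> ?proj2, ?free, ?acs, ?ideals, ?rel, ?submodules]")
proof -
  note R = \<open>ring R\<close> and n = \<open>n \<ge> 1\<close>
  have projI: "?proj1" "?proj2" if ?free
    using CS_Rickart_of_n_generated_projective[OF R that] by blast+
  have projD: ?free if ?proj2
    using that right_module_free[OF R] projective_free[OF R] n_generated_free_module[OF R] by blast
  have rel: "?free \<longleftrightarrow> ?rel" by (rule CS_Rickart_free_iff_relative[OF R n])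
  have idealsI: ?ideals if ?rel
    using direct_sum_decomposition[OF R that] by blast
  have idealsD: ?rel if ?ideals
    by (rule relatively_CS_Rickart_of_decomposition[OF R]) (use that in blast)
  have submodulesI: ?submodules if ?rel
    using direct_sum_family_decomposition[OF R that] by blast
  have submodulesD: ?free if ?submodules
    by (rule CS_Rickart_of_family_decomposition[OF R]) (use that in blast)
  have all: "all_equivalent [p, q, r, s, t, u]"
    if "p \<longleftrightarrow> q" "q \<longleftrightarrow> r" "s \<longleftrightarrow> t" "q \<longleftrightarrow> t" "u \<longleftrightarrow> q" for p q r s t u
    using that by (simp add: all_equivalent_def)
  show ?thesis
  proof (rule all)
    show "?proj1 \<and> ?proj2 \<longleftrightarrow> ?free" using projI projD by (intro iffI conjI) (erule conjE)
    show "?free \<longleftrightarrow> ?acs" by (rule CS_Rickart_free_iff_right_ACS_Mat[OF R n])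
    show "?ideals \<longleftrightarrow> ?rel" by (rule iffI[OF idealsD idealsI])
    show "?submodules \<longleftrightarrow> ?free" using submodulesI submodulesD rel by (intro iffI) simp_all
  qed (rule rel)
qed

end
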